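(* Let $a\ge0$ and let $X,X_1,X_2,\ldots$ be i.i.d. positive random variables with $\mathbb{E}[X]=1$ and $\mathbb{E}[|X|^3]<\infty$. Then there exists a centred Gaussian process (Gaussian random element) $W$ in $\mathbb{H}_a$ with covariance kernel \begin{align*} K(s,t)={}&\Psi_2(s\lor t)+st\,\mathbb{P}(X>s\lor t)-(s+t)\Psi_1(s\lor t)\\ &-\mathbb{P}(X>s)\left(\Psi_2(t)-t\Psi_1(t)\right)-\mathbb{P}(X>t)\left(\Psi_2(s)-s\Psi_1(s)\right)\\ &+\mathbb{V}(X)\,\mathbb{P}(X>s)\,\mathbb{P}(X>t)-z(s)z(t),\quad s,t>0, \end{align*} where $s\lor t=\max(s,t)$, $\mathbb{V}(X)$ is the variance of $X$, and $\Psi_\ell(s)=\mathbb{E}[(X-1)^\ell\mathbf{1}\{X>s\}]$, $s>0$, for $\ell=1,2$, such that $$W_n\stackrel{\mathcal{D}}{\longrightarrow}W\quad\text{in } \mathbb{H}_a \text{ as } n\to\infty,$$ where $\stackrel{\mathcal{D}}{\longrightarrow}$ denotes convergence in distribution.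
   Context: For $a\ge0$, $\mathbb{H}_a=L^2([0,\infty),\mathcal{B},\exp(-at)\,dt)$ is the separable Hilbert space of (equivalence classes of) measurable functions $f:[0,\infty)\to\mathbb{R}$ with $\int_0^\infty |f(t)|^2\exp(-at)\,dt<\infty$, where $\mathcal{B}$ is the Borel sigma-field on $[0,\infty)$, with scalar product $\langle f,g\rangle_{\mathbb{H}_a}=\int_0^\infty f(t)g(t)\exp(-at)\,dt$. A centred Gaussian process $W$ in $\mathbb{H}_a$ has covariance kernel $K$ if $\mathbb{E}[\langle W,f\rangle_{\mathbb{H}_a}\langle W,g\rangle_{\mathbb{H}_a}]=\int_0^\infty\int_0^\infty K(s,t)f(s)g(t)\exp(-a(s+t))\,ds\,dt$ for all $f,g\in\mathbb{H}_a$. Put $\overline{X}_n=\frac1n\sum_{j=1}^nX_j$, $$Z_n(y)=\frac1{\sqrt{n}}\sum_{j=1}^n(X_j-y-\overline{X}_n)\mathbf{1}\{X_j>y\},\qquad z(y)=\mathbb{E}\left[(X_1-y-1)\mathbf{1}\{X_1>y\}\right],\qquad y>0,$$ and $$W_n(y)=Z_n(y)-\sqrt{n}\,z(y),\quad y>0.$$ *)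

theory Defs
  imports "HOL-Probability.Probability"
begin

section \<open>The Hilbert space of square-integrable functions\<close>

definition l2_fun :: "'b measure \<Rightarrow> ('b \<Rightarrow> real) set" where
  "l2_fun L = {f \<in> borel_measurable L. integrable L (\<lambda>x. (f x)\<^sup>2)}"

definition l2_rel :: "'b measure \<Rightarrow> (('b \<Rightarrow> real) \<times> ('b \<Rightarrow> real)) set" where
  "l2_rel L = {(f, g). f \<in> l2_fun L \<and> g \<in> l2_fun L \<and> (AE x in L. f x = g x)}"

definition L2 :: "'b measure \<Rightarrow> ('b \<Rightarrow> real) set set" where
  "L2 L = l2_fun L // l2_rel L"

text \<open>If \<open>f\<close> is not square-integrable then \<open>l2_class L f\<close> is empty, hence not an element
  of \<open>L2 L\<close>.\<close>

definition l2_class :: "'b measure \<Rightarrow> ('b \<Rightarrow> real) \<Rightarrow> ('b \<Rightarrow> real) set" where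
  "l2_class L f = l2_rel L `` {f}"

definition l2_rep :: "('b \<Rightarrow> real) set \<Rightarrow> 'b \<Rightarrow> real" where
  "l2_rep F = (SOME f. f \<in> F)"

definition l2_inner :: "'b measure \<Rightarrow> ('b \<Rightarrow> real) set \<Rightarrow> ('b \<Rightarrow> real) set \<Rightarrow> real" where
  "l2_inner L F G = (\<integral>x. l2_rep F x * l2_rep G x \<partial>L)"

definition l2_dist :: "'b measure \<Rightarrow> ('b \<Rightarrow> real) set \<Rightarrow> ('b \<Rightarrow> real) set \<Rightarrow> real" where
  "l2_dist L F G = sqrt (\<integral>x. (l2_rep F x - l2_rep G x)\<^sup>2 \<partial>L)"

definition l2_topology :: "'b measure \<Rightarrow> ('b \<Rightarrow> real) set topology" where
  "l2_topology L = Metric_space.mtopology (L2 L) (l2_dist L)"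

lemma equiv_l2_rel: "equiv (l2_fun L) (l2_rel L)"
proof (rule equivI)
  show "l2_rel L \<subseteq> l2_fun L \<times> l2_fun L" by (auto simp: l2_rel_def)
  show "refl_on (l2_fun L) (l2_rel L)" by (auto simp: l2_rel_def refl_on_def)
  show "sym (l2_rel L)" by (auto simp: l2_rel_def sym_def eq_commute)
  show "trans (l2_rel L)" by (auto simp: l2_rel_def trans_def elim: AE_mp)
qed

lemma l2_class_in_L2: "f \<in> l2_fun L \<Longrightarrow> l2_class L f \<in> L2 L"
  by (simp add: L2_def l2_class_def quotientI)

lemma l2_class_eq_iff:
  assumes "f \<in> l2_fun L" "g \<in> l2_fun L"
  shows "l2_class L f = l2_class L g \<longleftrightarrow> (AE x in L. f x = g x)"
  using eq_equiv_class_iff[OF equiv_l2_rel assms] assms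
  by (simp add: l2_class_def l2_rel_def)

lemma l2_rep:
  assumes "F \<in> L2 L"
  shows "l2_rep F \<in> l2_fun L" "l2_class L (l2_rep F) = F"
proof -
  obtain f where f: "f \<in> l2_fun L" "F = l2_rel L `` {f}"
    using assms unfolding L2_def by (rule quotientE)
  have "f \<in> F" using f by (auto simp: l2_rel_def)
  then have "l2_rep F \<in> F" unfolding l2_rep_def by (rule someI[of "\<lambda>h. h \<in> F"])
  then have *: "(f, l2_rep F) \<in> l2_rel L" using f by auto
  then show "l2_rep F \<in> l2_fun L" by (auto simp: l2_rel_def)
  show "l2_class L (l2_rep F) = F"
    using equiv_class_eq[OF equiv_l2_rel *] f by (simp add: l2_class_def)
qed

lemma l2_rep_class:
  assumes "f \<in> l2_fun L"
  shows "AE x in L. l2_rep (l2_class L f) x = f x"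
  using l2_rep[OF l2_class_in_L2[OF assms]] assms l2_class_eq_iff by blast

lemma l2_fun_mult:
  assumes "f \<in> l2_fun L" "g \<in> l2_fun L"
  shows "integrable L (\<lambda>x. f x * g x)"
proof (rule Bochner_Integration.integrable_bound)
  show "integrable L (\<lambda>x. (f x)\<^sup>2 + (g x)\<^sup>2)" using assms by (auto simp: l2_fun_def)
  show "(\<lambda>x. f x * g x) \<in> borel_measurable L" using assms by (auto simp: l2_fun_def)
  have "\<bar>a * b\<bar> \<le> a\<^sup>2 + b\<^sup>2" for a b :: real
  proof -
    have "0 \<le> (\<bar>a\<bar> - \<bar>b\<bar>)\<^sup>2" by simp
    then have "2 * (\<bar>a\<bar> * \<bar>b\<bar>) \<le> a\<^sup>2 + b\<^sup>2" by (simp add: power2_diff)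
    moreover have "0 \<le> \<bar>a\<bar> * \<bar>b\<bar>" by simp
    ultimately show ?thesis unfolding abs_mult by linarith
  qed
  then show "AE x in L. norm (f x * g x) \<le> norm ((f x)\<^sup>2 + (g x)\<^sup>2)"
    by (simp add: order_trans[OF _ abs_ge_self])
qed

lemma l2_fun_diff:
  assumes "f \<in> l2_fun L" "g \<in> l2_fun L"
  shows "(\<lambda>x. f x - g x) \<in> l2_fun L"
proof -
  have "integrable L (\<lambda>x. (f x)\<^sup>2 + (g x)\<^sup>2 - 2 * (f x * g x))"
    using assms l2_fun_mult[OF assms] by (auto simp: l2_fun_def)
  then have "integrable L (\<lambda>x. (f x - g x)\<^sup>2)"
    by (simp add: power2_diff mult.assoc)
  then show ?thesis using assms by (auto simp: l2_fun_def)
qed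

lemma l2_inner_class:
  assumes "f \<in> l2_fun L" "g \<in> l2_fun L"
  shows "l2_inner L (l2_class L f) (l2_class L g) = (\<integral>x. f x * g x \<partial>L)"
  unfolding l2_inner_def
proof (rule integral_cong_AE)
  show "AE x in L. l2_rep (l2_class L f) x * l2_rep (l2_class L g) x = f x * g x"
    using l2_rep_class[OF assms(1)] l2_rep_class[OF assms(2)] by eventually_elim simp
qed (use assms l2_rep(1)[OF l2_class_in_L2] in \<open>auto simp: l2_fun_def intro!: borel_measurable_times\<close>)

lemma l2_dist_class:
  assumes "f \<in> l2_fun L" "g \<in> l2_fun L"
  shows "l2_dist L (l2_class L f) (l2_class L g) = sqrt (\<integral>x. (f x - g x)\<^sup>2 \<partial>L)"
proof -
  have "(\<integral>x. (l2_rep (l2_class L f) x - l2_rep (l2_class L g) x)\<^sup>2 \<partial>L)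
      = (\<integral>x. (f x - g x)\<^sup>2 \<partial>L)"
  proof (rule integral_cong_AE)
    show "AE x in L. (l2_rep (l2_class L f) x - l2_rep (l2_class L g) x)\<^sup>2 = (f x - g x)\<^sup>2"
      using l2_rep_class[OF assms(1)] l2_rep_class[OF assms(2)] by eventually_elim simp
  qed (use assms l2_rep(1)[OF l2_class_in_L2] in
        \<open>auto simp: l2_fun_def intro!: borel_measurable_power borel_measurable_diff\<close>)
  then show ?thesis by (simp add: l2_dist_def)
qed

lemma l2_Minkowski:
  assumes f: "f \<in> l2_fun L" and g: "g \<in> l2_fun L"
  shows "sqrt (\<integral>x. (f x + g x)\<^sup>2 \<partial>L) \<le> sqrt (\<integral>x. (f x)\<^sup>2 \<partial>L) + sqrt (\<integral>x. (g x)\<^sup>2 \<partial>L)"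
proof -
  define A where "A = (\<integral>x. (f x)\<^sup>2 \<partial>L)"
  define B where "B = (\<integral>x. (g x)\<^sup>2 \<partial>L)"
  define C where "C = (\<integral>x. f x * g x \<partial>L)"
  have int: "integrable L (\<lambda>x. (f x)\<^sup>2)" "integrable L (\<lambda>x. (g x)\<^sup>2)" "integrable L (\<lambda>x. f x * g x)"
    using f g l2_fun_mult[OF f g] by (auto simp: l2_fun_def)
  have quad: "(\<integral>x. (s * f x + t * g x)\<^sup>2 \<partial>L) = s\<^sup>2 * A + 2 * s * t * C + t\<^sup>2 * B" for s t :: real
  proof -
    have "(\<lambda>x. (s * f x + t * g x)\<^sup>2)
        = (\<lambda>x. s\<^sup>2 * (f x)\<^sup>2 + (2 * s * t) * (f x * g x) + t\<^sup>2 * (g x)\<^sup>2)"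
      by (auto simp: power2_eq_square algebra_simps)
    then show ?thesis using int by (simp add: A_def B_def C_def)
  qed
  have pos: "0 \<le> s\<^sup>2 * A + 2 * s * t * C + t\<^sup>2 * B" for s t
    unfolding quad[symmetric] by simp
  have A0: "0 \<le> A" and B0: "0 \<le> B" by (auto simp: A_def B_def)
  have "C\<^sup>2 \<le> A * B"
  proof (cases "A = 0")
    case True
    have "C = 0"
    proof (rule ccontr)
      assume "C \<noteq> 0"
      then show False using pos[of "- (B + 1) / (2 * C)" 1] True by (simp add: field_simps)
    qed
    then show ?thesis using True by simp
  next
    case False
    then have "0 < A" using A0 by simp
    have "0 \<le> A * (A * B - C\<^sup>2)"
      using pos[of "- C" A] by (simp add: power2_eq_square algebra_simps)
    then show ?thesis using \<open>0 < A\<close> by (simp add: zero_le_mult_iff)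
  qed
  then have "C \<le> sqrt A * sqrt B"
    using real_le_rsqrt[of C "A * B"] by (simp add: real_sqrt_mult)
  then have "A + 2 * C + B \<le> (sqrt A + sqrt B)\<^sup>2"
    using A0 B0 by (simp add: power2_sum)
  then have "sqrt (A + 2 * C + B) \<le> sqrt A + sqrt B"
    using A0 B0 by (intro real_le_lsqrt) auto
  then show ?thesis using quad[of 1 1] by (simp add: A_def B_def)
qed

lemma Metric_space_L2: "Metric_space (L2 L) (l2_dist L)"
proof
  fix F G H
  show "0 \<le> l2_dist L F G" by (simp add: l2_dist_def)
  show "l2_dist L F G = l2_dist L G F" by (simp add: l2_dist_def power2_commute)
  show "l2_dist L F G = 0 \<longleftrightarrow> F = G" if FG: "F \<in> L2 L" "G \<in> L2 L"
  proof -
    have d: "(\<lambda>x. l2_rep F x - l2_rep G x) \<in> l2_fun L"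
      using l2_fun_diff l2_rep(1) FG by blast
    have "l2_dist L F G = 0 \<longleftrightarrow> (AE x in L. l2_rep F x = l2_rep G x)"
      using d integral_nonneg_eq_0_iff_AE[of L "\<lambda>x. (l2_rep F x - l2_rep G x)\<^sup>2"]
      by (simp add: l2_dist_def l2_fun_def)
    also have "\<dots> \<longleftrightarrow> F = G"
      using l2_class_eq_iff[of "l2_rep F" L "l2_rep G"] l2_rep FG by metis
    finally show ?thesis .
  qed
  show "l2_dist L F H \<le> l2_dist L F G + l2_dist L G H" if "F \<in> L2 L" "G \<in> L2 L" "H \<in> L2 L"
    using l2_Minkowski[OF l2_fun_diff[OF l2_rep(1)[OF that(1)] l2_rep(1)[OF that(2)]]
        l2_fun_diff[OF l2_rep(1)[OF that(2)] l2_rep(1)[OF that(3)]]]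
    by (simp add: l2_dist_def)
qed

text \<open>The Hilbert space $\mathbb{H}_a$ is \<open>L2 (exp_weight a)\<close>; the elements of its classes are functions on
  \<open>real\<close> whose values outside of \<open>{0..}\<close> are irrelevant.\<close>

definition exp_weight :: "real \<Rightarrow> real measure" where
  "exp_weight a = density (restrict_space lborel {0..}) (\<lambda>t. ennreal (exp (- a * t)))"


section \<open>Random elements, convergence in distribution, Gaussian elements\<close>

definition borel_of :: "'b topology \<Rightarrow> 'b measure" where
  "borel_of T = sigma (topspace T) {U. openin T U}"

definition random_element :: "'b topology \<Rightarrow> 'a measure \<Rightarrow> ('a \<Rightarrow> 'b) \<Rightarrow> bool" where
  "random_element T M X \<longleftrightarrow> X \<in> measurable M (borel_of T)"

definition converges_in_distribution ::
    "'b topology \<Rightarrow> 'a measure \<Rightarrow> (nat \<Rightarrow> 'a \<Rightarrow> 'b) \<Rightarrow> 'c measure \<Rightarrow> ('c \<Rightarrow> 'b) \<Rightarrow> bool" where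
  "converges_in_distribution T M X N Y \<longleftrightarrow>
     (\<forall>n. random_element T M (X n)) \<and> random_element T N Y \<and>
     (\<forall>\<phi>. continuous_map T euclideanreal \<phi> \<and> bounded (\<phi> ` topspace T) \<longrightarrow>
        (\<lambda>n. \<integral>\<omega>. \<phi> (X n \<omega>) \<partial>M) \<longlonglongrightarrow> (\<integral>\<omega>. \<phi> (Y \<omega>) \<partial>N))"

text \<open>Point masses count as (degenerate) normal distributions.\<close>

definition normal_law :: "real measure \<Rightarrow> bool" where
  "normal_law \<nu> \<longleftrightarrow>
     (\<exists>m. \<nu> = return borel m) \<or> (\<exists>m s. 0 < s \<and> \<nu> = density lborel (normal_density m s))"

definition centred_gaussian_element ::
    "'b measure \<Rightarrow> 'c measure \<Rightarrow> ('c \<Rightarrow> ('b \<Rightarrow> real) set) \<Rightarrow> bool" where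
  "centred_gaussian_element L N W \<longleftrightarrow>
     random_element (l2_topology L) N W \<and>
     (\<forall>F\<in>L2 L. normal_law (distr N borel (\<lambda>\<omega>. l2_inner L (W \<omega>) F)) \<and>
        (\<integral>\<omega>. l2_inner L (W \<omega>) F \<partial>N) = 0)"

text \<open>Integrability is required explicitly because non-integrable functions have integral \<open>0\<close>
  in Isabelle.\<close>

definition has_covariance_kernel ::
    "real \<Rightarrow> 'c measure \<Rightarrow> ('c \<Rightarrow> (real \<Rightarrow> real) set) \<Rightarrow> (real \<Rightarrow> real \<Rightarrow> real) \<Rightarrow> bool" where
  "has_covariance_kernel a N W K \<longleftrightarrow>
     (\<forall>f\<in>l2_fun (exp_weight a). \<forall>g\<in>l2_fun (exp_weight a).
        let I = (\<lambda>\<omega>. l2_inner (exp_weight a) (W \<omega>) (l2_class (exp_weight a) f)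
                   * l2_inner (exp_weight a) (W \<omega>) (l2_class (exp_weight a) g));
            k = (\<lambda>s t. K s t * f s * g t * exp (- a * (s + t)))
        in integrable N I \<and>
           set_integrable (lborel \<Otimes>\<^sub>M lborel) ({0..} \<times> {0..}) (\<lambda>(s, t). k s t) \<and>
           (\<integral>\<omega>. I \<omega> \<partial>N) = (LINT t:{0..}|lborel. (LINT s:{0..}|lborel. k s t)))"


section \<open>The process and its limiting covariance kernel\<close>

definition sample_mean :: "(nat \<Rightarrow> 'a \<Rightarrow> real) \<Rightarrow> nat \<Rightarrow> 'a \<Rightarrow> real" where
  "sample_mean Xs n \<omega> = (\<Sum>j=1..n. Xs j \<omega>) / real n"

definition Z_proc :: "(nat \<Rightarrow> 'a \<Rightarrow> real) \<Rightarrow> nat \<Rightarrow> 'a \<Rightarrow> real \<Rightarrow> real" where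
  "Z_proc Xs n \<omega> y =
     (1 / sqrt (real n)) *
       (\<Sum>j=1..n. (Xs j \<omega> - y - sample_mean Xs n \<omega>) * indicator {y<..} (Xs j \<omega>))"

definition z_fun :: "'a measure \<Rightarrow> ('a \<Rightarrow> real) \<Rightarrow> real \<Rightarrow> real" where
  "z_fun M X1 y = (\<integral>\<omega>. (X1 \<omega> - y - 1) * indicator {y<..} (X1 \<omega>) \<partial>M)"

definition W_proc :: "'a measure \<Rightarrow> (nat \<Rightarrow> 'a \<Rightarrow> real) \<Rightarrow> nat \<Rightarrow> 'a \<Rightarrow> real \<Rightarrow> real" where
  "W_proc M Xs n \<omega> y = Z_proc Xs n \<omega> y - sqrt (real n) * z_fun M (Xs 1) y"

definition Psi :: "'a measure \<Rightarrow> ('a \<Rightarrow> real) \<Rightarrow> nat \<Rightarrow> real \<Rightarrow> real" where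
  "Psi M X l s = (\<integral>\<omega>. (X \<omega> - 1) ^ l * indicator {s<..} (X \<omega>) \<partial>M)"

definition tail_prob :: "'a measure \<Rightarrow> ('a \<Rightarrow> real) \<Rightarrow> real \<Rightarrow> real" where
  "tail_prob M X s = measure M {\<omega> \<in> space M. X \<omega> > s}"

definition K_kernel ::
    "'a measure \<Rightarrow> ('a \<Rightarrow> real) \<Rightarrow> (real \<Rightarrow> real) \<Rightarrow> real \<Rightarrow> real \<Rightarrow> real" where
  "K_kernel M X z s t =
     Psi M X 2 (max s t) + s * t * tail_prob M X (max s t) - (s + t) * Psi M X 1 (max s t)
     - tail_prob M X s * (Psi M X 2 t - t * Psi M X 1 t)
     - tail_prob M X t * (Psi M X 2 s - s * Psi M X 1 s)
     + prob_space.variance M X * tail_prob M X s * tail_prob M X t - z s * z t"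

end

theory Submission
  imports Defs
begin

text \<open>
  With \<open>h x y = (x - 1 - y) 1{x > y} - (x - 1) P(X > y) - z(y)\<close>, the process \<open>W_n\<close> equals
  \<open>U_n = n^(-1/2) (h X_1 + ... + h X_n)\<close> up to the product of \<open>sqrt n (1 - mean)\<close> with the
  error of the empirical tail function, which tends to \<open>0\<close> in mean norm. The kernel of the
  covariance of the centred random function \<open>h X\<close> is \<open>K\<close>. The central limit theorem for \<open>U_n\<close> in the
  Hilbert space reduces to finite dimensions: \<open>h\<close> is right-continuous in \<open>y\<close> and dominated by a
  square-integrable function that decreases in \<open>y\<close>, so it is the limit of the step functions obtained by
  rounding \<open>y\<close> up to finitely many rationals, and the error is uniform in \<open>n\<close> because second moments of
  normalized sums do not depend on \<open>n\<close>. The step functions are finite sums \<open>v_i(x) c_i(y)\<close>; the vectors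
  \<open>n^(-1/2) (v_i(X_1) + ... + v_i(X_n))\<close> converge to a Gaussian vector by the
  one-dimensional theorem, since the expectations of trigonometric polynomials converge and these
  approximate bounded continuous functions. The Gaussian sequence comes from Gram-Schmidt
  orthogonalization of the \<open>v_i\<close>, and \<open>W\<close> is the almost sure limit of its finite-rank sums.\<close>

section \<open>Square-integrable functions\<close>

text \<open>No tightness argument in the function space occurs. Every comparison is a bound on a
  mean distance, which is why convergence in distribution is first reduced to bounded Lipschitz test
  functions: for these a mean distance bounds the difference of expectations directly. The Gaussian
  limit has to be built beforehand. The mean squared norm of a finite-rank sum involves its random
  coefficients only through their Gram matrix; hence replacing the \<open>v_i\<close> by Gaussian
  variables with the same Gram matrix carries the Cauchy property of the step approximations of
  \<open>h\<close> over to random functions. The approximations are chosen with mean squared error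
  at most \<open>(1/4)^k\<close>, so that their increments stay summable after multiplication by
  \<open>2^k\<close>; this upgrades convergence in mean to almost sure convergence. The third moment
  pays for the integration over the half-line: without weight, that is for \<open>a = 0\<close>, the
  squared norm of 1{y < x} as a function of y is x, and this multiplies the square of the linear
  growth of \<open>h\<close> in x.\<close>

definition l2_norm :: "'b measure \<Rightarrow> ('b \<Rightarrow> real) \<Rightarrow> real" where
  "l2_norm L f = sqrt (\<integral>x. (f x)\<^sup>2 \<partial>L)"

lemma l2_funD:
  assumes "f \<in> l2_fun L"
  shows "f \<in> borel_measurable L" "integrable L (\<lambda>x. (f x)\<^sup>2)"
  using assms by (auto simp: l2_fun_def)

lemma l2_fun_zero: "(\<lambda>x. 0) \<in> l2_fun L"
  by (simp add: l2_fun_def)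

lemma l2_fun_cmult: "f \<in> l2_fun L \<Longrightarrow> (\<lambda>x. c * f x) \<in> l2_fun L"
  by (auto simp: l2_fun_def power_mult_distrib)

lemma l2_fun_add:
  assumes "f \<in> l2_fun L" "g \<in> l2_fun L"
  shows "(\<lambda>x. f x + g x) \<in> l2_fun L"
  using l2_fun_diff[OF assms(1) l2_fun_cmult[OF assms(2), of "-1"]] by simp

lemma l2_fun_sum:
  assumes "\<And>i. i \<in> I \<Longrightarrow> f i \<in> l2_fun L"
  shows "(\<lambda>x. \<Sum>i\<in>I. f i x) \<in> l2_fun L"
  using assms by (induction I rule: infinite_finite_induct) (auto intro: l2_fun_zero l2_fun_add)

lemma l2_fun_bound:
  assumes "g \<in> l2_fun L" "f \<in> borel_measurable L" "AE x in L. \<bar>f x\<bar> \<le> g x"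
  shows "f \<in> l2_fun L"
proof -
  have "integrable L (\<lambda>x. (f x)\<^sup>2)"
  proof (rule Bochner_Integration.integrable_bound[OF l2_funD(2)[OF assms(1)]])
    show "AE x in L. norm ((f x)\<^sup>2) \<le> norm ((g x)\<^sup>2)"
      using assms(3) by eventually_elim (simp add: power2_le_iff_abs_le abs_le_square_iff[symmetric])
  qed (use assms in measurable)
  with assms show ?thesis by (simp add: l2_fun_def)
qed

lemma l2_norm_nonneg [simp]: "0 \<le> l2_norm L f"
  by (simp add: l2_norm_def)

lemma l2_norm_sq: "(l2_norm L f)\<^sup>2 = (\<integral>x. (f x)\<^sup>2 \<partial>L)"
  by (simp add: l2_norm_def)

lemma l2_norm_zero [simp]: "l2_norm L (\<lambda>x. 0) = 0"
  by (simp add: l2_norm_def)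

lemma l2_norm_cmult: "l2_norm L (\<lambda>x. c * f x) = \<bar>c\<bar> * l2_norm L f"
  by (simp add: l2_norm_def power_mult_distrib real_sqrt_mult)

lemma l2_norm_triangle:
  "f \<in> l2_fun L \<Longrightarrow> g \<in> l2_fun L \<Longrightarrow> l2_norm L (\<lambda>x. f x + g x) \<le> l2_norm L f + l2_norm L g"
  using l2_Minkowski by (simp add: l2_norm_def)

lemma l2_norm_commute: "l2_norm L (\<lambda>x. f x - g x) = l2_norm L (\<lambda>x. g x - f x)"
  by (simp add: l2_norm_def power2_commute)

lemma l2_norm_sum:
  assumes "\<And>i. i \<in> I \<Longrightarrow> f i \<in> l2_fun L"
  shows "l2_norm L (\<lambda>x. \<Sum>i\<in>I. f i x) \<le> (\<Sum>i\<in>I. l2_norm L (f i))"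
  using assms
proof (induction I rule: infinite_finite_induct)
  case (insert i I)
  have "l2_norm L (\<lambda>x. f i x + (\<Sum>i\<in>I. f i x)) \<le> l2_norm L (f i) + l2_norm L (\<lambda>x. \<Sum>i\<in>I. f i x)"
    using insert.prems by (intro l2_norm_triangle l2_fun_sum) auto
  also have "\<dots> \<le> l2_norm L (f i) + (\<Sum>i\<in>I. l2_norm L (f i))"
    using insert by simp
  finally show ?case using insert.hyps by simp
qed simp_all

lemma l2_norm_diff_triangle:
  assumes "f \<in> l2_fun L" "g \<in> l2_fun L" "k \<in> l2_fun L"
  shows "l2_norm L (\<lambda>x. f x - k x) \<le> l2_norm L (\<lambda>x. f x - g x) + l2_norm L (\<lambda>x. g x - k x)"
  using l2_norm_triangle[OF l2_fun_diff[OF assms(1,2)] l2_fun_diff[OF assms(2,3)]] by simp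

lemma l2_norm_diff_bound:
  assumes "f \<in> l2_fun L" "g \<in> l2_fun L"
  shows "\<bar>l2_norm L f - l2_norm L g\<bar> \<le> l2_norm L (\<lambda>x. f x - g x)"
  using l2_norm_diff_triangle[OF assms l2_fun_zero] l2_norm_diff_triangle[OF assms(2,1) l2_fun_zero]
    l2_norm_commute[of L f g] by simp

lemma l2_norm_sq_add:
  assumes "f \<in> l2_fun L" "g \<in> l2_fun L"
  shows "(\<integral>x. (f x + g x)\<^sup>2 \<partial>L) \<le> 2 * (\<integral>x. (f x)\<^sup>2 \<partial>L) + 2 * (\<integral>x. (g x)\<^sup>2 \<partial>L)"
proof -
  have "(\<integral>x. (f x + g x)\<^sup>2 \<partial>L) \<le> (\<integral>x. 2 * (f x)\<^sup>2 + 2 * (g x)\<^sup>2 \<partial>L)"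
  proof (rule integral_mono)
    fix x
    have "0 \<le> (f x - g x)\<^sup>2" by simp
    then show "(f x + g x)\<^sup>2 \<le> 2 * (f x)\<^sup>2 + 2 * (g x)\<^sup>2"
      unfolding power2_sum power2_diff by linarith
  qed (use l2_funD(2)[OF l2_fun_add[OF assms]] l2_funD(2)[OF assms(1)] l2_funD(2)[OF assms(2)] in auto)
  also have "\<dots> = 2 * (\<integral>x. (f x)\<^sup>2 \<partial>L) + 2 * (\<integral>x. (g x)\<^sup>2 \<partial>L)"
    using l2_funD(2)[OF assms(1)] l2_funD(2)[OF assms(2)] by simp
  finally show ?thesis .
qed

text \<open>Squaring the triangle inequality leaves exactly this bound for the cross term; the
  absolute value comes from applying it to \<open>- f\<close> as well.\<close>

lemma l2_Cauchy_Schwarz: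
  assumes f: "f \<in> l2_fun L" and g: "g \<in> l2_fun L"
  shows "\<bar>\<integral>x. f x * g x \<partial>L\<bar> \<le> l2_norm L f * l2_norm L g"
proof -
  have *: "(\<integral>x. f x * g x \<partial>L) \<le> l2_norm L f * l2_norm L g"
    if f: "f \<in> l2_fun L" and g: "g \<in> l2_fun L" for f g
  proof -
    have "(\<integral>x. (f x + g x)\<^sup>2 \<partial>L) = (\<integral>x. (f x)\<^sup>2 + (g x)\<^sup>2 + 2 * (f x * g x) \<partial>L)"
      by (simp add: power2_sum mult.assoc)
    also have "\<dots> = (l2_norm L f)\<^sup>2 + (l2_norm L g)\<^sup>2 + 2 * (\<integral>x. f x * g x \<partial>L)"
      using l2_funD(2)[OF f] l2_funD(2)[OF g] l2_fun_mult[OF f g] by (simp add: l2_norm_sq)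
    finally have "(l2_norm L (\<lambda>x. f x + g x))\<^sup>2
        = (l2_norm L f)\<^sup>2 + (l2_norm L g)\<^sup>2 + 2 * (\<integral>x. f x * g x \<partial>L)"
      by (simp add: l2_norm_sq)
    moreover have "(l2_norm L (\<lambda>x. f x + g x))\<^sup>2 \<le> (l2_norm L f + l2_norm L g)\<^sup>2"
      by (intro power_mono l2_norm_triangle f g) simp
    ultimately show ?thesis by (simp add: power2_sum)
  qed
  have "(\<integral>x. - f x * g x \<partial>L) \<le> l2_norm L (\<lambda>x. - f x) * l2_norm L g"
    using l2_fun_cmult[OF f, of "-1"] by (intro * g) simp
  then have "- (\<integral>x. f x * g x \<partial>L) \<le> l2_norm L f * l2_norm L g"
    by (simp add: l2_norm_def)
  with *[OF f g] show ?thesis by linarith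
qed

lemma l2_dist_norm:
  "f \<in> l2_fun L \<Longrightarrow> g \<in> l2_fun L \<Longrightarrow> l2_dist L (l2_class L f) (l2_class L g) = l2_norm L (\<lambda>x. f x - g x)"
  by (simp add: l2_dist_class l2_norm_def)

lemma l2_inner_rep:
  assumes "f \<in> l2_fun L" "G \<in> L2 L"
  shows "l2_inner L (l2_class L f) G = (\<integral>x. f x * l2_rep G x \<partial>L)"
  using l2_inner_class[OF assms(1) l2_rep(1)[OF assms(2)]] l2_rep(2)[OF assms(2)] by simp

lemma topspace_l2: "topspace (l2_topology L) = L2 L"
  by (simp add: l2_topology_def Metric_space.topspace_mtopology[OF Metric_space_L2])

section \<open>Lipschitz functions and convergence in distribution\<close>

context Metric_space
begin

definition lipschitz :: "real \<Rightarrow> ('a \<Rightarrow> real) \<Rightarrow> bool" where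
  "lipschitz m \<phi> \<longleftrightarrow> (\<forall>x\<in>M. \<forall>y\<in>M. \<bar>\<phi> x - \<phi> y\<bar> \<le> m * d x y)"

lemma lipschitz_continuous_map:
  assumes "lipschitz m \<phi>"
  shows "continuous_map mtopology euclideanreal \<phi>"
  unfolding continuous_map
proof (intro conjI allI impI)
  fix U :: "real set" assume "openin euclideanreal U"
  then have "open U" by simp
  have "\<exists>r>0. mball x r \<subseteq> {x \<in> M. \<phi> x \<in> U}" if x: "x \<in> {x \<in> M. \<phi> x \<in> U}" for x
  proof -
    obtain e where e: "e > 0" "\<And>y. dist y (\<phi> x) < e \<Longrightarrow> y \<in> U"
      using \<open>open U\<close> x by (auto simp: open_dist)
    \<comment> \<open>The absolute value admits a negative \<open>m\<close>, and the summand 1 keeps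
      the radius meaningful for \<open>m = 0\<close>.\<close>
    show ?thesis
    proof (intro exI[of _ "e / (\<bar>m\<bar> + 1)"] conjI subsetI CollectI)
      fix y assume "y \<in> mball x (e / (\<bar>m\<bar> + 1))"
      then have y: "y \<in> M" "d x y < e / (\<bar>m\<bar> + 1)" by auto
      have "\<bar>\<phi> y - \<phi> x\<bar> \<le> m * d y x" using assms x y by (auto simp: lipschitz_def)
      also have "\<dots> \<le> (\<bar>m\<bar> + 1) * d x y"
        by (subst commute) (intro mult_right_mono; simp)
      also have "\<dots> < e" using y(2) by (simp add: field_simps)
      finally show "\<phi> y \<in> U" using e(2) by (simp add: dist_real_def)
    qed (use e in auto)
  qed
  then show "openin mtopology {x \<in> topspace mtopology. \<phi> x \<in> U}"
    unfolding openin_mtopology topspace_mtopology by blast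
qed simp

text \<open>Inf-convolution of \<open>g\<close> with \<open>m * d\<close>. Each competitor
  \<open>g y + m * d x y\<close> is \<open>m\<close>-Lipschitz in \<open>x\<close> by the triangle
  inequality and bounded below by \<open>b\<close>, and the infimum inherits both. With
  \<open>g = 0\<close> and \<open>m = 1\<close> it is the distance to \<open>C\<close>; with
  \<open>C = M\<close> it regularizes \<open>g\<close> from below.\<close>

lemma lipschitz_INF:
  assumes C: "C \<noteq> {}" "C \<subseteq> M" and m: "0 \<le> m" and b: "\<And>y. y \<in> C \<Longrightarrow> b \<le> g y"
  shows "lipschitz m (\<lambda>x. INF y\<in>C. g y + m * d x y)"
    and "x \<in> M \<Longrightarrow> b \<le> (INF y\<in>C. g y + m * d x y)"
    and "y \<in> C \<Longrightarrow> (INF y\<in>C. g y + m * d x y) \<le> g y + m * d x y"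
proof -
  have bdd: "bdd_below ((\<lambda>y. g y + m * d x y) ` C)" for x
    using b m by (intro bdd_belowI2[of _ b]) (auto intro!: add_increasing2)
  then show "y \<in> C \<Longrightarrow> (INF y\<in>C. g y + m * d x y) \<le> g y + m * d x y" for x y
    by (intro cINF_lower)
  show "x \<in> M \<Longrightarrow> b \<le> (INF y\<in>C. g y + m * d x y)"
    using b m C by (intro cINF_greatest) (auto intro!: add_increasing2)
  have *: "(INF y\<in>C. g y + m * d x y) \<le> (INF y\<in>C. g y + m * d x' y) + m * d x x'"
    if "x \<in> M" "x' \<in> M" for x x'
  proof -
    have "(INF y\<in>C. g y + m * d x y) - m * d x x' \<le> g y + m * d x' y" if "y \<in> C" for y
    proof -
      have "(INF y\<in>C. g y + m * d x y) \<le> g y + m * d x y" using bdd that by (intro cINF_lower)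
      also have "\<dots> \<le> g y + m * (d x x' + d x' y)"
        using m triangle[of x x' y] \<open>x \<in> M\<close> \<open>x' \<in> M\<close> that C by (intro add_left_mono mult_left_mono) auto
      finally show ?thesis by (simp add: algebra_simps)
    qed
    then have "(INF y\<in>C. g y + m * d x y) - m * d x x' \<le> (INF y\<in>C. g y + m * d x' y)"
      using C by (intro cINF_greatest) auto
    then show ?thesis by simp
  qed
  show "lipschitz m (\<lambda>x. INF y\<in>C. g y + m * d x y)"
    unfolding lipschitz_def
  proof (intro ballI)
    fix x x' assume x: "x \<in> M" "x' \<in> M"
    show "\<bar>(INF y\<in>C. g y + m * d x y) - (INF y\<in>C. g y + m * d x' y)\<bar> \<le> m * d x x'"
      using *[OF x] *[OF x(2,1)] commute[of x x'] by (simp add: abs_le_iff)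
  qed
qed

end

lemma random_elementD:
  assumes "random_element T N X"
  shows "\<omega> \<in> space N \<Longrightarrow> X \<omega> \<in> topspace T"
    and "openin T U \<Longrightarrow> X -` U \<inter> space N \<in> sets N"
proof -
  have sub: "{U. openin T U} \<subseteq> Pow (topspace T)" using openin_subset by auto
  have m: "X \<in> measurable N (sigma (topspace T) {U. openin T U})"
    using assms by (simp add: random_element_def borel_of_def)
  show "\<omega> \<in> space N \<Longrightarrow> X \<omega> \<in> topspace T"
    using measurable_space[OF m] sub by (simp add: space_measure_of)
  show "openin T U \<Longrightarrow> X -` U \<inter> space N \<in> sets N"
    using measurable_sets[OF m, of U] sub by (simp add: sets_measure_of sigma_sets.Basic)
qed

lemma random_elementI:
  assumes "\<And>\<omega>. \<omega> \<in> space N \<Longrightarrow> X \<omega> \<in> topspace T"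
    and "\<And>U. openin T U \<Longrightarrow> X -` U \<inter> space N \<in> sets N"
  shows "random_element T N X"
  unfolding random_element_def borel_of_def
  using assms by (intro measurable_measure_of) (auto dest: openin_subset)

lemma random_element_continuous_map:
  assumes "random_element T N X" "continuous_map T euclideanreal \<phi>"
  shows "(\<lambda>\<omega>. \<phi> (X \<omega>)) \<in> borel_measurable N"
proof (rule borel_measurableI)
  fix S :: "real set" assume "open S"
  then have "openin T {x \<in> topspace T. \<phi> x \<in> S}"
    using assms(2) by (auto simp: continuous_map)
  from random_elementD(2)[OF assms(1) this] random_elementD(1)[OF assms(1)]
  show "(\<lambda>\<omega>. \<phi> (X \<omega>)) -` S \<inter> space N \<in> sets N"
    by (auto simp: vimage_def Int_def cong: conj_cong elim: back_subst[of "\<lambda>A. A \<in> sets N"])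
qed

context Metric_space
begin

text \<open>An open set is the set where the distance to its complement is positive, and along
  \<open>Y\<close> this distance is a pointwise limit of measurable functions. This treats arbitrary
  open sets at once, with no appeal to separability.\<close>

lemma random_element_limit:
  assumes X: "\<And>k. random_element mtopology N (X k)"
    and Y: "\<And>\<omega>. \<omega> \<in> space N \<Longrightarrow> Y \<omega> \<in> M"
    and lim: "\<And>\<omega>. \<omega> \<in> space N \<Longrightarrow> (\<lambda>k. d (X k \<omega>) (Y \<omega>)) \<longlonglongrightarrow> 0"
  shows "random_element mtopology N Y"
proof (rule random_elementI)
  fix U assume U: "openin mtopology U"
  show "Y -` U \<inter> space N \<in> sets N"
  \<comment> \<open>If \<open>U\<close> is the whole carrier, the infimum defining the distance
    would range over the empty set.\<close>
  proof (cases "M - U = {}")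
    case True
    then have "Y -` U \<inter> space N = space N" using Y by auto
    then show ?thesis by simp
  next
    case False
    define \<phi> where "\<phi> x = (INF y\<in>M - U. 0 + 1 * d x y)" for x
    have lip: "lipschitz 1 \<phi>"
      and le: "\<And>x y. y \<in> M - U \<Longrightarrow> \<phi> x \<le> 0 + 1 * d x y"
      unfolding \<phi>_def using False by (rule lipschitz_INF; auto)+
    have pos: "x \<in> U \<longleftrightarrow> 0 < \<phi> x" if "x \<in> M" for x
    proof
      assume "x \<in> U"
      then obtain r where r: "r > 0" "mball x r \<subseteq> U" using U by (auto simp: openin_mtopology)
      have "r \<le> \<phi> x" unfolding \<phi>_def
      proof (rule cINF_greatest[OF False])
        fix y assume "y \<in> M - U"
        then show "r \<le> 0 + 1 * d x y" using r that by (force simp: not_less[symmetric])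
      qed
      then show "0 < \<phi> x" using r by simp
    next
      assume "0 < \<phi> x"
      then show "x \<in> U" using le[of x x] that by force
    qed
    have "(\<lambda>\<omega>. \<phi> (Y \<omega>)) \<in> borel_measurable N"
    proof (rule borel_measurable_LIMSEQ_real)
      show "(\<lambda>\<omega>. \<phi> (X k \<omega>)) \<in> borel_measurable N" for k
        using random_element_continuous_map[OF X lipschitz_continuous_map[OF lip]] .
      show "(\<lambda>k. \<phi> (X k \<omega>)) \<longlonglongrightarrow> \<phi> (Y \<omega>)" if "\<omega> \<in> space N" for \<omega>
      proof (rule Lim_null_comparison[where g="\<lambda>k. d (X k \<omega>) (Y \<omega>)", THEN LIM_zero_cancel])
        show "\<forall>\<^sub>F k in sequentially. norm (\<phi> (X k \<omega>) - \<phi> (Y \<omega>)) \<le> d (X k \<omega>) (Y \<omega>)"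
          using lip random_elementD(1)[OF X that] Y[OF that] by (simp add: lipschitz_def)
      qed (rule lim[OF that])
    qed
    then have "{\<omega> \<in> space N. 0 < \<phi> (Y \<omega>)} \<in> sets N" by measurable
    moreover have "{\<omega> \<in> space N. 0 < \<phi> (Y \<omega>)} = Y -` U \<inter> space N"
      using Y pos by auto
    ultimately show ?thesis by simp
  qed
qed (use Y in simp)

text \<open>A bounded continuous function is the pointwise limit from below of its inf-convolutions
  with \<open>m * d\<close>, which are Lipschitz. Dominated convergence under the limit law and the
  minorant property under the laws of the \<open>X n\<close> give an asymptotic lower bound for the
  expectations; applied to \<open>- \<phi>\<close> it becomes the upper bound.\<close>

lemma portmanteau_lipschitz:
  assumes P: "prob_space P" and Q: "prob_space Q"
    and X: "\<And>n. random_element mtopology P (X n)" and Y: "random_element mtopology Q Y"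
    and conv: "\<And>m \<phi>. \<lbrakk>0 \<le> m; lipschitz m \<phi>; bounded (\<phi> ` M)\<rbrakk>
        \<Longrightarrow> (\<lambda>n. \<integral>\<omega>. \<phi> (X n \<omega>) \<partial>P) \<longlonglongrightarrow> (\<integral>\<omega>. \<phi> (Y \<omega>) \<partial>Q)"
  shows "converges_in_distribution mtopology P X Q Y"
proof -
  interpret P: prob_space P by fact
  interpret Q: prob_space Q by fact
  have XM: "\<And>\<omega> n. \<omega> \<in> space P \<Longrightarrow> X n \<omega> \<in> M" using random_elementD(1)[OF X] by simp
  have YM: "\<And>\<omega>. \<omega> \<in> space Q \<Longrightarrow> Y \<omega> \<in> M" using random_elementD(1)[OF Y] by simp
  have ne: "M \<noteq> {}" using YM Q.not_empty by blast
  have int: "integrable P (\<lambda>\<omega>. \<phi> (X n \<omega>))" "integrable Q (\<lambda>\<omega>. \<phi> (Y \<omega>))"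
    if c: "continuous_map mtopology euclideanreal \<phi>" and b: "bounded (\<phi> ` M)" for \<phi> n
  proof -
    obtain B where B: "\<And>x. x \<in> M \<Longrightarrow> \<bar>\<phi> x\<bar> \<le> B" using b by (auto simp: bounded_iff)
    show "integrable P (\<lambda>\<omega>. \<phi> (X n \<omega>))"
      using random_element_continuous_map[OF X c] B XM
      by (intro P.integrable_const_bound[of _ B]) auto
    show "integrable Q (\<lambda>\<omega>. \<phi> (Y \<omega>))"
      using random_element_continuous_map[OF Y c] B YM
      by (intro Q.integrable_const_bound[of _ B]) auto
  qed
  have lower: "\<forall>\<^sub>F n in sequentially. (\<integral>\<omega>. \<phi> (Y \<omega>) \<partial>Q) - e < (\<integral>\<omega>. \<phi> (X n \<omega>) \<partial>P)"
    if c: "continuous_map mtopology euclideanreal \<phi>" and b: "bounded (\<phi> ` M)" and e: "0 < e" for \<phi> e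
  proof -
    obtain B where B: "\<And>x. x \<in> M \<Longrightarrow> \<bar>\<phi> x\<bar> \<le> B" using b by (auto simp: bounded_iff)
    then have Bl: "\<And>x. x \<in> M \<Longrightarrow> - B \<le> \<phi> x" by (force simp: abs_le_iff)
    define g where "g m x = (INF y\<in>M. \<phi> y + real m * d x y)" for m :: nat and x
      \<comment> \<open>Lipschitz functions that increase to \<open>\<phi>\<close>\<close>
    have lip: "lipschitz (real m) (g m)" and gB: "\<And>x. x \<in> M \<Longrightarrow> - B \<le> g m x"
      and gle: "\<And>x y. y \<in> M \<Longrightarrow> g m x \<le> \<phi> y + real m * d x y" for m
      unfolding g_def by (rule lipschitz_INF[OF ne subset_refl _ Bl]; simp)+
    have gphi: "g m x \<le> \<phi> x" if "x \<in> M" for m x using gle[OF that, of m x] that by simp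
    have gabs: "\<bar>g m x\<bar> \<le> B" if "x \<in> M" for m x
      using gB[OF that, of m] gphi[OF that, of m] B[OF that] by linarith
    then have bg: "bounded (g m ` M)" for m
      unfolding bounded_iff by (intro exI[of _ B]) auto
    have lim: "(\<lambda>m. g m x) \<longlonglongrightarrow> \<phi> x" if x: "x \<in> M" for x
    proof (rule LIMSEQ_I)
      fix r :: real assume r: "0 < r"
      define V where "V = {y \<in> M. \<phi> y \<in> {\<phi> x - r/2<..}}"
      have V: "openin mtopology V"
        using openin_continuous_map_preimage[OF c, of "{\<phi> x - r/2<..}"] by (simp add: V_def)
      have "x \<in> V" using x r by (simp add: V_def)
      with V obtain s where s: "s > 0" "mball x s \<subseteq> V"
        unfolding openin_mtopology by blast
      \<comment> \<open>Outside the ball of radius \<open>s\<close> the penalty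
        \<open>m * d x y\<close> is then at least \<open>2 * B\<close>, no less than any difference
        \<open>\<phi> x - \<phi> y\<close>.\<close>
      obtain m0 :: nat where m0: "2 * B / s < real m0" using reals_Archimedean2 by blast
      have "norm (g m x - \<phi> x) < r" if m: "m0 \<le> m" for m
      proof -
        have "\<phi> x - r / 2 \<le> g m x" unfolding g_def
        proof (rule cINF_greatest[OF ne])
          fix y assume y: "y \<in> M"
          show "\<phi> x - r / 2 \<le> \<phi> y + real m * d x y"
          proof (cases "d x y < s")
            case True
            then have "y \<in> V" using s x y by (auto simp: subset_iff)
            then have "\<phi> x - r / 2 < \<phi> y" by (simp add: V_def)
            then show ?thesis by (simp add: add_increasing2 less_imp_le)
          next
            case False
            have "2 * B \<le> real m0 * s" using m0 s by (simp add: field_simps)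
            also have "\<dots> \<le> real m * d x y" using m False s by (intro mult_mono) auto
            finally show ?thesis using B[OF x] Bl[OF y] r by (simp add: abs_le_iff)
          qed
        qed
        then show ?thesis using gphi[OF x, of m] r by simp
      qed
      then show "\<exists>no. \<forall>n\<ge>no. norm (g n x - \<phi> x) < r" by blast
    qed
    have "(\<lambda>m. \<integral>\<omega>. g m (Y \<omega>) \<partial>Q) \<longlonglongrightarrow> (\<integral>\<omega>. \<phi> (Y \<omega>) \<partial>Q)"
    proof (rule integral_dominated_convergence[where w="\<lambda>_. B"])
      show "AE \<omega> in Q. norm (g m (Y \<omega>)) \<le> B" for m
        using gabs[OF YM] by (intro AE_I2) simp
    qed (use lim YM random_element_continuous_map[OF Y] lipschitz_continuous_map[OF lip] c in auto)
    from LIMSEQ_D[OF this, of "e/2"] e obtain m where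
      m: "\<bar>(\<integral>\<omega>. g m (Y \<omega>) \<partial>Q) - (\<integral>\<omega>. \<phi> (Y \<omega>) \<partial>Q)\<bar> < e / 2" by auto
    from tendstoD[OF conv[OF _ lip bg, of m], of "e/2"] e
    have "\<forall>\<^sub>F n in sequentially. \<bar>(\<integral>\<omega>. g m (X n \<omega>) \<partial>P) - (\<integral>\<omega>. g m (Y \<omega>) \<partial>Q)\<bar> < e / 2"
      by (simp add: dist_real_def)
    then show ?thesis
    proof eventually_elim
      fix n assume n: "\<bar>(\<integral>\<omega>. g m (X n \<omega>) \<partial>P) - (\<integral>\<omega>. g m (Y \<omega>) \<partial>Q)\<bar> < e / 2"
      have "(\<integral>\<omega>. g m (X n \<omega>) \<partial>P) \<le> (\<integral>\<omega>. \<phi> (X n \<omega>) \<partial>P)"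
        using gphi[OF XM] int(1)[OF c b] int(1)[OF lipschitz_continuous_map[OF lip] bg]
        by (intro integral_mono) auto
      with n m show "(\<integral>\<omega>. \<phi> (Y \<omega>) \<partial>Q) - e < (\<integral>\<omega>. \<phi> (X n \<omega>) \<partial>P)" by linarith
    qed
  qed
  have "(\<lambda>n. \<integral>\<omega>. \<phi> (X n \<omega>) \<partial>P) \<longlonglongrightarrow> (\<integral>\<omega>. \<phi> (Y \<omega>) \<partial>Q)"
    if c: "continuous_map mtopology euclideanreal \<phi>" and b: "bounded (\<phi> ` M)" for \<phi>
  proof (rule tendstoI)
    fix e :: real assume e: "0 < e"
    have c': "continuous_map mtopology euclideanreal (\<lambda>x. - \<phi> x)" using c by (rule continuous_map_minus)
    have b': "bounded ((\<lambda>x. - \<phi> x) ` M)" using b by (simp add: bounded_iff)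
    show "\<forall>\<^sub>F n in sequentially. dist (\<integral>\<omega>. \<phi> (X n \<omega>) \<partial>P) (\<integral>\<omega>. \<phi> (Y \<omega>) \<partial>Q) < e"
      using lower[OF c b e] lower[OF c' b' e]
      by eventually_elim (simp add: dist_real_def abs_less_iff)
  qed
  then show ?thesis using X Y by (simp add: converges_in_distribution_def)
qed

end

text \<open>The map from coefficients to classes is continuous, since the distance of two sums is at
  most the sum of the coefficient differences weighted by the norms of the \<open>e i\<close>. The
  coefficients live in the full product space \<open>nat => real\<close>, where measurability of a
  random vector reduces to its coordinates.\<close>

lemma random_element_finite_rank:
  assumes e: "\<And>i. i < m \<Longrightarrow> e i \<in> l2_fun L"
    and c: "\<And>i. i < m \<Longrightarrow> c i \<in> borel_measurable N"
  shows "random_element (l2_topology L) N (\<lambda>\<omega>. l2_class L (\<lambda>y. \<Sum>i<m. c i \<omega> * e i y))"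
    and "continuous_map (l2_topology L) euclideanreal \<phi> \<Longrightarrow>
      continuous_on UNIV (\<lambda>x :: nat \<Rightarrow> real. \<phi> (l2_class L (\<lambda>y. \<Sum>i<m. x i * e i y)))"
proof -
  interpret H: Metric_space "L2 L" "l2_dist L" by (rule Metric_space_L2)
  define S where "S x = l2_class L (\<lambda>y. \<Sum>i<m. x i * e i y)" for x :: "nat \<Rightarrow> real"
  have lf: "(\<lambda>y. \<Sum>i<m. x i * e i y) \<in> l2_fun L" for x :: "nat \<Rightarrow> real"
    using e by (intro l2_fun_sum l2_fun_cmult) auto
  have SL: "S x \<in> L2 L" for x unfolding S_def by (intro l2_class_in_L2 lf)
  have dist: "l2_dist L (S x) (S x') \<le> (\<Sum>i<m. \<bar>x i - x' i\<bar> * l2_norm L (e i))" for x x'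
  proof -
    have "l2_dist L (S x) (S x') = l2_norm L (\<lambda>y. \<Sum>i<m. (x i - x' i) * e i y)"
      unfolding S_def by (simp add: l2_dist_norm[OF lf lf] sum_subtractf[symmetric] left_diff_distrib)
    also have "\<dots> \<le> (\<Sum>i<m. l2_norm L (\<lambda>y. (x i - x' i) * e i y))"
      using e by (intro l2_norm_sum l2_fun_cmult) auto
    finally show ?thesis by (simp add: l2_norm_cmult)
  qed
  have openS: "open (S -` U)" if U: "openin (l2_topology L) U" for U
    unfolding open_contains_ball_eq
  proof (subst open_subopen, intro ballI)
    fix x assume "x \<in> S -` U"
    then obtain r where r: "r > 0" "H.mball (S x) r \<subseteq> U"
      using U by (auto simp: l2_topology_def H.openin_mtopology)
    have "open {x'. (\<Sum>i<m. \<bar>x i - x' i\<bar> * l2_norm L (e i)) < r}"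
      by (intro open_Collect_less continuous_intros continuous_on_product_coordinates)
    moreover have "x \<in> {x'. (\<Sum>i<m. \<bar>x i - x' i\<bar> * l2_norm L (e i)) < r}" using r by simp
    moreover have "{x'. (\<Sum>i<m. \<bar>x i - x' i\<bar> * l2_norm L (e i)) < r} \<subseteq> S -` U"
    proof
      fix x' assume "x' \<in> {x'. (\<Sum>i<m. \<bar>x i - x' i\<bar> * l2_norm L (e i)) < r}"
      then have "l2_dist L (S x) (S x') < r" using dist[of x x'] by simp
      then show "x' \<in> S -` U" using r SL by auto
    qed
    ultimately show "\<exists>T. open T \<and> x \<in> T \<and> T \<subseteq> S -` U" by blast
  qed
  \<comment> \<open>Measurability of \<open>c i\<close> is known for \<open>i < m\<close> only; the
    other coordinates do not enter the sum and are set to 0.\<close>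
  define c' where "c' \<omega> i = (if i < m then c i \<omega> else 0)" for \<omega> i
  have c': "c' \<in> borel_measurable N"
    unfolding c'_def 
  proof (rule measurable_coordinatewise_then_product)
    show "(\<lambda>\<omega>. if i < m then c i \<omega> else 0) \<in> borel_measurable N" for i
      using c[of i] by (cases "i < m") auto
  qed
  have eq: "l2_class L (\<lambda>y. \<Sum>i<m. c i \<omega> * e i y) = S (c' \<omega>)" for \<omega>
    unfolding S_def c'_def by (intro arg_cong[where f="l2_class L"] ext sum.cong) auto
  have "random_element (l2_topology L) N (\<lambda>\<omega>. S (c' \<omega>))"
  proof (rule random_elementI)
    fix U assume "openin (l2_topology L) U"
    then have "open (S -` U)" by (rule openS)
    then have "S -` U \<in> sets borel" by (rule borel_open)
    from measurable_sets[OF c' this]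
    show "(\<lambda>\<omega>. S (c' \<omega>)) -` U \<inter> space N \<in> sets N"
      by (simp only: vimage_comp o_def)
  next
    show "S (c' \<omega>) \<in> topspace (l2_topology L)" for \<omega>
      unfolding topspace_l2 by (rule SL)
  qed
  then show "random_element (l2_topology L) N (\<lambda>\<omega>. l2_class L (\<lambda>y. \<Sum>i<m. c i \<omega> * e i y))"
    by (simp only: eq)
  show "continuous_on UNIV (\<lambda>x :: nat \<Rightarrow> real. \<phi> (l2_class L (\<lambda>y. \<Sum>i<m. x i * e i y)))"
    if phi: "continuous_map (l2_topology L) euclideanreal \<phi>"
  proof (subst continuous_on_open_vimage[OF open_UNIV], intro allI impI)
    fix B :: "real set" assume "open B"
    then have "openin (l2_topology L) {x \<in> topspace (l2_topology L). \<phi> x \<in> B}"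
      using openin_continuous_map_preimage[OF phi, of B] by simp
    then have "open (S -` {x \<in> topspace (l2_topology L). \<phi> x \<in> B})" by (rule openS)
    moreover have "S -` {x \<in> topspace (l2_topology L). \<phi> x \<in> B}
        = (\<lambda>x. \<phi> (l2_class L (\<lambda>y. \<Sum>i<m. x i * e i y))) -` B \<inter> UNIV"
      unfolding topspace_l2 S_def[symmetric] using SL by blast
    ultimately show "open ((\<lambda>x. \<phi> (l2_class L (\<lambda>y. \<Sum>i<m. x i * e i y))) -` B \<inter> UNIV)"
      by (simp only:)
  qed
qed

section \<open>Completeness of the space of square-integrable functions\<close>

text \<open>By \<open>2 * |a k| <= 2 ^ k * (a k) ^ 2 + (1/2) ^ k\<close>, the inequality of
  arithmetic and geometric means with a summable second term. It will serve for increments at a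
  fixed point and for increments in norm.\<close>

lemma summable_sqrt_weighted:
  fixes a :: "nat \<Rightarrow> real"
  assumes "summable (\<lambda>k. 2 ^ k * (a k)\<^sup>2)"
  shows "summable (\<lambda>k. \<bar>a k\<bar>)"
proof (rule summable_comparison_test')
  show "summable (\<lambda>k. 2 ^ k * (a k)\<^sup>2 + (1/2) ^ k)"
    using assms by (intro summable_add) (auto intro: summable_geometric)
  fix k
  have "0 \<le> (2 ^ k * \<bar>a k\<bar> - 1)\<^sup>2" by simp
  then have "2 * (2 ^ k * \<bar>a k\<bar>) \<le> 2 ^ k * (2 ^ k * (a k)\<^sup>2) + 1"
    by (simp add: power2_diff power_mult_distrib power2_eq_square algebra_simps)
  then have "2 ^ k * (2 * \<bar>a k\<bar>) \<le> 2 ^ k * (2 ^ k * (a k)\<^sup>2 + (1/2) ^ k)"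
    by (simp add: distrib_left power_one_over)
  then have "2 * \<bar>a k\<bar> \<le> 2 ^ k * (a k)\<^sup>2 + (1/2) ^ k" by (rule mult_left_le_imp_le) simp
  then show "norm \<bar>a k\<bar> \<le> 2 ^ k * (a k)\<^sup>2 + (1/2) ^ k" by simp
qed

lemma convergent_of_summable_diff:
  fixes f :: "nat \<Rightarrow> real"
  assumes "summable (\<lambda>k. \<bar>f (Suc k) - f k\<bar>)"
  shows "convergent f"
proof -
  have "summable (\<lambda>k. f (Suc k) - f k)"
    using assms by (rule summable_rabs_cancel)
  then have "convergent (\<lambda>n. \<Sum>k<n. f (Suc k) - f k)" by (simp add: summable_iff_convergent)
  then have "convergent (\<lambda>n. f n - f 0)" by (simp add: sum_lessThan_telescope)
  then have "convergent (\<lambda>n. f n - f 0 + f 0)" by (intro convergent_add convergent_const)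
  then show ?thesis by simp
qed

text \<open>Riesz-Fischer. The weighted sum of squared increments has finite integral, hence is
  finite almost everywhere; there the increments themselves are summable and \<open>f k x\<close>
  converges. Fatou's lemma bounds the distance to the limit by the tail of the norms of the
  increments.\<close>

lemma l2_complete:
  assumes f: "\<And>k. f k \<in> l2_fun L"
    and sm: "summable (\<lambda>k. 2 ^ k * (\<integral>x. (f (Suc k) x - f k x)\<^sup>2 \<partial>L))"
  obtains g where "g \<in> l2_fun L" "(\<lambda>k. l2_norm L (\<lambda>x. f k x - g x)) \<longlonglongrightarrow> 0"
proof -
  note [measurable] = l2_funD(1)[OF f]
  define D where "D k = l2_norm L (\<lambda>x. f (Suc k) x - f k x)" for k
  have fd: "(\<lambda>x. f k x - f l x) \<in> l2_fun L" for k l by (intro l2_fun_diff f)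
  \<comment> \<open>\<open>lim\<close> is total, so \<open>g\<close> is measurable at once; the
    points where the sequence diverges will form a null set.\<close>
  define g where "g x = lim (\<lambda>k. f k x)" for x
  have [measurable]: "g \<in> borel_measurable L" unfolding g_def by measurable
  have "(\<integral>\<^sup>+x. (\<Sum>k. ennreal (2 ^ k * (f (Suc k) x - f k x)\<^sup>2)) \<partial>L)
      = (\<Sum>k. \<integral>\<^sup>+x. ennreal (2 ^ k * (f (Suc k) x - f k x)\<^sup>2) \<partial>L)"
    by (rule nn_integral_suminf) measurable
  also have "\<dots> = (\<Sum>k. ennreal (2 ^ k * (\<integral>x. (f (Suc k) x - f k x)\<^sup>2 \<partial>L)))"
    using l2_funD(2)[OF fd] by (subst nn_integral_eq_integral) auto
  also have "\<dots> < \<infinity>"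
    unfolding infinity_ennreal_def less_top[symmetric] by (rule ennreal_suminf_neq_top[OF sm]) simp
  finally have "AE x in L. (\<Sum>k. ennreal (2 ^ k * (f (Suc k) x - f k x)\<^sup>2)) \<noteq> \<infinity>"
    by (intro nn_integral_PInf_AE) auto
  then have lim: "AE x in L. (\<lambda>k. f k x) \<longlonglongrightarrow> g x"
  proof eventually_elim
    fix x assume "(\<Sum>k. ennreal (2 ^ k * (f (Suc k) x - f k x)\<^sup>2)) \<noteq> \<infinity>"
    then have "summable (\<lambda>k. 2 ^ k * (f (Suc k) x - f k x)\<^sup>2)"
      by (intro summable_suminf_not_top) auto
    then show "(\<lambda>k. f k x) \<longlonglongrightarrow> g x"
      unfolding g_def convergent_LIMSEQ_iff[symmetric]
      by (intro convergent_of_summable_diff summable_sqrt_weighted)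
  qed
  have sD: "summable D"
  proof -
    have "summable (\<lambda>k. \<bar>D k\<bar>)"
      by (rule summable_sqrt_weighted) (use sm in \<open>simp add: D_def l2_norm_sq\<close>)
    then show ?thesis by (simp add: D_def[abs_def])
  qed
  have Dn: "0 \<le> D k" for k by (simp add: D_def)
  define T where "T k = (\<Sum>i. D (i + k))" for k
  have T0: "T \<longlonglongrightarrow> 0" unfolding T_def by (rule suminf_exist_split2[OF sD])
  have dist: "l2_norm L (\<lambda>x. f k x - f (k + l) x) \<le> T k" for k l
  proof -
    have "l2_norm L (\<lambda>x. f k x - f (k + l) x) \<le> (\<Sum>i<l. D (i + k))"
    proof (induction l)
      case (Suc l)
      have "l2_norm L (\<lambda>x. f k x - f (k + Suc l) x)
          \<le> l2_norm L (\<lambda>x. f k x - f (k + l) x) + l2_norm L (\<lambda>x. f (k + l) x - f (k + Suc l) x)"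
        by (intro l2_norm_diff_triangle f)
      also have "l2_norm L (\<lambda>x. f (k + l) x - f (k + Suc l) x) = D (l + k)"
        by (simp add: D_def l2_norm_commute[of L "f (k + l)"] add.commute)
      finally show ?case using Suc by simp
    qed simp
    also have "\<dots> \<le> T k"
      unfolding T_def using sD by (intro sum_le_suminf) (auto simp: D_def[symmetric] summable_iff_shift Dn)
    finally show ?thesis .
  qed
  \<comment> \<open>Fatou in the second index \<open>k + l\<close>; the bound \<open>T k\<close>
    does not depend on \<open>l\<close>.\<close>
  have bound: "(\<integral>\<^sup>+x. ennreal ((f k x - g x)\<^sup>2) \<partial>L) \<le> ennreal ((T k)\<^sup>2)" for k
  proof -
    have "(\<integral>\<^sup>+x. ennreal ((f k x - g x)\<^sup>2) \<partial>L)
        = (\<integral>\<^sup>+x. liminf (\<lambda>l. ennreal ((f k x - f (k + l) x)\<^sup>2)) \<partial>L)"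
    proof (rule nn_integral_cong_AE)
      show "AE x in L. ennreal ((f k x - g x)\<^sup>2) = liminf (\<lambda>l. ennreal ((f k x - f (k + l) x)\<^sup>2))"
        using lim
      proof eventually_elim
        fix x assume "(\<lambda>k. f k x) \<longlonglongrightarrow> g x"
        then have "(\<lambda>l. f (k + l) x) \<longlonglongrightarrow> g x"
          using LIMSEQ_ignore_initial_segment[of "\<lambda>k. f k x" "g x" k] by (simp add: add.commute)
        then have "(\<lambda>l. ennreal ((f k x - f (k + l) x)\<^sup>2)) \<longlonglongrightarrow> ennreal ((f k x - g x)\<^sup>2)"
          by (intro tendsto_intros)
        then show "ennreal ((f k x - g x)\<^sup>2) = liminf (\<lambda>l. ennreal ((f k x - f (k + l) x)\<^sup>2))"
          by (intro lim_imp_Liminf[symmetric]) auto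
      qed
    qed
    also have "\<dots> \<le> liminf (\<lambda>l. \<integral>\<^sup>+x. ennreal ((f k x - f (k + l) x)\<^sup>2) \<partial>L)"
      by (rule nn_integral_liminf) measurable
    also have "\<dots> = liminf (\<lambda>l. ennreal ((l2_norm L (\<lambda>x. f k x - f (k + l) x))\<^sup>2))"
      using l2_funD(2)[OF fd] by (subst nn_integral_eq_integral) (auto simp: l2_norm_sq)
    also have "\<dots> \<le> liminf (\<lambda>l. ennreal ((T k)\<^sup>2))"
      by (intro Liminf_mono always_eventually allI ennreal_leI power_mono dist) simp
    finally show ?thesis by (simp add: Liminf_const)
  qed
  have fg: "(\<lambda>x. f k x - g x) \<in> l2_fun L" for k
  proof -
    have "integrable L (\<lambda>x. (f k x - g x)\<^sup>2)"
      by (rule integrableI_bounded)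
        (use bound[of k] in \<open>auto intro: le_less_trans[OF _ ennreal_less_top]\<close>)
    then show ?thesis by (simp add: l2_fun_def)
  qed
  have "g \<in> l2_fun L"
    using l2_fun_diff[OF f[of 0] fg[of 0]] by simp
  moreover have "(\<lambda>k. l2_norm L (\<lambda>x. f k x - g x)) \<longlonglongrightarrow> 0"
  proof (rule tendsto_sandwich[OF _ _ tendsto_const T0])
    show "\<forall>\<^sub>F k in sequentially. l2_norm L (\<lambda>x. f k x - g x) \<le> T k"
    proof (intro always_eventually allI)
      fix k
      have T: "0 \<le> T k" using order_trans[OF l2_norm_nonneg dist] .
      have "ennreal (\<integral>x. (f k x - g x)\<^sup>2 \<partial>L) \<le> ennreal ((T k)\<^sup>2)"
        using bound[of k] l2_funD(2)[OF fg[of k]] by (subst (asm) nn_integral_eq_integral) auto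
      then have "(l2_norm L (\<lambda>x. f k x - g x))\<^sup>2 \<le> (T k)\<^sup>2"
        by (simp add: l2_norm_sq)
      then show "l2_norm L (\<lambda>x. f k x - g x) \<le> T k" using T by (rule power2_le_imp_le)
    qed
  qed auto
  ultimately show ?thesis by (rule that)
qed

section \<open>Gaussian sequences\<close>

text \<open>As \<open>inverse 0 = 0\<close>, a function that depends linearly on its predecessors is sent to \<open>0\<close>.\<close>

fun gram_schmidt :: "'a measure \<Rightarrow> (nat \<Rightarrow> 'a \<Rightarrow> real) \<Rightarrow> nat \<Rightarrow> 'a \<Rightarrow> real" where
  "gram_schmidt P v i =
    (let w = (\<lambda>x. v i x - (\<Sum>j<i. (\<integral>y. v i y * gram_schmidt P v j y \<partial>P) * gram_schmidt P v j x))
     in (\<lambda>x. inverse (l2_norm P w) * w x))"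

declare gram_schmidt.simps [simp del]

text \<open>The Cholesky factorization of the Gram matrix, with \<open>A i j\<close> the coefficient
  of \<open>v i\<close> along the orthonormalized function \<open>u j\<close>. Triangularity allows
  a single infinite matrix to serve every finite section \<open>m\<close>.\<close>

lemma gram_factorization:
  assumes v: "\<And>i. v i \<in> l2_fun P"
  obtains A :: "nat \<Rightarrow> nat \<Rightarrow> real" where
    "\<And>i l m. i < m \<Longrightarrow> l < m \<Longrightarrow> (\<integral>x. v i x * v l x \<partial>P) = (\<Sum>j<m. A i j * A l j)"
    "\<And>i j. i < j \<Longrightarrow> A i j = 0"
proof -
  define ip where "ip f g = (\<integral>x. f x * g x \<partial>P)" for f g :: "'a \<Rightarrow> real"
  define u where "u = gram_schmidt P v"
  define w where "w i = (\<lambda>x. v i x - (\<Sum>j<i. ip (v i) (u j) * u j x))" for i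
  have u_eq: "u i = (\<lambda>x. inverse (l2_norm P (w i)) * w i x)" for i
    unfolding u_def w_def ip_def by (rule gram_schmidt.simps[unfolded Let_def])
  have u: "u i \<in> l2_fun P" for i
  proof (induction i rule: less_induct)
    case (less i)
    have "w i \<in> l2_fun P" unfolding w_def
      by (intro l2_fun_diff v l2_fun_sum l2_fun_cmult less) auto
    then show ?case unfolding u_eq[of i] by (rule l2_fun_cmult)
  qed
  have w: "w i \<in> l2_fun P" for i
    unfolding w_def by (intro l2_fun_diff v l2_fun_sum l2_fun_cmult u)
  have ip_commute: "ip f g = ip g f" for f g by (simp add: ip_def mult.commute)
  have ip_cmult: "ip (\<lambda>x. c * f x) g = c * ip f g" for c f g by (simp add: ip_def mult.assoc)
  have ip_diff: "ip (\<lambda>x. f x - g x) h = ip f h - ip g h"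
    if "f \<in> l2_fun P" "g \<in> l2_fun P" "h \<in> l2_fun P" for f g h
    using l2_fun_mult[OF that(1,3)] l2_fun_mult[OF that(2,3)] by (simp add: ip_def left_diff_distrib)
  have ip_sum: "ip (\<lambda>x. \<Sum>i\<in>I. f i x) g = (\<Sum>i\<in>I. ip (f i) g)"
    if "\<And>i. f i \<in> l2_fun P" "g \<in> l2_fun P" for f g and I :: "nat set"
    using l2_fun_mult[OF that(1) that(2)] by (simp add: ip_def sum_distrib_right)
  have ip_w: "ip (w i) (w i) = (l2_norm P (w i))\<^sup>2" for i
    unfolding l2_norm_sq by (simp add: ip_def power2_eq_square)
  have unit: "ip (u i) (u i) = (if l2_norm P (w i) = 0 then 0 else 1)" for i
  proof -
    have "ip (u i) (u i) = (inverse (l2_norm P (w i)))\<^sup>2 * (l2_norm P (w i))\<^sup>2"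
      unfolding u_eq[of i] ip_cmult
      by (subst ip_commute) (simp add: ip_cmult ip_w power2_eq_square)
    then show ?thesis by (simp add: power_mult_distrib[symmetric])
  qed
  have u0: "u i = (\<lambda>x. 0)" if "l2_norm P (w i) = 0" for i
    unfolding u_eq[of i] using that by simp
  \<comment> \<open>Each \<open>u j\<close> is a unit vector or the zero function; in both cases its
    squared norm may be dropped here, which spares later case distinctions.\<close>
  have vu: "ip f (u j) * ip (u j) (u j) = ip f (u j)" for f j
  proof (cases "l2_norm P (w j) = 0")
    case True
    then show ?thesis by (simp add: unit u0[of j] ip_def)
  next
    case False
    then show ?thesis by (simp add: unit)
  qed
  have orth: "ip (u i) (u j) = 0" if "j < i" for i j
    using that
  proof (induction i arbitrary: j rule: less_induct)
    case (less i)
    have "ip (w i) (u j) = ip (v i) (u j) - (\<Sum>k<i. ip (v i) (u k) * ip (u k) (u j))"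
      unfolding w_def
      by (subst ip_diff) (simp_all add: ip_sum ip_cmult v u l2_fun_sum l2_fun_cmult)
    also have "(\<Sum>k<i. ip (v i) (u k) * ip (u k) (u j)) = (\<Sum>k<i. if k = j then ip (v i) (u j) else 0)"
    proof (rule sum.cong)
      fix k assume "k \<in> {..<i}"
      then show "ip (v i) (u k) * ip (u k) (u j) = (if k = j then ip (v i) (u j) else 0)"
        using less.IH[of k j] less.IH[of j k] less.prems ip_commute[of "u k" "u j"] vu
        by (cases j k rule: linorder_cases) auto
    qed simp
    also have "\<dots> = ip (v i) (u j)" using less.prems by simp
    finally show ?case unfolding u_eq[of i] ip_cmult by simp
  qed
  \<comment> \<open>The diagonal entry is the norm of the residual \<open>w i\<close>; if it is 0,
    the whole column \<open>i\<close> of \<open>A\<close> vanishes together with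
    \<open>u i\<close>.\<close>
  define A where "A i j = (if j < i then ip (v i) (u j) else if j = i then l2_norm P (w i) else 0)" for i j
  have A0: "A i j = 0" if "i < j" for i j using that by (simp add: A_def)
  have AA: "A i j * ip (u j) (u j) = A i j" for i j
    using vu[of "v i" j] by (auto simp: A_def unit)
  \<comment> \<open>Only almost everywhere, because a residual of norm 0 need not vanish at every
    point.\<close>
  have expand: "AE x in P. v i x = (\<Sum>j<m. A i j * u j x)" if "i < m" for i m
  proof -
    have "AE x in P. w i x = l2_norm P (w i) * u i x"
    proof (cases "l2_norm P (w i) = 0")
      case True
      then have "(\<integral>x. (w i x)\<^sup>2 \<partial>P) = 0" using l2_norm_sq[of P "w i"] by simp
      then have "AE x in P. (w i x)\<^sup>2 = 0"
        using l2_funD(2)[OF w[of i]] by (subst (asm) integral_nonneg_eq_0_iff_AE) auto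
      then show ?thesis using True by simp
    next
      case False
      then show ?thesis unfolding u_eq[of i] by simp
    qed
    then show ?thesis
    proof eventually_elim
      fix x assume "w i x = l2_norm P (w i) * u i x"
      then have "v i x = (\<Sum>j<i. A i j * u j x) + A i i * u i x"
        by (simp add: w_def A_def)
      also have "\<dots> = (\<Sum>j<Suc i. A i j * u j x)" by simp
      also have "\<dots> = (\<Sum>j<m. A i j * u j x)"
        using that A0 by (intro sum.mono_neutral_left) auto
      finally show "v i x = (\<Sum>j<m. A i j * u j x)" .
    qed
  qed
  show ?thesis
  proof (rule that)
    fix i l m :: nat assume m: "i < m" "l < m"
    have "(\<integral>x. v i x * v l x \<partial>P) = ip (\<lambda>x. \<Sum>j<m. A i j * u j x) (\<lambda>x. \<Sum>j<m. A l j * u j x)"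
      unfolding ip_def
    proof (rule integral_cong_AE)
      show "AE x in P. v i x * v l x = (\<Sum>j<m. A i j * u j x) * (\<Sum>j<m. A l j * u j x)"
        using expand[OF m(1)] expand[OF m(2)] by eventually_elim simp
      show "(\<lambda>x. v i x * v l x) \<in> borel_measurable P"
        "(\<lambda>x. (\<Sum>j<m. A i j * u j x) * (\<Sum>j<m. A l j * u j x)) \<in> borel_measurable P"
        using l2_funD(1)[OF v] l2_funD(1)[OF u] by measurable
    qed
    also have "\<dots> = (\<Sum>j<m. A i j * (\<Sum>k<m. A l k * ip (u k) (u j)))"
      by (simp add: ip_sum ip_cmult u l2_fun_cmult l2_fun_sum ip_commute[of "u _" "\<lambda>x. \<Sum>j<m. A l j * u j x"])
    also have "\<dots> = (\<Sum>j<m. A i j * A l j)"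
    proof (intro sum.cong refl, goal_cases)
      case (1 j)
      have "(\<Sum>k<m. A l k * ip (u k) (u j)) = (\<Sum>k<m. if k = j then A l j else 0)"
      proof (rule sum.cong)
        fix k
        show "A l k * ip (u k) (u j) = (if k = j then A l j else 0)"
          using orth[of k j] orth[of j k] ip_commute[of "u k" "u j"] AA
          by (cases j k rule: linorder_cases) auto
      qed simp
      then show ?case using 1 by simp
    qed
    finally show "(\<integral>x. v i x * v l x \<partial>P) = (\<Sum>j<m. A i j * A l j)" .
  qed (rule A0)
qed

text \<open>By Levy's uniqueness theorem \<open>X\<close> has the law of \<open>\<sigma> * x\<close>
  under the standard normal distribution, with \<open>\<sigma> = sqrt v\<close>, and the moments are
  read off from there. For \<open>\<sigma> = 0\<close> this law is the point mass at 0, which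
  \<open>normal_law\<close> admits.\<close>

lemma normal_char_imp:
  assumes N: "prob_space N" and X[measurable]: "X \<in> borel_measurable N"
    and char: "\<And>s. char (distr N borel X) s = complex_of_real (exp (- (s\<^sup>2 * v) / 2))" and v: "0 \<le> v"
  shows "normal_law (distr N borel X)" "X \<in> l2_fun N" "(\<integral>\<omega>. X \<omega> \<partial>N) = 0" "(\<integral>\<omega>. (X \<omega>)\<^sup>2 \<partial>N) = v"
proof -
  interpret N: prob_space N by fact
  define Z where "Z = std_normal_distribution"
  interpret Z: real_distribution Z unfolding Z_def by (rule real_dist_normal_dist)
  have [simp]: "sets Z = sets borel" "space Z = UNIV" by (simp_all add: Z_def)
  define \<sigma> where "\<sigma> = sqrt v"
  have \<sigma>: "0 \<le> \<sigma>" "\<sigma>\<^sup>2 = v" using v by (auto simp: \<sigma>_def)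
  have [measurable]: "(\<lambda>x. \<sigma> * x) \<in> borel_measurable Z" by (subst measurable_cong_sets[of _ borel _ borel]) auto
  have eq: "distr N borel X = distr Z borel (\<lambda>x. \<sigma> * x)"
  proof (rule Levy_uniqueness)
    show "real_distribution (distr N borel X)" by (rule N.real_distribution_distr) simp
    show "real_distribution (distr Z borel (\<lambda>x. \<sigma> * x))" by (rule Z.real_distribution_distr) simp
    have "char (distr Z borel (\<lambda>x. \<sigma> * x)) s = char Z (s * \<sigma>)" for s
      unfolding char_def by (subst integral_distr) (auto simp: mult.assoc)
    also have "char Z (s * \<sigma>) = char (distr N borel X) s" for s
      unfolding Z_def char_std_normal_distribution char by (simp add: power_mult_distrib \<sigma>)
    finally show "char (distr N borel X) = char (distr Z borel (\<lambda>x. \<sigma> * x))" by auto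
  qed
  show "normal_law (distr N borel X)"
  proof (cases "\<sigma> = 0")
    case True
    have "distr Z borel (\<lambda>x. 0) = return borel (0 :: real)" by (rule Z.distr_const) simp
    then have "distr Z borel (\<lambda>x. \<sigma> * x) = return borel 0" unfolding True by simp
    then show ?thesis unfolding eq normal_law_def by blast
  next
    case False
    then have "0 < \<sigma>" using \<sigma> by simp
    have "distributed Z lborel (\<lambda>x. x) std_normal_density"
      unfolding distributed_def Z_def by (auto simp: distr_id2)
    from Z.normal_density_affine[OF this _ False, of 0]
    have "distributed Z lborel (\<lambda>x. \<sigma> * x) (normal_density 0 \<sigma>)" using \<sigma> by simp
    then have "distr Z lborel (\<lambda>x. \<sigma> * x) = density lborel (normal_density 0 \<sigma>)"
      by (rule distributed_distr_eq_density)
    then have "distr Z borel (\<lambda>x. \<sigma> * x) = density lborel (normal_density 0 \<sigma>)"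
      by (simp cong: distr_cong)
    then show ?thesis unfolding eq normal_law_def using \<open>0 < \<sigma>\<close> by auto
  qed
  have m2: "integrable Z (\<lambda>x. x\<^sup>2)" "(\<integral>x. x\<^sup>2 \<partial>Z) = 1" "(\<integral>x. x \<partial>Z) = 0"
    using std_normal_distribution_even_moments(2)[of 1] std_normal_distribution_even_moments(1)[of 1]
      integral_std_normal_distribution_moment_odd[of 1] by (auto simp: Z_def fact_numeral)
  have "integrable (distr N borel X) (\<lambda>x. x\<^sup>2)"
    unfolding eq using m2 by (subst integrable_distr_eq) (auto simp: power_mult_distrib)
  then show "X \<in> l2_fun N" by (simp add: l2_fun_def integrable_distr_eq)
  have "(\<integral>\<omega>. X \<omega> \<partial>N) = (\<integral>x. x \<partial>distr N borel X)" by (simp add: integral_distr)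
  also have "\<dots> = \<sigma> * (\<integral>x. x \<partial>Z)" unfolding eq by (subst integral_distr) auto
  finally show "(\<integral>\<omega>. X \<omega> \<partial>N) = 0" using m2 by simp
  have "(\<integral>\<omega>. (X \<omega>)\<^sup>2 \<partial>N) = (\<integral>x. x\<^sup>2 \<partial>distr N borel X)" by (simp add: integral_distr)
  also have "\<dots> = \<sigma>\<^sup>2 * (\<integral>x. x\<^sup>2 \<partial>Z)" unfolding eq by (subst integral_distr) (auto simp: power_mult_distrib)
  finally show "(\<integral>\<omega>. (X \<omega>)\<^sup>2 \<partial>N) = v" using m2 \<sigma> by simp
qed

text \<open>The coordinates of the product space are independent standard normal variables, so the
  characteristic function factorizes.\<close>

lemma char_sum_std_normal:
  defines "N \<equiv> PiM UNIV (\<lambda>_ :: nat. std_normal_distribution)"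
  shows "char (distr N borel (\<lambda>\<omega>. \<Sum>j<m. a j * \<omega> j)) s
    = complex_of_real (exp (- (s\<^sup>2 * (\<Sum>j<m. (a j)\<^sup>2)) / 2))"
proof -
  let ?Z = std_normal_distribution
  have Z: "prob_space ?Z" using real_dist_normal_dist by (simp add: real_distribution_def)
  interpret N: prob_space N unfolding N_def by (rule prob_space_PiM) (rule Z)
  have [measurable]: "(\<lambda>\<omega>. \<omega> j) \<in> measurable N borel" for j
    unfolding N_def by (rule measurable_compose[OF measurable_component_singleton[of j]]) auto
  have comp: "distr N borel (\<lambda>\<omega>. \<omega> j) = ?Z" for j
  proof -
    have "distr N borel (\<lambda>\<omega>. \<omega> j) = distr N ?Z (\<lambda>\<omega>. \<omega> j)" by (rule distr_cong) auto
    also have "\<dots> = ?Z" unfolding N_def by (rule distr_PiM_component) (use Z in auto)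
    finally show ?thesis .
  qed
  have "N.indep_vars (\<lambda>_. borel) (\<lambda>j \<omega>. \<omega> j) UNIV"
  proof (subst N.indep_vars_iff_distr_eq_PiM)
    have "distr N (PiM UNIV (\<lambda>_ :: nat. borel)) (\<lambda>\<omega>. \<lambda>j\<in>UNIV. \<omega> j) = distr N N (\<lambda>\<omega>. \<omega>)"
      unfolding N_def by (intro distr_cong sets_PiM_cong) auto
    then show "distr N (PiM UNIV (\<lambda>_ :: nat. borel)) (\<lambda>\<omega>. \<lambda>j\<in>UNIV. \<omega> j)
        = PiM UNIV (\<lambda>j. distr N borel (\<lambda>\<omega>. \<omega> j))"
      unfolding comp by (simp add: N_def)
  qed auto
  then have "N.indep_vars (\<lambda>_. borel) (\<lambda>j \<omega>. a j * \<omega> j) UNIV"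
    by (rule N.indep_vars_compose2) auto
  then have "N.indep_vars (\<lambda>_. borel) (\<lambda>j \<omega>. a j * \<omega> j) {..<m}"
    by (rule N.indep_vars_subset) auto
  then have "char (distr N borel (\<lambda>\<omega>. \<Sum>j<m. a j * \<omega> j)) s
      = (\<Prod>j<m. char (distr N borel (\<lambda>\<omega>. a j * \<omega> j)) s)"
    by (rule N.char_distr_sum)
  also have "\<dots> = (\<Prod>j<m. complex_of_real (exp (- (s\<^sup>2 * (a j)\<^sup>2) / 2)))"
  proof (rule prod.cong[OF refl])
    fix j
    have "char (distr N borel (\<lambda>\<omega>. a j * \<omega> j)) s = char (distr N borel (\<lambda>\<omega>. \<omega> j)) (s * a j)"
      unfolding char_def by (simp add: integral_distr mult.assoc)
    then show "char (distr N borel (\<lambda>\<omega>. a j * \<omega> j)) s = complex_of_real (exp (- (s\<^sup>2 * (a j)\<^sup>2) / 2))"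
      by (simp add: comp char_std_normal_distribution power_mult_distrib)
  qed
  also have "\<dots> = complex_of_real (exp (- (s\<^sup>2 * (\<Sum>j<m. (a j)\<^sup>2)) / 2))"
    by (simp add: exp_sum[symmetric] of_real_prod[symmetric] sum_distrib_left sum_negf sum_divide_distrib[symmetric]
        del: of_real_prod of_real_exp)
  finally show ?thesis .
qed

text \<open>\<open>G i\<close> is row \<open>i\<close> of the Cholesky factor applied to independent
  standard normal coordinates; triangularity makes this a finite sum. A linear combination of the
  \<open>G i\<close> then has as its variance the squared norm of the same combination of the
  \<open>v i\<close>, which determines its characteristic function.\<close>

lemma gaussian_family:
  fixes v :: "nat \<Rightarrow> 'x \<Rightarrow> real"
  assumes v: "\<And>i. v i \<in> l2_fun P"
  obtains N :: "(nat \<Rightarrow> real) measure" and G where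
    "prob_space N" "\<And>i. G i \<in> l2_fun N"
    "\<And>i j. (\<integral>\<omega>. G i \<omega> * G j \<omega> \<partial>N) = (\<integral>x. v i x * v j x \<partial>P)"
    "\<And>m t s. char (distr N borel (\<lambda>\<omega>. \<Sum>i<m. t i * G i \<omega>)) s
       = complex_of_real (exp (- (s\<^sup>2 * (\<integral>x. (\<Sum>i<m. t i * v i x)\<^sup>2 \<partial>P)) / 2))"
proof -
  obtain A where A: "\<And>i l m. i < m \<Longrightarrow> l < m \<Longrightarrow> (\<integral>x. v i x * v l x \<partial>P) = (\<Sum>j<m. A i j * A l j)"
    and A0: "\<And>i j. i < j \<Longrightarrow> A i j = 0"
    using gram_factorization[of v P, OF v] by blast
  define N where "N = PiM UNIV (\<lambda>_ :: nat. std_normal_distribution)"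
  have Z: "prob_space std_normal_distribution" using real_dist_normal_dist by (simp add: real_distribution_def)
  interpret N: prob_space N unfolding N_def by (rule prob_space_PiM) (rule Z)
  have [measurable]: "(\<lambda>\<omega>. \<omega> j) \<in> measurable N borel" for j
    unfolding N_def by (rule measurable_compose[OF measurable_component_singleton[of j]]) auto
  define G where "G i \<omega> = (\<Sum>j<Suc i. A i j * \<omega> j)" for i and \<omega> :: "nat \<Rightarrow> real"
  have [measurable]: "G i \<in> borel_measurable N" for i unfolding G_def by measurable
  have char: "char (distr N borel (\<lambda>\<omega>. \<Sum>i<m. t i * G i \<omega>)) s
       = complex_of_real (exp (- (s\<^sup>2 * (\<integral>x. (\<Sum>i<m. t i * v i x)\<^sup>2 \<partial>P)) / 2))" for m t s
  proof -
    have "(\<Sum>i<m. t i * G i \<omega>) = (\<Sum>j<m. (\<Sum>i<m. t i * A i j) * \<omega> j)" for \<omega>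
    proof -
      have "G i \<omega> = (\<Sum>j<m. A i j * \<omega> j)" if "i < m" for i
        unfolding G_def using that A0 by (intro sum.mono_neutral_left) auto
      then have "(\<Sum>i<m. t i * G i \<omega>) = (\<Sum>i<m. \<Sum>j<m. t i * A i j * \<omega> j)"
        by (simp add: sum_distrib_left mult.assoc)
      also have "\<dots> = (\<Sum>j<m. (\<Sum>i<m. t i * A i j) * \<omega> j)"
        by (subst sum.swap) (simp add: sum_distrib_right)
      finally show ?thesis .
    qed
    then have 1: "char (distr N borel (\<lambda>\<omega>. \<Sum>i<m. t i * G i \<omega>)) s
        = complex_of_real (exp (- (s\<^sup>2 * (\<Sum>j<m. (\<Sum>i<m. t i * A i j)\<^sup>2)) / 2))"
      using char_sum_std_normal[where a="\<lambda>j. \<Sum>i<m. t i * A i j"] by (simp add: N_def)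
    have "(\<integral>x. (\<Sum>i<m. t i * v i x)\<^sup>2 \<partial>P) = (\<integral>x. (\<Sum>i<m. \<Sum>l<m. t i * t l * (v i x * v l x)) \<partial>P)"
      by (simp add: power2_eq_square sum_product mult_ac)
    also have "\<dots> = (\<Sum>i<m. \<Sum>l<m. t i * t l * (\<integral>x. v i x * v l x \<partial>P))"
      using l2_fun_mult[OF v v] by simp
    also have "\<dots> = (\<Sum>i<m. \<Sum>l<m. t i * t l * (\<Sum>j<m. A i j * A l j))"
      using A[of _ m] by simp
    also have "\<dots> = (\<Sum>i<m. \<Sum>l<m. \<Sum>j<m. (t i * A i j) * (t l * A l j))"
      by (simp add: sum_distrib_left mult_ac)
    also have "\<dots> = (\<Sum>i<m. \<Sum>j<m. \<Sum>l<m. (t i * A i j) * (t l * A l j))"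
      by (intro sum.cong refl sum.swap)
    also have "\<dots> = (\<Sum>j<m. \<Sum>i<m. \<Sum>l<m. (t i * A i j) * (t l * A l j))" by (rule sum.swap)
    also have "\<dots> = (\<Sum>j<m. (\<Sum>i<m. t i * A i j)\<^sup>2)"
      by (simp add: power2_eq_square sum_product)
    finally show ?thesis using 1 by simp
  qed
  have nonneg: "0 \<le> (\<integral>x. (\<Sum>i<m. t i * v i x)\<^sup>2 \<partial>P)" for t m by simp
  have nc: "(\<lambda>\<omega>. \<Sum>i<m. t i * G i \<omega>) \<in> l2_fun N"
      "(\<integral>\<omega>. (\<Sum>i<m. t i * G i \<omega>)\<^sup>2 \<partial>N) = (\<integral>x. (\<Sum>i<m. t i * v i x)\<^sup>2 \<partial>P)" for m t
    by (rule normal_char_imp[OF N.prob_space_axioms _ char nonneg], measurable)+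
  have single: "(\<Sum>k<m. (if k = i then 1 else 0) * f k) = f i" if "i < m" for f :: "nat \<Rightarrow> real" and i m
    using that by (simp add: if_distrib[of "\<lambda>x. x * _"] cong: if_cong)
  have G: "G i \<in> l2_fun N" for i
    using nc(1)[of "\<lambda>k. if k = i then 1 else 0" "Suc i"] single[of i "Suc i"] by simp
  have sq: "(\<integral>\<omega>. (G i \<omega>)\<^sup>2 \<partial>N) = (\<integral>x. (v i x)\<^sup>2 \<partial>P)" for i
    using nc(2)[of "\<lambda>k. if k = i then 1 else 0" "Suc i"] single[of i "Suc i"] by simp
  \<comment> \<open>Polarization. The coefficient vector is a sum of two unit vectors, which covers
    \<open>i = j\<close> as well.\<close>
  have sq2: "(\<integral>\<omega>. (G i \<omega> + G j \<omega>)\<^sup>2 \<partial>N) = (\<integral>x. (v i x + v j x)\<^sup>2 \<partial>P)" for i j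
  proof -
    define m where "m = Suc (max i j)"
    have m: "i < m" "j < m" by (auto simp: m_def)
    show ?thesis
      using nc(2)[of "\<lambda>k. (if k = i then 1 else 0) + (if k = j then 1 else 0)" m]
      by (simp add: distrib_right sum.distrib single m)
  qed
  have "(\<integral>\<omega>. G i \<omega> * G j \<omega> \<partial>N) = (\<integral>x. v i x * v j x \<partial>P)" for i j
    using sq2[of i j] sq l2_funD(2)[OF G] l2_funD(2)[OF v] l2_fun_mult[OF G G] l2_fun_mult[OF v v]
    by (simp add: power2_sum mult.assoc)
  then show ?thesis using that[of N G] N.prob_space_axioms G char by blast
qed

section \<open>Convergence of finite-dimensional distributions\<close>

text \<open>The phase \<open>b\<close> makes sines and constants special cases. The generation is
  linear because expectations and their limits are; closure under products is derived below.\<close>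

inductive trig_poly :: "nat \<Rightarrow> ((nat \<Rightarrow> real) \<Rightarrow> real) \<Rightarrow> bool" for m where
  cos: "trig_poly m (\<lambda>x. cos ((\<Sum>i<m. t i * x i) + b))"
| cmult: "trig_poly m f \<Longrightarrow> trig_poly m (\<lambda>x. c * f x)"
| add: "trig_poly m f \<Longrightarrow> trig_poly m g \<Longrightarrow> trig_poly m (\<lambda>x. f x + g x)"

lemma trig_poly_const: "trig_poly m (\<lambda>x. c)"
  using trig_poly.cmult[OF trig_poly.cos[of m "\<lambda>_. 0" 0], of c] by simp

lemma trig_poly_sin:
  assumes "i < m"
  shows "trig_poly m (\<lambda>x. sin (c * x i))"
proof -
  have "(\<Sum>j<m. (if j = i then c else 0) * x j) = c * x i" for x :: "nat \<Rightarrow> real"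
    using assms by (simp add: if_distrib[of "\<lambda>x. x * _"] cong: if_cong)
  then have "(\<lambda>x :: nat \<Rightarrow> real. sin (c * x i))
      = (\<lambda>x. cos ((\<Sum>j<m. (if j = i then c else 0) * x j) + (- (pi / 2))))"
    by (simp add: cos_add cos_diff)
  then show ?thesis by (simp only: trig_poly.cos)
qed

text \<open>The product-to-sum formula turns a product of two cosines into a sum of two; linearity
  in each factor does the rest, by an induction inside an induction.\<close>

lemma trig_poly_mult:
  assumes "trig_poly m f" "trig_poly m g"
  shows "trig_poly m (\<lambda>x. f x * g x)"
  using assms(1)
proof induction
  case (cos t b)
  show ?case using assms(2)
  proof induction
    case (cos s d)
    have "cos ((\<Sum>i<m. t i * x i) + b) * cos ((\<Sum>i<m. s i * x i) + d)
        = (1/2) * cos ((\<Sum>i<m. (t i - s i) * x i) + (b - d))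
          + (1/2) * cos ((\<Sum>i<m. (t i + s i) * x i) + (b + d))" for x :: "nat \<Rightarrow> real"
      by (simp add: cos_times_cos distrib_right left_diff_distrib sum_subtractf sum.distrib algebra_simps
          add_divide_distrib)
    then show ?case
      by (simp only:) (intro trig_poly.add trig_poly.cmult trig_poly.cos)
  next
    case (cmult f c)
    then show ?case
      using trig_poly.cmult[OF cmult.IH, of c] by (simp add: mult_ac)
  next
    case (add f g)
    then show ?case
      using trig_poly.add[OF add.IH] by (simp add: distrib_left)
  qed
next
  case (cmult f c)
  then show ?case using trig_poly.cmult[OF cmult.IH, of c] by (simp add: mult_ac)
next
  case (add f g)
  then show ?case using trig_poly.add[OF add.IH] by (simp add: distrib_right)
qed

lemma trig_poly_continuous: "trig_poly m T \<Longrightarrow> continuous_on UNIV T"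
  by (induction rule: trig_poly.induct) (auto intro!: continuous_intros)

lemma trig_poly_bounded:
  assumes "trig_poly m T"
  shows "\<exists>B. \<forall>x. \<bar>T x\<bar> \<le> B"
  using assms
proof induction
  case (cos t b)
  show ?case by (intro exI[of _ 1]) simp
next
  case (cmult f c)
  then obtain B where "\<forall>x. \<bar>f x\<bar> \<le> B" by blast
  then show ?case by (intro exI[of _ "\<bar>c\<bar> * B"]) (simp add: abs_mult mult_left_mono)
next
  case (add f g)
  then obtain B C where "\<forall>x. \<bar>f x\<bar> \<le> B" "\<forall>x. \<bar>g x\<bar> \<le> C" by blast
  then show ?case by (intro exI[of _ "B + C"]) (metis abs_triangle_ineq add_mono order_trans)
qed

text \<open>Polynomials in the first \<open>m\<close> coordinates, generated by the closure
  properties that the Stone-Weierstrass theorem asks for.\<close>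

inductive poly_coord :: "nat \<Rightarrow> ((nat \<Rightarrow> real) \<Rightarrow> real) \<Rightarrow> bool" for m where
  coord: "i < m \<Longrightarrow> poly_coord m (\<lambda>x. x i)"
| const: "poly_coord m (\<lambda>x. c)"
| add: "poly_coord m f \<Longrightarrow> poly_coord m g \<Longrightarrow> poly_coord m (\<lambda>x. f x + g x)"
| mult: "poly_coord m f \<Longrightarrow> poly_coord m g \<Longrightarrow> poly_coord m (\<lambda>x. f x * g x)"

lemma poly_coord_continuous: "poly_coord m p \<Longrightarrow> continuous_on S p"
  by (induction rule: poly_coord.induct)
    (auto intro!: continuous_intros intro: continuous_on_subset[OF continuous_on_product_coordinates])

lemma poly_coord_sin: "poly_coord m p \<Longrightarrow> trig_poly m (\<lambda>x. p (\<lambda>i. sin (c * x i)))"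
  by (induction rule: poly_coord.induct)
    (auto intro: trig_poly_sin trig_poly_const trig_poly_mult trig_poly.add)

lemma poly_coord_cong: "poly_coord m p \<Longrightarrow> (\<And>i. i < m \<Longrightarrow> x i = y i) \<Longrightarrow> p x = p y"
  by (induction rule: poly_coord.induct) auto

text \<open>The substitution \<open>x \<mapsto> arcsin (sin x)\<close> is the identity near \<open>0\<close> and factors through \<open>sin\<close>, so the
  Weierstrass approximation on the cube yields a trigonometric polynomial that is close to \<open>\<psi>\<close> on
  a large box and bounded by about \<open>B\<close> everywhere.\<close>

lemma trig_poly_approx:
  fixes \<psi> :: "(nat \<Rightarrow> real) \<Rightarrow> real"
  assumes cont: "continuous_on UNIV \<psi>" and dep: "\<And>x y. (\<And>i. i < m \<Longrightarrow> x i = y i) \<Longrightarrow> \<psi> x = \<psi> y"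
    and B: "\<And>x. \<bar>\<psi> x\<bar> \<le> B" and R: "0 < R" and e: "0 < e"
  obtains T where "trig_poly m T" "\<And>x. \<bar>T x\<bar> \<le> B + e"
    "\<And>x. (\<And>i. i < m \<Longrightarrow> \<bar>x i\<bar> \<le> R) \<Longrightarrow> \<bar>T x - \<psi> x\<bar> \<le> e"
proof -
  \<comment> \<open>Pinning the coordinates from \<open>m\<close> on to 0 lets polynomials in the
    first \<open>m\<close> coordinates separate the points of this compact set.\<close>
  define S where "S = (\<Pi>\<^sub>E i\<in>UNIV. if i < m then {-1..1::real} else {0})"
  have S: "x \<in> S \<longleftrightarrow> (\<forall>i. (i < m \<longrightarrow> \<bar>x i\<bar> \<le> 1) \<and> (\<not> i < m \<longrightarrow> x i = 0))" for x
    by (auto simp: S_def PiE_iff abs_le_iff split: if_splits) (force+)?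
  have "compactin (product_topology (\<lambda>i. euclidean) UNIV) S"
    unfolding S_def compactin_PiE by auto
  then have comp: "compact S" by (simp add: euclidean_product_topology)
  define \<Psi> where "\<Psi> s = \<psi> (\<lambda>i. 2 * R / pi * arcsin (s i))" for s :: "nat \<Rightarrow> real"
  have c\<Psi>: "continuous_on S \<Psi>"
    unfolding \<Psi>_def
  proof (rule continuous_on_compose2[OF cont])
    show "continuous_on S (\<lambda>s i. 2 * R / pi * arcsin (s i))"
    proof (rule continuous_on_coordinatewise_then_product)
      fix i
      have "continuous_on S (\<lambda>s. s i)"
        by (rule continuous_on_subset[OF continuous_on_product_coordinates]) simp
      moreover have "\<forall>s\<in>S. - 1 \<le> s i \<and> s i \<le> 1"
      proof
        fix s assume "s \<in> S"
        then show "- 1 \<le> s i \<and> s i \<le> 1" using S[of s] by (cases "i < m") (auto simp: abs_le_iff)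
      qed
      ultimately have "continuous_on S (\<lambda>s. arcsin (s i))" by (rule continuous_on_arcsin)
      then show "continuous_on S (\<lambda>s. 2 * R / pi * arcsin (s i))"
        by (intro continuous_on_mult_left)
    qed
  qed simp
  have "\<exists>g. poly_coord m g \<and> (\<forall>s\<in>S. \<bar>\<Psi> s - g s\<bar> < e)"
  proof (rule Stone_Weierstrass_HOL[OF comp _ _ _ _ _ c\<Psi> e])
    fix x y assume xy: "x \<in> S \<and> y \<in> S \<and> x \<noteq> y"
    then obtain i where "x i \<noteq> y i" by auto
    moreover from this have "i < m" using xy unfolding S by metis
    ultimately show "\<exists>f. poly_coord m f \<and> f x \<noteq> f y" using poly_coord.coord by blast
  qed (auto intro: poly_coord.intros poly_coord_continuous)
  then obtain p where p: "poly_coord m p" "\<And>s. s \<in> S \<Longrightarrow> \<bar>\<Psi> s - p s\<bar> < e" by blast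
  \<comment> \<open>With this scale \<open>\<bar>x i\<bar> \<le> R\<close> puts
    \<open>c * x i\<close> between \<open>- pi / 2\<close> and \<open>pi / 2\<close>, where
    \<open>arcsin\<close> inverts \<open>sin\<close>; the factor \<open>2 * R / pi\<close> in
    \<open>\<Psi>\<close> is \<open>1 / c\<close>.\<close>
  define c where "c = pi / (2 * R)"
  define T where "T x = p (\<lambda>i. sin (c * x i))" for x :: "nat \<Rightarrow> real"
  define s where "s x i = (if i < m then sin (c * x i) else 0)" for x :: "nat \<Rightarrow> real" and i
  have sS: "s x \<in> S" for x unfolding S by (simp add: s_def)
  have T: "T x = p (s x)" for x unfolding T_def by (rule poly_coord_cong[OF p(1)]) (simp add: s_def)
  show ?thesis
  proof (rule that)
    show "trig_poly m T" unfolding T_def by (rule poly_coord_sin[OF p(1)])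
    \<comment> \<open>\<open>s x\<close> lies in \<open>S\<close> for every \<open>x\<close>, so the
      error bound on the cube controls \<open>T\<close> on the whole space and not only on the
      box.\<close>
    show "\<bar>T x\<bar> \<le> B + e" for x
      using p(2)[OF sS, of x] B[of "\<lambda>i. 2 * R / pi * arcsin (s x i)"]
      unfolding T \<Psi>_def by linarith
    fix x :: "nat \<Rightarrow> real" assume x: "\<And>i. i < m \<Longrightarrow> \<bar>x i\<bar> \<le> R"
    have "\<Psi> (s x) = \<psi> x" unfolding \<Psi>_def
    proof (rule dep)
      fix i assume i: "i < m"
      have "\<bar>c * x i\<bar> \<le> c * R" unfolding abs_mult using x[OF i] R
        by (intro mult_mono) (auto simp: c_def)
      also have "c * R = pi / 2" using R by (simp add: c_def)
      finally have "arcsin (sin (c * x i)) = c * x i" by (intro arcsin_sin) auto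
      then show "2 * R / pi * arcsin (s x i) = x i" using i R by (simp add: s_def c_def)
    qed
    then show "\<bar>T x - \<psi> x\<bar> \<le> e" using p(2)[OF sS, of x] unfolding T by (simp add: abs_minus_commute)
  qed
qed

text \<open>The expectation of a cosine with phase \<open>b\<close> is the real part of
  \<open>iexp b\<close> times the characteristic function of the linear form at 1; linear
  combinations follow by induction.\<close>

lemma trig_poly_expectation_tendsto:
  assumes T: "trig_poly m T" and P: "prob_space P" and Q: "prob_space Q"
    and V: "\<And>n i. V n i \<in> borel_measurable P" and G: "\<And>i. G i \<in> borel_measurable Q"
    and char: "\<And>t. (\<lambda>n. char (distr P borel (\<lambda>\<omega>. \<Sum>i<m. t i * V n i \<omega>)) 1)
      \<longlonglongrightarrow> char (distr Q borel (\<lambda>\<omega>. \<Sum>i<m. t i * G i \<omega>)) 1"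
  shows "(\<lambda>n. \<integral>\<omega>. T (\<lambda>i. V n i \<omega>) \<partial>P) \<longlonglongrightarrow> (\<integral>\<omega>. T (\<lambda>i. G i \<omega>) \<partial>Q)"
proof -
  have int: "integrable N (\<lambda>\<omega>. f (\<lambda>i. X i \<omega>))"
    if N: "prob_space N" and X: "\<And>i. X i \<in> borel_measurable N" and f: "trig_poly m f"
    for N :: "'z measure" and X and f
  proof -
    interpret N: prob_space N by fact
    obtain B where "\<forall>x. \<bar>f x\<bar> \<le> B" using trig_poly_bounded[OF f] by blast
    moreover have "(\<lambda>\<omega>. f (\<lambda>i. X i \<omega>)) \<in> borel_measurable N"
      using borel_measurable_continuous_onI[OF trig_poly_continuous[OF f]]
      by (rule measurable_compose[rotated]) (intro measurable_coordinatewise_then_product X)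
    ultimately show ?thesis by (intro N.integrable_const_bound[of _ B]) auto
  qed
  have cosint: "(\<integral>\<omega>. cos ((\<Sum>i<m. t i * X i \<omega>) + b) \<partial>N)
      = Re (iexp b * char (distr N borel (\<lambda>\<omega>. \<Sum>i<m. t i * X i \<omega>)) 1)"
    if N: "prob_space N" and X[measurable]: "\<And>i. X i \<in> borel_measurable N"
    for N :: "'z measure" and X t b
  proof -
    interpret N: prob_space N by fact
    have "iexp b * char (distr N borel (\<lambda>\<omega>. \<Sum>i<m. t i * X i \<omega>)) 1
        = (\<integral>\<omega>. iexp b * iexp (\<Sum>i<m. t i * X i \<omega>) \<partial>N)"
      unfolding char_def by (subst integral_distr) auto
    also have "\<dots> = (\<integral>\<omega>. iexp ((\<Sum>i<m. t i * X i \<omega>) + b) \<partial>N)"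
      by (simp add: exp_add[symmetric] algebra_simps)
    finally have "Re (iexp b * char (distr N borel (\<lambda>\<omega>. \<Sum>i<m. t i * X i \<omega>)) 1)
        = Re (\<integral>\<omega>. iexp ((\<Sum>i<m. t i * X i \<omega>) + b) \<partial>N)" by (rule arg_cong)
    also have "\<dots> = (\<integral>\<omega>. Re (iexp ((\<Sum>i<m. t i * X i \<omega>) + b)) \<partial>N)"
    proof (rule integral_Re[symmetric])
      show "complex_integrable N (\<lambda>\<omega>. iexp ((\<Sum>i<m. t i * X i \<omega>) + b))"
        by (rule N.integrable_iexp) auto
    qed
    finally show ?thesis by (simp add: Re_exp)
  qed
  show ?thesis using T
  proof induction
    case (cos t b)
    show ?case unfolding cosint[OF P V] cosint[OF Q G]
      by (intro tendsto_Re tendsto_mult tendsto_const char)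
  next
    case (cmult f c)
    then show ?case by (simp add: tendsto_mult_left)
  next
    case (add f g)
    have "(\<integral>\<omega>. f (\<lambda>i. V n i \<omega>) + g (\<lambda>i. V n i \<omega>) \<partial>P)
        = (\<integral>\<omega>. f (\<lambda>i. V n i \<omega>) \<partial>P) + (\<integral>\<omega>. g (\<lambda>i. V n i \<omega>) \<partial>P)" for n
      using add.hyps by (intro Bochner_Integration.integral_add int P V)
    moreover have "(\<integral>\<omega>. f (\<lambda>i. G i \<omega>) + g (\<lambda>i. G i \<omega>) \<partial>Q)
        = (\<integral>\<omega>. f (\<lambda>i. G i \<omega>) \<partial>Q) + (\<integral>\<omega>. g (\<lambda>i. G i \<omega>) \<partial>Q)"
      using add.hyps by (intro Bochner_Integration.integral_add int Q G)
    ultimately show ?case using tendsto_add[OF add.IH] by simp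
  qed
qed

text \<open>The common bound \<open>C\<close> on second moments takes the place of tightness: off
  the box of size \<open>R\<close> the function and its trigonometric approximation differ by a
  bounded amount, which is charged to the sum of the squared coordinates divided by
  \<open>R ^ 2\<close>.\<close>

lemma cramer_wold:
  fixes \<psi> :: "(nat \<Rightarrow> real) \<Rightarrow> real"
  assumes P: "prob_space P" and Q: "prob_space Q"
    and V: "\<And>n i. V n i \<in> l2_fun P" and G: "\<And>i. G i \<in> l2_fun Q"
    and VC: "\<And>n i. i < m \<Longrightarrow> (\<integral>\<omega>. (V n i \<omega>)\<^sup>2 \<partial>P) \<le> C" and GC: "\<And>i. i < m \<Longrightarrow> (\<integral>\<omega>. (G i \<omega>)\<^sup>2 \<partial>Q) \<le> C"
    and char: "\<And>t. (\<lambda>n. char (distr P borel (\<lambda>\<omega>. \<Sum>i<m. t i * V n i \<omega>)) 1)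
      \<longlonglongrightarrow> char (distr Q borel (\<lambda>\<omega>. \<Sum>i<m. t i * G i \<omega>)) 1"
    and cont: "continuous_on UNIV \<psi>" and dep: "\<And>x y. (\<And>i. i < m \<Longrightarrow> x i = y i) \<Longrightarrow> \<psi> x = \<psi> y"
    and B: "\<And>x. \<bar>\<psi> x\<bar> \<le> B"
  shows "(\<lambda>n. \<integral>\<omega>. \<psi> (\<lambda>i. V n i \<omega>) \<partial>P) \<longlonglongrightarrow> (\<integral>\<omega>. \<psi> (\<lambda>i. G i \<omega>) \<partial>Q)"
proof (rule tendstoI)
  fix e :: real assume e: "0 < e"
  \<comment> \<open>The two replacements of \<open>\<psi>\<close> by \<open>T\<close> cost
    \<open>2 * \<epsilon>\<close> each and the convergence for \<open>T\<close> costs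
    \<open>\<epsilon>\<close>, in total less than \<open>8 * \<epsilon>\<close>.\<close>
  define \<epsilon> where "\<epsilon> = e / 8"
  have \<epsilon>: "0 < \<epsilon>" using e by (simp add: \<epsilon>_def)
  have B0: "0 \<le> B" using B[of undefined] by linarith
  define D where "D = (2 * B + \<epsilon>) * (real m * \<bar>C\<bar>)"
  have D: "0 \<le> D" using B0 \<epsilon> by (simp add: D_def)
  \<comment> \<open>\<open>D\<close> bounds the contribution from outside the box before division by
    \<open>R ^ 2\<close>. This \<open>R\<close> makes the quotient at most
    \<open>\<epsilon>\<close>, and the summand 1 keeps \<open>R\<close> positive if
    \<open>D = 0\<close>.\<close>
  define R where "R = sqrt (D / \<epsilon> + 1)"
  have R: "0 < R" "R\<^sup>2 = D / \<epsilon> + 1" using D \<epsilon> by (auto simp: R_def add_nonneg_pos)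
  obtain T where T: "trig_poly m T" and TB: "\<And>x. \<bar>T x\<bar> \<le> B + \<epsilon>"
    and Tp: "\<And>x. (\<And>i. i < m \<Longrightarrow> \<bar>x i\<bar> \<le> R) \<Longrightarrow> \<bar>T x - \<psi> x\<bar> \<le> \<epsilon>"
    using trig_poly_approx[OF cont dep B R(1) \<epsilon>] by metis
  \<comment> \<open>Markov's inequality in pointwise form: outside the box the sum of squares
    divided by \<open>R ^ 2\<close> is at least 1.\<close>
  have pw: "\<bar>T x - \<psi> x\<bar> \<le> \<epsilon> + (2 * B + \<epsilon>) / R\<^sup>2 * (\<Sum>i<m. (x i)\<^sup>2)" for x
  proof (cases "\<forall>i<m. \<bar>x i\<bar> \<le> R")
    case True
    then have "\<bar>T x - \<psi> x\<bar> \<le> \<epsilon>" by (intro Tp) auto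
    moreover have "0 \<le> (2 * B + \<epsilon>) / R\<^sup>2 * (\<Sum>i<m. (x i)\<^sup>2)"
      using B0 \<epsilon> by (intro mult_nonneg_nonneg sum_nonneg) auto
    ultimately show ?thesis by linarith
  next
    case False
    then obtain i where i: "i < m" "R < \<bar>x i\<bar>" by (auto simp: not_le)
    have "R\<^sup>2 \<le> (x i)\<^sup>2" using power_mono[of R "\<bar>x i\<bar>" 2] i R(1) by simp
    also have "\<dots> \<le> (\<Sum>i<m. (x i)\<^sup>2)" using i by (intro member_le_sum) auto
    finally have "1 \<le> (\<Sum>i<m. (x i)\<^sup>2) / R\<^sup>2" using R(1) by (simp add: field_simps)
    then have "(2 * B + \<epsilon>) * 1 \<le> (2 * B + \<epsilon>) * ((\<Sum>i<m. (x i)\<^sup>2) / R\<^sup>2)"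
      using B0 \<epsilon> by (intro mult_left_mono) auto
    moreover have "\<bar>T x - \<psi> x\<bar> \<le> 2 * B + \<epsilon>" using TB[of x] B[of x] by linarith
    ultimately show ?thesis using \<epsilon> by simp
  qed
  have close: "\<bar>(\<integral>\<omega>. T (\<lambda>i. X i \<omega>) \<partial>N) - (\<integral>\<omega>. \<psi> (\<lambda>i. X i \<omega>) \<partial>N)\<bar> \<le> 2 * \<epsilon>"
    if N: "prob_space N" and X: "\<And>i. X i \<in> l2_fun N" and XC: "\<And>i. i < m \<Longrightarrow> (\<integral>\<omega>. (X i \<omega>)\<^sup>2 \<partial>N) \<le> C"
    for N :: "'z measure" and X
  proof -
    interpret N: prob_space N by fact
    have m: "(\<lambda>\<omega> i. X i \<omega>) \<in> borel_measurable N"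
      by (intro measurable_coordinatewise_then_product l2_funD(1) X)
    have iT: "integrable N (\<lambda>\<omega>. T (\<lambda>i. X i \<omega>))"
      using measurable_compose[OF m borel_measurable_continuous_onI[OF trig_poly_continuous[OF T]]] TB
      by (intro N.integrable_const_bound[of _ "B + \<epsilon>"]) auto
    have i\<psi>: "integrable N (\<lambda>\<omega>. \<psi> (\<lambda>i. X i \<omega>))"
      using measurable_compose[OF m borel_measurable_continuous_onI[OF cont]] B
      by (intro N.integrable_const_bound[of _ B]) auto
    have "\<bar>(\<integral>\<omega>. T (\<lambda>i. X i \<omega>) \<partial>N) - (\<integral>\<omega>. \<psi> (\<lambda>i. X i \<omega>) \<partial>N)\<bar>
        = \<bar>\<integral>\<omega>. T (\<lambda>i. X i \<omega>) - \<psi> (\<lambda>i. X i \<omega>) \<partial>N\<bar>"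
      using iT i\<psi> by simp
    also have "\<dots> \<le> (\<integral>\<omega>. \<bar>T (\<lambda>i. X i \<omega>) - \<psi> (\<lambda>i. X i \<omega>)\<bar> \<partial>N)" by (rule integral_abs_bound)
    also have "\<dots> \<le> (\<integral>\<omega>. \<epsilon> + (2 * B + \<epsilon>) / R\<^sup>2 * (\<Sum>i<m. (X i \<omega>)\<^sup>2) \<partial>N)"
      using iT i\<psi> l2_funD(2)[OF X] pw by (intro integral_mono) auto
    also have "\<dots> = \<epsilon> + (2 * B + \<epsilon>) / R\<^sup>2 * (\<Sum>i<m. \<integral>\<omega>. (X i \<omega>)\<^sup>2 \<partial>N)"
      using l2_funD(2)[OF X] by (simp add: N.prob_space)
    also have "\<dots> \<le> \<epsilon> + (2 * B + \<epsilon>) / R\<^sup>2 * (real m * \<bar>C\<bar>)"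
    proof -
      have "(\<Sum>i<m. \<integral>\<omega>. (X i \<omega>)\<^sup>2 \<partial>N) \<le> (\<Sum>i<m. \<bar>C\<bar>)"
        using XC by (intro sum_mono) (auto intro: order_trans[OF _ abs_ge_self])
      then show ?thesis using B0 \<epsilon> by (intro add_left_mono mult_left_mono) auto
    qed
    also have "\<dots> = \<epsilon> + D / R\<^sup>2" by (simp add: D_def)
    also have "D / R\<^sup>2 \<le> \<epsilon>"
    proof -
      have "D \<le> \<epsilon> * (D / \<epsilon> + 1)" using \<epsilon> by (simp add: distrib_left)
      then have "D \<le> \<epsilon> * R\<^sup>2" unfolding R(2) .
      then show ?thesis using R(1) by (simp add: pos_divide_le_eq)
    qed
    finally show ?thesis by simp
  qed
  have "(\<lambda>n. \<integral>\<omega>. T (\<lambda>i. V n i \<omega>) \<partial>P) \<longlonglongrightarrow> (\<integral>\<omega>. T (\<lambda>i. G i \<omega>) \<partial>Q)"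
    by (rule trig_poly_expectation_tendsto[OF T P Q l2_funD(1)[OF V] l2_funD(1)[OF G] char])
  from tendstoD[OF this \<epsilon>]
  show "\<forall>\<^sub>F n in sequentially. dist (\<integral>\<omega>. \<psi> (\<lambda>i. V n i \<omega>) \<partial>P) (\<integral>\<omega>. \<psi> (\<lambda>i. G i \<omega>) \<partial>Q) < e"
  proof eventually_elim
    case (elim n)
    have "\<bar>(\<integral>\<omega>. T (\<lambda>i. V n i \<omega>) \<partial>P) - (\<integral>\<omega>. \<psi> (\<lambda>i. V n i \<omega>) \<partial>P)\<bar> \<le> 2 * \<epsilon>"
      by (rule close[OF P V VC])
    moreover have "\<bar>(\<integral>\<omega>. T (\<lambda>i. G i \<omega>) \<partial>Q) - (\<integral>\<omega>. \<psi> (\<lambda>i. G i \<omega>) \<partial>Q)\<bar> \<le> 2 * \<epsilon>"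
      by (rule close[OF Q G GC])
    ultimately show ?case using elim \<epsilon> unfolding dist_real_def \<epsilon>_def by linarith
  qed
qed

section \<open>Normalized sums of independent identically distributed observations\<close>

text \<open>The measure \<open>S\<close> is both the target space and the common law of the
  \<open>Y i\<close>, so the expectation of a function of one observation is an integral over
  \<open>S\<close>. Observations are numbered from 0.\<close>

locale iid_sequence = prob_space M for M :: "'a measure" +
  fixes S :: "'x measure" and Y :: "nat \<Rightarrow> 'a \<Rightarrow> 'x"
  assumes indep: "indep_vars (\<lambda>_. S) Y UNIV"
    and distr_Y: "\<And>i. distr M S (Y i) = S"
begin

lemma measurable_Y [measurable]: "Y i \<in> measurable M S"
  using indep by (simp add: indep_vars_def2)

lemma prob_space_S: "prob_space S"
  using prob_space_distr[OF measurable_Y[of 0]] by (simp add: distr_Y)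

lemma integral_Y: "f \<in> borel_measurable S \<Longrightarrow> (\<integral>\<omega>. f (Y i \<omega>) \<partial>M) = (\<integral>x. f x \<partial>S)" for f :: "'x \<Rightarrow> real"
  using integral_distr[OF measurable_Y, of f i] by (simp add: distr_Y)

lemma l2_fun_Y: "f \<in> l2_fun S \<Longrightarrow> (\<lambda>\<omega>. f (Y i \<omega>)) \<in> l2_fun M"
  using integrable_distr_eq[OF measurable_Y, of "\<lambda>x. (f x)\<^sup>2" i] measurable_compose[OF measurable_Y, of f borel]
  by (auto simp: l2_fun_def distr_Y)

text \<open>At \<open>n = 0\<close> the sum is empty and the quotient is 0, so no index has to be
  excluded later.\<close>

definition normalized_sum :: "('x \<Rightarrow> real) \<Rightarrow> nat \<Rightarrow> 'a \<Rightarrow> real" where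
  "normalized_sum f n \<omega> = (\<Sum>j<n. f (Y j \<omega>)) / sqrt (real n)"

lemma normalized_sum_l2: "f \<in> l2_fun S \<Longrightarrow> normalized_sum f n \<in> l2_fun M"
  using l2_fun_cmult[OF l2_fun_sum[of "{..<n}" "\<lambda>j \<omega>. f (Y j \<omega>)"], of M "inverse (sqrt (real n))"] l2_fun_Y
  by (simp add: normalized_sum_def[abs_def] field_simps)

lemma l2_integrable: "f \<in> l2_fun S \<Longrightarrow> integrable S f"
  using finite_measure.square_integrable_imp_integrable[of S f] prob_space_S
  by (auto simp: l2_fun_def prob_space_def)

text \<open>Independence and centring remove the off-diagonal terms, and the \<open>n\<close> equal
  diagonal ones cancel the normalization.\<close>

lemma normalized_sum_second_moment:
  assumes f: "f \<in> l2_fun S" and f0: "(\<integral>x. f x \<partial>S) = 0"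
  shows "(\<integral>\<omega>. (normalized_sum f n \<omega>)\<^sup>2 \<partial>M) = (if n = 0 then 0 else (\<integral>x. (f x)\<^sup>2 \<partial>S))"
proof -
  note [measurable] = l2_funD(1)[OF f]
  have l2: "(\<lambda>\<omega>. f (Y i \<omega>)) \<in> l2_fun M" for i by (rule l2_fun_Y[OF f])
  have int: "integrable M (\<lambda>\<omega>. f (Y i \<omega>))" for i
    using square_integrable_imp_integrable l2_funD[OF l2] by blast
  have cross: "(\<integral>\<omega>. f (Y i \<omega>) * f (Y j \<omega>) \<partial>M) = (if i = j then (\<integral>x. (f x)\<^sup>2 \<partial>S) else 0)" for i j
  proof (cases "i = j")
    case True
    then show ?thesis using integral_Y[of "\<lambda>x. (f x)\<^sup>2" j] by (simp add: power2_eq_square)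
  next
    case False
    have "indep_vars (\<lambda>_. borel) (\<lambda>i \<omega>. f (Y i \<omega>)) UNIV"
      by (rule indep_vars_compose2[OF indep]) simp
    then have "indep_vars (\<lambda>_. borel) (\<lambda>i \<omega>. f (Y i \<omega>)) {i, j}" by (rule indep_vars_subset) simp
    from indep_vars_lebesgue_integral[OF _ this] int False
    have "(\<integral>\<omega>. f (Y i \<omega>) * f (Y j \<omega>) \<partial>M) = (\<integral>\<omega>. f (Y i \<omega>) \<partial>M) * (\<integral>\<omega>. f (Y j \<omega>) \<partial>M)" by simp
    then show ?thesis using False f0 by (simp add: integral_Y)
  qed
  have "(\<integral>\<omega>. (normalized_sum f n \<omega>)\<^sup>2 \<partial>M) = (\<integral>\<omega>. (\<Sum>i<n. \<Sum>j<n. f (Y i \<omega>) * f (Y j \<omega>)) / real n \<partial>M)"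
    by (simp add: normalized_sum_def power_divide power2_eq_square[of "sum _ _"] sum_product)
  also have "\<dots> = (\<Sum>i<n. \<Sum>j<n. (\<integral>\<omega>. f (Y i \<omega>) * f (Y j \<omega>) \<partial>M)) / real n"
    using l2_fun_mult[OF l2 l2] by simp
  finally show ?thesis by (simp add: cross)
qed

text \<open>The one-dimensional central limit theorem applies if the variance is positive; if it is
  0, the normalized sums vanish almost surely and the limit is 1.\<close>

lemma normalized_sum_char_tendsto:
  assumes f: "f \<in> l2_fun S" and f0: "(\<integral>x. f x \<partial>S) = 0"
  shows "(\<lambda>n. char (distr M borel (normalized_sum f n)) 1)
    \<longlonglongrightarrow> complex_of_real (exp (- (\<integral>x. (f x)\<^sup>2 \<partial>S) / 2))"
proof -
  note [measurable] = l2_funD(1)[OF f] l2_funD(1)[OF normalized_sum_l2[OF f]]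
  define v where "v = (\<integral>x. (f x)\<^sup>2 \<partial>S)"
  have v: "0 \<le> v" by (simp add: v_def)
  have char: "char (distr M borel (normalized_sum f n)) 1 = (\<integral>\<omega>. iexp (normalized_sum f n \<omega>) \<partial>M)" for n
    unfolding char_def by (subst integral_distr) auto
  show ?thesis
  proof (cases "v = 0")
    case True
    have ae: "AE \<omega> in M. normalized_sum f n \<omega> = 0" for n
    proof -
      have "(\<integral>\<omega>. (normalized_sum f n \<omega>)\<^sup>2 \<partial>M) = 0"
        using normalized_sum_second_moment[OF f f0] True by (simp add: v_def)
      then show ?thesis
        using l2_funD(2)[OF normalized_sum_l2[OF f]] by (subst (asm) integral_nonneg_eq_0_iff_AE) auto
    qed
    have "AE \<omega> in M. iexp (normalized_sum f n \<omega>) = 1" for n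
      using ae[of n] by eventually_elim simp
    then have "(\<integral>\<omega>. iexp (normalized_sum f n \<omega>) \<partial>M) = (\<integral>\<omega>. 1 \<partial>M)" for n
      by (intro integral_cong_AE) auto
    then show ?thesis using True by (simp add: char v_def prob_space)
  next
    case False
    then have v0: "0 < v" using v by simp
    define X where "X i \<omega> = f (Y i \<omega>)" for i \<omega>
    have E0: "expectation (X i) = 0" for i unfolding X_def by (subst integral_Y) (auto simp: f0)
    have "weak_conv_m (\<lambda>n. distr M borel (\<lambda>\<omega>. (\<Sum>i<n. X i \<omega>) / sqrt (real n * (sqrt v)\<^sup>2))) std_normal_distribution"
    proof (rule central_limit_theorem_zero_mean)
      show "indep_vars (\<lambda>_. borel) X UNIV"
        unfolding X_def[abs_def] by (rule indep_vars_compose2[OF indep]) simp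
      show "0 < sqrt v" using v0 by simp
      show "integrable M (\<lambda>\<omega>. (X i \<omega>)\<^sup>2)" for i unfolding X_def by (rule l2_funD(2)[OF l2_fun_Y[OF f]])
      show "variance (X i) = (sqrt v)\<^sup>2" for i
        using integral_Y[of "\<lambda>x. (f x)\<^sup>2" i] v by (simp add: E0 X_def v_def)
      show "distr M borel (X i) = distr S borel f" for i
        using distr_distr[of f S borel "Y i" M] by (simp add: X_def[abs_def] comp_def distr_Y)
    qed (rule E0)
    from levy_continuity1[OF _ real_dist_normal_dist this]
    have lim: "(\<lambda>n. char (distr M borel (\<lambda>\<omega>. (\<Sum>i<n. X i \<omega>) / sqrt (real n * (sqrt v)\<^sup>2))) (sqrt v))
      \<longlonglongrightarrow> char std_normal_distribution (sqrt v)"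
      unfolding X_def by (auto intro!: real_distribution_distr)
    \<comment> \<open>The central limit theorem divides by the standard deviation as well, so its
      characteristic function at \<open>sqrt v\<close> is the present one at 1.\<close>
    have "char (distr M borel (\<lambda>\<omega>. (\<Sum>i<n. X i \<omega>) / sqrt (real n * (sqrt v)\<^sup>2))) (sqrt v)
        = char (distr M borel (normalized_sum f n)) 1" for n
    proof -
      have "sqrt v * ((\<Sum>i<n. X i \<omega>) / sqrt (real n * (sqrt v)\<^sup>2)) = normalized_sum f n \<omega>" for \<omega>
        using v0 by (simp add: normalized_sum_def X_def real_sqrt_mult)
      then show ?thesis unfolding char
        unfolding char_def by (subst integral_distr) (auto simp: X_def simp flip: of_real_mult)
    qed
    then show ?thesis using lim v0 by (simp add: char_std_normal_distribution v_def[symmetric])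
  qed
qed

end

section \<open>The central limit theorem in \<open>L2\<close>\<close>

text \<open>The double sum sees the \<open>u i\<close> only through their Gram matrix. This carries
  norm estimates over between families on different probability spaces with equal Gram
  matrices.\<close>

lemma finite_rank_second_moment:
  fixes u :: "nat \<Rightarrow> 'a \<Rightarrow> real" and e :: "nat \<Rightarrow> 'b \<Rightarrow> real"
  assumes u: "\<And>i. u i \<in> l2_fun P" and e: "\<And>i. i < m \<Longrightarrow> e i \<in> l2_fun L"
  shows "integrable P (\<lambda>x. \<integral>y. (\<Sum>i<m. u i x * e i y)\<^sup>2 \<partial>L)"
    and "(\<integral>x. (\<integral>y. (\<Sum>i<m. u i x * e i y)\<^sup>2 \<partial>L) \<partial>P)
      = (\<Sum>i<m. \<Sum>j<m. (\<integral>x. u i x * u j x \<partial>P) * (\<integral>y. e i y * e j y \<partial>L))"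
proof -
  have inner: "(\<integral>y. (\<Sum>i<m. u i x * e i y)\<^sup>2 \<partial>L) = (\<Sum>i<m. \<Sum>j<m. (u i x * u j x) * (\<integral>y. e i y * e j y \<partial>L))" for x
  proof -
    have "(\<integral>y. (\<Sum>i<m. u i x * e i y)\<^sup>2 \<partial>L) = (\<integral>y. (\<Sum>i<m. \<Sum>j<m. (u i x * u j x) * (e i y * e j y)) \<partial>L)"
      by (simp add: power2_eq_square sum_product mult_ac)
    also have "\<dots> = (\<Sum>i<m. \<integral>y. (\<Sum>j<m. (u i x * u j x) * (e i y * e j y)) \<partial>L)"
      by (rule Bochner_Integration.integral_sum)
        (intro Bochner_Integration.integrable_sum integrable_mult_right l2_fun_mult e, auto)
    also have "\<dots> = (\<Sum>i<m. \<Sum>j<m. \<integral>y. (u i x * u j x) * (e i y * e j y) \<partial>L)"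
      by (intro sum.cong refl Bochner_Integration.integral_sum integrable_mult_right l2_fun_mult e) auto
    also have "\<dots> = (\<Sum>i<m. \<Sum>j<m. (u i x * u j x) * (\<integral>y. e i y * e j y \<partial>L))"
      by simp
    finally show ?thesis .
  qed
  show "integrable P (\<lambda>x. \<integral>y. (\<Sum>i<m. u i x * e i y)\<^sup>2 \<partial>L)"
    unfolding inner using l2_fun_mult[OF u u] by simp
  show "(\<integral>x. (\<integral>y. (\<Sum>i<m. u i x * e i y)\<^sup>2 \<partial>L) \<partial>P)
      = (\<Sum>i<m. \<Sum>j<m. (\<integral>x. u i x * u j x \<partial>P) * (\<integral>y. e i y * e j y \<partial>L))"
    unfolding inner using l2_fun_mult[OF u u] by simp
qed

lemma l2_inner_lipschitz:
  assumes F: "F \<in> L2 L"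
  shows "Metric_space.lipschitz (L2 L) (l2_dist L) (l2_norm L (l2_rep F)) (\<lambda>G. l2_inner L G F)"
  unfolding Metric_space.lipschitz_def[OF Metric_space_L2]
proof (intro ballI)
  fix G H assume G: "G \<in> L2 L" and H: "H \<in> L2 L"
  note r = l2_rep(1)[OF F] l2_rep(1)[OF G] l2_rep(1)[OF H]
  have "l2_inner L G F - l2_inner L H F = (\<integral>x. (l2_rep G x - l2_rep H x) * l2_rep F x \<partial>L)"
    unfolding l2_inner_def using l2_fun_mult[OF r(2,1)] l2_fun_mult[OF r(3,1)] by (simp add: left_diff_distrib)
  also have "\<bar>\<dots>\<bar> \<le> l2_norm L (\<lambda>x. l2_rep G x - l2_rep H x) * l2_norm L (l2_rep F)"
    by (intro l2_Cauchy_Schwarz l2_fun_diff r)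
  finally show "\<bar>l2_inner L G F - l2_inner L H F\<bar> \<le> l2_norm L (l2_rep F) * l2_dist L G H"
    by (simp add: l2_dist_def l2_norm_def mult.commute)
qed

lemma l2_inner_measurable:
  assumes "random_element (l2_topology L) N W" "F \<in> L2 L"
  shows "(\<lambda>\<omega>. l2_inner L (W \<omega>) F) \<in> borel_measurable N"
  using random_element_continuous_map[OF assms(1)] l2_inner_lipschitz[OF assms(2)]
    Metric_space.lipschitz_continuous_map[OF Metric_space_L2]
  unfolding l2_topology_def by blast

text \<open>The increments of the finite-rank sums with coefficients \<open>G i\<close> have the
  same mean squared norm as those with coefficients \<open>v i\<close>, and the latter are
  controlled by \<open>approx\<close> through \<open>h\<close>. Completeness then yields a limit
  \<open>W\<close>, and every inner product with \<open>W\<close> is a limit of Gaussian variables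
  whose variances converge.\<close>

lemma gaussian_element_exists:
  fixes h :: "'x \<Rightarrow> 'b \<Rightarrow> real" and v :: "nat \<Rightarrow> 'x \<Rightarrow> real" and c :: "nat \<Rightarrow> nat \<Rightarrow> 'b \<Rightarrow> real" and r :: "nat \<Rightarrow> nat"
  assumes S: "prob_space S" and L: "sigma_finite_measure L"
    and h[measurable]: "(\<lambda>(x, y). h x y) \<in> borel_measurable (S \<Otimes>\<^sub>M L)"
    and hL: "\<And>x. x \<in> space S \<Longrightarrow> h x \<in> l2_fun L"
    and v: "\<And>i. v i \<in> l2_fun S" and c: "\<And>k i. c k i \<in> l2_fun L"
    and approx: "\<And>k. (\<integral>\<^sup>+x. ennreal (\<integral>y. (h x y - (\<Sum>i<r k. v i x * c k i y))\<^sup>2 \<partial>L) \<partial>S) \<le> ennreal ((1/4) ^ k)"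
  obtains N :: "(nat \<Rightarrow> real) measure" and G W where
    "prob_space N" "\<And>i. G i \<in> l2_fun N"
    "\<And>i j. (\<integral>\<omega>. G i \<omega> * G j \<omega> \<partial>N) = (\<integral>x. v i x * v j x \<partial>S)"
    "\<And>m t s. char (distr N borel (\<lambda>\<omega>. \<Sum>i<m. t i * G i \<omega>)) s
       = complex_of_real (exp (- (s\<^sup>2 * (\<integral>x. (\<Sum>i<m. t i * v i x)\<^sup>2 \<partial>S)) / 2))"
    "random_element (l2_topology L) N W"
    "AE \<omega> in N. (\<lambda>k. l2_dist L (l2_class L (\<lambda>y. \<Sum>i<r k. G i \<omega> * c k i y)) (W \<omega>)) \<longlonglongrightarrow> 0"
    "\<And>F s. F \<in> L2 L \<Longrightarrow> char (distr N borel (\<lambda>\<omega>. l2_inner L (W \<omega>) F)) s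
       = complex_of_real (exp (- (s\<^sup>2 * (\<integral>x. (\<integral>y. h x y * l2_rep F y \<partial>L)\<^sup>2 \<partial>S)) / 2))"
proof -
  interpret S: prob_space S by fact
  interpret L: sigma_finite_measure L by fact
  interpret H: Metric_space "L2 L" "l2_dist L" by (rule Metric_space_L2)
  obtain N :: "(nat \<Rightarrow> real) measure" and G where N: "prob_space N" and G: "\<And>i. G i \<in> l2_fun N"
    and GG: "\<And>i j. (\<integral>\<omega>. G i \<omega> * G j \<omega> \<partial>N) = (\<integral>x. v i x * v j x \<partial>S)"
    and Gchar: "\<And>m t s. char (distr N borel (\<lambda>\<omega>. \<Sum>i<m. t i * G i \<omega>)) s
       = complex_of_real (exp (- (s\<^sup>2 * (\<integral>x. (\<Sum>i<m. t i * v i x)\<^sup>2 \<partial>S)) / 2))"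
    using gaussian_family[of v S, OF v] by blast
  interpret N: prob_space N by fact
  note [measurable] = l2_funD(1)[OF v] l2_funD(1)[OF c] l2_funD(1)[OF G]
  define hk where "hk k x y = (\<Sum>i<r k. v i x * c k i y)" for k x y
  define Wk where "Wk k \<omega> y = (\<Sum>i<r k. G i \<omega> * c k i y)" for k \<omega> y
  have hkL: "hk k x \<in> l2_fun L" for k x
    unfolding hk_def[abs_def] by (intro l2_fun_sum l2_fun_cmult c)
  have WkL: "Wk k \<omega> \<in> l2_fun L" for k \<omega>
    unfolding Wk_def[abs_def] by (intro l2_fun_sum l2_fun_cmult c)
  have [measurable]: "(\<lambda>(x, y). hk k x y) \<in> borel_measurable (S \<Otimes>\<^sub>M L)" for k
    unfolding hk_def by measurable
  \<comment> \<open>Consecutive approximations differ in the number of terms and in the functions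
    \<open>c k i\<close>; padding with zeros up to \<open>m k\<close> turns their difference into
    one finite-rank sum.\<close>
  define m where "m k = max (r k) (r (Suc k))" for k
  define d where "d k i y = (if i < r (Suc k) then c (Suc k) i y else 0) - (if i < r k then c k i y else 0)" for k i y
  have dL: "d k i \<in> l2_fun L" for k i
  proof -
    have "(\<lambda>y. if i < n then c j i y else 0) \<in> l2_fun L" for n j
      by (cases "i < n") (auto simp: c l2_fun_zero)
    then show ?thesis unfolding d_def[abs_def] by (intro l2_fun_diff)
  qed
  have dsum: "(\<Sum>i<r (Suc k). u i * c (Suc k) i y) - (\<Sum>i<r k. u i * c k i y) = (\<Sum>i<m k. u i * d k i y)"
    for u :: "nat \<Rightarrow> real" and k y
  proof -
    have *: "(\<Sum>i<n. u i * c j i y) = (\<Sum>i<m k. u i * (if i < n then c j i y else 0))" if "n \<le> m k" for n j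
      using that by (intro sum.mono_neutral_cong_left) auto
    show ?thesis
      unfolding *[of "r (Suc k)" "Suc k", OF max.cobounded2[of "r (Suc k)" "r k", folded m_def]]
      unfolding *[of "r k" k, OF max.cobounded1[of "r k" "r (Suc k)", folded m_def]]
      unfolding d_def by (simp add: sum_subtractf[symmetric] right_diff_distrib)
  qed
  define \<Delta> where "\<Delta> k \<omega> = (\<integral>y. (Wk (Suc k) \<omega> y - Wk k \<omega> y)\<^sup>2 \<partial>L)" for k \<omega>
  have \<Delta>_eq: "\<Delta> k \<omega> = (\<integral>y. (\<Sum>i<m k. G i \<omega> * d k i y)\<^sup>2 \<partial>L)" for k \<omega>
    unfolding \<Delta>_def Wk_def dsum ..
  have \<Delta>_int: "integrable N (\<Delta> k)" for k
    unfolding \<Delta>_eq[abs_def] by (rule finite_rank_second_moment(1)[OF G dL])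
  have [measurable]: "\<Delta> k \<in> borel_measurable N" for k using \<Delta>_int by blast
  have \<Delta>0: "0 \<le> \<Delta> k \<omega>" for k \<omega> by (simp add: \<Delta>_def)
  \<comment> \<open>Inserting \<open>h\<close> between two consecutive approximations gives
    \<open>2 * (1/4) ^ k + 2 * (1/4) ^ Suc k\<close>, which the constant 4 absorbs.\<close>
  have \<Delta>_bound: "(\<integral>\<omega>. \<Delta> k \<omega> \<partial>N) \<le> 4 * (1/4) ^ k" for k
  proof -
    have eq: "(\<integral>\<omega>. \<Delta> k \<omega> \<partial>N) = (\<integral>x. (\<integral>y. (\<Sum>i<m k. v i x * d k i y)\<^sup>2 \<partial>L) \<partial>S)"
      unfolding \<Delta>_eq finite_rank_second_moment(2)[OF G dL] finite_rank_second_moment(2)[OF v dL] GG ..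
    have "ennreal (\<integral>x. (\<integral>y. (\<Sum>i<m k. v i x * d k i y)\<^sup>2 \<partial>L) \<partial>S)
        = (\<integral>\<^sup>+x. ennreal (\<integral>y. (\<Sum>i<m k. v i x * d k i y)\<^sup>2 \<partial>L) \<partial>S)"
      by (rule nn_integral_eq_integral[symmetric, OF finite_rank_second_moment(1)[OF v dL]]) simp
    also have "\<dots> \<le> (\<integral>\<^sup>+x. 2 * ennreal (\<integral>y. (h x y - hk k x y)\<^sup>2 \<partial>L)
        + 2 * ennreal (\<integral>y. (h x y - hk (Suc k) x y)\<^sup>2 \<partial>L) \<partial>S)"
    proof (rule nn_integral_mono)
      fix x assume x: "x \<in> space S"
      have "(\<integral>y. (\<Sum>i<m k. v i x * d k i y)\<^sup>2 \<partial>L)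
          = (\<integral>y. ((h x y - hk k x y) + (hk (Suc k) x y - h x y))\<^sup>2 \<partial>L)"
        unfolding dsum[symmetric] hk_def by simp
      also have "\<dots> \<le> 2 * (\<integral>y. (h x y - hk k x y)\<^sup>2 \<partial>L) + 2 * (\<integral>y. (hk (Suc k) x y - h x y)\<^sup>2 \<partial>L)"
        by (intro l2_norm_sq_add l2_fun_diff hL hkL x)
      also have "(\<integral>y. (hk (Suc k) x y - h x y)\<^sup>2 \<partial>L) = (\<integral>y. (h x y - hk (Suc k) x y)\<^sup>2 \<partial>L)"
        by (simp add: power2_commute)
      finally have "ennreal (\<integral>y. (\<Sum>i<m k. v i x * d k i y)\<^sup>2 \<partial>L)
          \<le> ennreal (2 * (\<integral>y. (h x y - hk k x y)\<^sup>2 \<partial>L) + 2 * (\<integral>y. (h x y - hk (Suc k) x y)\<^sup>2 \<partial>L))"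
        by (rule ennreal_leI)
      then show "ennreal (\<integral>y. (\<Sum>i<m k. v i x * d k i y)\<^sup>2 \<partial>L)
          \<le> 2 * ennreal (\<integral>y. (h x y - hk k x y)\<^sup>2 \<partial>L) + 2 * ennreal (\<integral>y. (h x y - hk (Suc k) x y)\<^sup>2 \<partial>L)"
        by (simp add: ennreal_mult)
    qed
    also have "\<dots> = 2 * (\<integral>\<^sup>+x. ennreal (\<integral>y. (h x y - hk k x y)\<^sup>2 \<partial>L) \<partial>S)
        + 2 * (\<integral>\<^sup>+x. ennreal (\<integral>y. (h x y - hk (Suc k) x y)\<^sup>2 \<partial>L) \<partial>S)"
      by (subst nn_integral_add) (auto simp: nn_integral_cmult)
    also have "\<dots> \<le> 2 * ennreal ((1/4) ^ k) + 2 * ennreal ((1/4) ^ Suc k)"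
      using approx[of k] approx[of "Suc k"] unfolding hk_def[symmetric] by (intro add_mono mult_left_mono) auto
    also have "\<dots> = ennreal (2 * (1/4) ^ k + 2 * (1/4) ^ Suc k)"
      by (simp add: numeral_mult_ennreal del: power_Suc)
    also have "\<dots> \<le> ennreal (4 * (1/4) ^ k)" by (intro ennreal_leI) simp
    finally show ?thesis unfolding eq by (simp add: ennreal_le_iff)
  qed
  \<comment> \<open>On this set \<open>l2_complete\<close> applies. It has full measure, because the
    expectations decay like \<open>(1/4) ^ k\<close> and remain summable with the factor
    \<open>2 ^ k\<close>.\<close>
  define A where "A = {\<omega> \<in> space N. (\<Sum>k. ennreal (2 ^ k * \<Delta> k \<omega>)) \<noteq> \<infinity>}"
  have [measurable]: "A \<in> sets N" unfolding A_def by measurable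
  have "(\<integral>\<^sup>+\<omega>. (\<Sum>k. ennreal (2 ^ k * \<Delta> k \<omega>)) \<partial>N) = (\<Sum>k. \<integral>\<^sup>+\<omega>. ennreal (2 ^ k * \<Delta> k \<omega>) \<partial>N)"
    by (rule nn_integral_suminf) measurable
  also have "\<dots> = (\<Sum>k. ennreal (2 ^ k * (\<integral>\<omega>. \<Delta> k \<omega> \<partial>N)))"
    using \<Delta>_int \<Delta>0 by (subst nn_integral_eq_integral) auto
  also have "\<dots> \<noteq> \<infinity>"
    unfolding infinity_ennreal_def
  proof (rule ennreal_suminf_neq_top)
    show "summable (\<lambda>k. 2 ^ k * (\<integral>\<omega>. \<Delta> k \<omega> \<partial>N))"
    proof (rule summable_comparison_test')
      show "summable (\<lambda>k. 4 * (1/2) ^ k :: real)" by (intro summable_mult summable_geometric) simp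
      fix k
      have "2 ^ k * (\<integral>\<omega>. \<Delta> k \<omega> \<partial>N) \<le> 2 ^ k * (4 * (1/4) ^ k)"
        by (intro mult_left_mono \<Delta>_bound) simp
      also have "\<dots> = 4 * (1/2) ^ k" by (simp add: power_mult_distrib[symmetric])
      finally show "norm (2 ^ k * (\<integral>\<omega>. \<Delta> k \<omega> \<partial>N)) \<le> 4 * (1/2) ^ k"
        using \<Delta>0 by (simp add: abs_mult)
    qed
  qed (use \<Delta>0 in simp)
  finally have "AE \<omega> in N. (\<Sum>k. ennreal (2 ^ k * \<Delta> k \<omega>)) \<noteq> \<infinity>"
    by (intro nn_integral_PInf_AE) auto
  then have AE_A: "AE \<omega> in N. \<omega> \<in> A"
    by (rule AE_mp) (simp add: A_def)
  have "\<exists>g. g \<in> l2_fun L \<and> (\<lambda>k. l2_norm L (\<lambda>y. Wk k \<omega> y - g y)) \<longlonglongrightarrow> 0" if "\<omega> \<in> A" for \<omega>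
  proof -
    have "summable (\<lambda>k. 2 ^ k * \<Delta> k \<omega>)"
      using that \<Delta>0 by (intro summable_suminf_not_top) (auto simp: A_def)
    then show ?thesis
      using l2_complete[of "\<lambda>k. Wk k \<omega>" L, OF WkL] unfolding \<Delta>_def by blast
  qed
  then obtain g where g: "\<And>\<omega>. \<omega> \<in> A \<Longrightarrow> g \<omega> \<in> l2_fun L"
    and glim: "\<And>\<omega>. \<omega> \<in> A \<Longrightarrow> (\<lambda>k. l2_norm L (\<lambda>y. Wk k \<omega> y - g \<omega> y)) \<longlonglongrightarrow> 0"
    by metis
  define W where "W \<omega> = (if \<omega> \<in> A then l2_class L (g \<omega>) else l2_class L (\<lambda>y. 0))" for \<omega>
  \<comment> \<open>The indicator of \<open>A\<close> makes the approximations converge at every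
    point, as \<open>random_element_limit\<close> demands, and keeps them of finite rank with
    measurable coefficients.\<close>
  define X where "X k \<omega> = l2_class L (\<lambda>y. \<Sum>i<r k. (indicator A \<omega> * G i \<omega>) * c k i y)" for k \<omega>
  have W_A: "W \<omega> = l2_class L (g \<omega>)" if "\<omega> \<in> A" for \<omega> using that by (simp add: W_def)
  have X_A: "X k \<omega> = l2_class L (Wk k \<omega>)" if "\<omega> \<in> A" for \<omega> k
    using that by (simp add: X_def Wk_def[abs_def])
  have W: "random_element (l2_topology L) N W"
    unfolding l2_topology_def
  proof (rule H.random_element_limit)
    show "random_element H.mtopology N (X k)" for k
      unfolding X_def l2_topology_def[symmetric] by (rule random_element_finite_rank(1)) (auto simp: c)
    show "W \<omega> \<in> L2 L" for \<omega>
      unfolding W_def using g by (auto intro: l2_class_in_L2 l2_fun_zero)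
    show "(\<lambda>k. l2_dist L (X k \<omega>) (W \<omega>)) \<longlonglongrightarrow> 0" for \<omega>
    proof (cases "\<omega> \<in> A")
      case True
      then show ?thesis using glim[OF True] by (simp add: X_A W_A l2_dist_norm[OF WkL g])
    next
      case False
      then show ?thesis by (simp add: X_def W_def l2_dist_norm[OF l2_fun_zero l2_fun_zero])
    qed
  qed
  have AE_lim: "AE \<omega> in N. (\<lambda>k. l2_dist L (l2_class L (\<lambda>y. \<Sum>i<r k. G i \<omega> * c k i y)) (W \<omega>)) \<longlonglongrightarrow> 0"
    using AE_A
  proof eventually_elim
    case (elim \<omega>)
    have "(\<lambda>k. l2_dist L (l2_class L (Wk k \<omega>)) (W \<omega>)) \<longlonglongrightarrow> 0"
      using glim[OF elim] by (simp add: W_A[OF elim] l2_dist_norm[OF WkL g[OF elim]])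
    then show ?case by (simp add: Wk_def[abs_def])
  qed
  have Wchar: "char (distr N borel (\<lambda>\<omega>. l2_inner L (W \<omega>) F)) s
       = complex_of_real (exp (- (s\<^sup>2 * (\<integral>x. (\<integral>y. h x y * l2_rep F y \<partial>L)\<^sup>2 \<partial>S)) / 2))"
    if F: "F \<in> L2 L" for F s
  proof -
    define f where "f = l2_rep F"
    have f: "f \<in> l2_fun L" unfolding f_def by (rule l2_rep(1)[OF F])
    note [measurable] = l2_funD(1)[OF f]
    define t where "t k i = (\<integral>y. c k i y * f y \<partial>L)" for k i
    have pull: "(\<integral>y. (\<Sum>i<m. u i * c k i y) * f y \<partial>L) = (\<Sum>i<m. t k i * u i)" for u :: "nat \<Rightarrow> real" and m k
    proof -
      have "(\<integral>y. (\<Sum>i<m. u i * c k i y) * f y \<partial>L) = (\<integral>y. (\<Sum>i<m. u i * (c k i y * f y)) \<partial>L)"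
        by (simp add: sum_distrib_right mult.assoc)
      also have "\<dots> = (\<Sum>i<m. u i * t k i)"
        using l2_fun_mult[OF c f] by (simp add: t_def)
      finally show ?thesis by (simp add: mult.commute)
    qed
    have Wkf: "(\<integral>y. Wk k \<omega> y * f y \<partial>L) = (\<Sum>i<r k. t k i * G i \<omega>)" for k \<omega>
      unfolding Wk_def by (rule pull)
    have hkf: "(\<integral>y. hk k x y * f y \<partial>L) = (\<Sum>i<r k. t k i * v i x)" for k x
      unfolding hk_def by (rule pull)
    define p where "p x = (\<integral>y. h x y * f y \<partial>L)" for x
    define q where "q k x = (\<Sum>i<r k. t k i * v i x)" for k x
    have qS: "q k \<in> l2_fun S" for k unfolding q_def[abs_def] by (intro l2_fun_sum l2_fun_cmult v)
    have [measurable]: "p \<in> borel_measurable S" "q k \<in> borel_measurable S" for k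
      unfolding p_def q_def by measurable
    \<comment> \<open>Cauchy-Schwarz in \<open>y\<close> for each \<open>x\<close>: the
      approximation of \<open>h\<close> becomes convergence in mean square of the \<open>q k\<close>
      to \<open>p\<close>, hence convergence of the variances.\<close>
    have qp: "(\<integral>\<^sup>+x. ennreal ((q k x - p x)\<^sup>2) \<partial>S) \<le> ennreal ((1/4) ^ k * (l2_norm L f)\<^sup>2)" for k
    proof -
      have "(\<integral>\<^sup>+x. ennreal ((q k x - p x)\<^sup>2) \<partial>S)
          \<le> (\<integral>\<^sup>+x. ennreal (\<integral>y. (h x y - hk k x y)\<^sup>2 \<partial>L) * ennreal ((l2_norm L f)\<^sup>2) \<partial>S)"
      proof (rule nn_integral_mono)
        fix x assume x: "x \<in> space S"
        have "p x - q k x = (\<integral>y. (h x y - hk k x y) * f y \<partial>L)"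
          unfolding p_def q_def hkf[symmetric]
          using l2_fun_mult[OF hL[OF x] f] l2_fun_mult[OF hkL f] by (simp add: left_diff_distrib)
        then have "\<bar>q k x - p x\<bar> \<le> l2_norm L (\<lambda>y. h x y - hk k x y) * l2_norm L f"
          using l2_Cauchy_Schwarz[OF l2_fun_diff[OF hL[OF x] hkL] f] by (simp add: abs_minus_commute)
        then have "\<bar>q k x - p x\<bar>\<^sup>2 \<le> (l2_norm L (\<lambda>y. h x y - hk k x y) * l2_norm L f)\<^sup>2"
          by (intro power_mono) auto
        then have "(q k x - p x)\<^sup>2 \<le> (\<integral>y. (h x y - hk k x y)\<^sup>2 \<partial>L) * (l2_norm L f)\<^sup>2"
          by (simp add: power_mult_distrib l2_norm_sq)
        then have "ennreal ((q k x - p x)\<^sup>2) \<le> ennreal ((\<integral>y. (h x y - hk k x y)\<^sup>2 \<partial>L) * (l2_norm L f)\<^sup>2)"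
          by (rule ennreal_leI)
        then show "ennreal ((q k x - p x)\<^sup>2)
            \<le> ennreal (\<integral>y. (h x y - hk k x y)\<^sup>2 \<partial>L) * ennreal ((l2_norm L f)\<^sup>2)"
          by (simp add: ennreal_mult)
      qed
      also have "\<dots> = (\<integral>\<^sup>+x. ennreal (\<integral>y. (h x y - hk k x y)\<^sup>2 \<partial>L) \<partial>S) * ennreal ((l2_norm L f)\<^sup>2)"
        by (rule nn_integral_multc) measurable
      also have "\<dots> \<le> ennreal ((1/4) ^ k) * ennreal ((l2_norm L f)\<^sup>2)"
        using approx[of k] unfolding hk_def[symmetric] by (intro mult_right_mono) auto
      also have "\<dots> = ennreal ((1/4) ^ k * (l2_norm L f)\<^sup>2)" by (simp add: ennreal_mult)
      finally show ?thesis .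
    qed
    have qpS: "(\<lambda>x. q k x - p x) \<in> l2_fun S" for k
    proof -
      have "integrable S (\<lambda>x. (q k x - p x)\<^sup>2)"
        by (rule integrableI_bounded) (use qp[of k] in \<open>auto intro: le_less_trans[OF _ ennreal_less_top]\<close>)
      then show ?thesis by (simp add: l2_fun_def)
    qed
    have pS: "p \<in> l2_fun S" using l2_fun_diff[OF qS[of 0] qpS[of 0]] by simp
    have "(\<lambda>k. l2_norm S (\<lambda>x. q k x - p x)) \<longlonglongrightarrow> 0"
    proof (rule tendsto_sandwich[OF _ _ tendsto_const])
      show "(\<lambda>k. (1/2) ^ k * l2_norm L f) \<longlonglongrightarrow> 0"
        by (intro tendsto_mult_left_zero LIMSEQ_power_zero) simp
      show "\<forall>\<^sub>F k in sequentially. l2_norm S (\<lambda>x. q k x - p x) \<le> (1/2) ^ k * l2_norm L f"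
      proof (intro always_eventually allI)
        fix k
        have "ennreal (\<integral>x. (q k x - p x)\<^sup>2 \<partial>S) \<le> ennreal ((1/4) ^ k * (l2_norm L f)\<^sup>2)"
          using qp[of k] l2_funD(2)[OF qpS[of k]] by (subst (asm) nn_integral_eq_integral) auto
        then have "(l2_norm S (\<lambda>x. q k x - p x))\<^sup>2 \<le> (1/4) ^ k * (l2_norm L f)\<^sup>2"
          by (simp add: l2_norm_sq ennreal_le_iff)
        also have "\<dots> = ((1/2) ^ k * l2_norm L f)\<^sup>2"
          by (simp add: power_mult_distrib power2_eq_square flip: power_mult_distrib)
        finally show "l2_norm S (\<lambda>x. q k x - p x) \<le> (1/2) ^ k * l2_norm L f"
          by (rule power2_le_imp_le) simp
      qed
    qed auto
    then have "(\<lambda>k. l2_norm S (q k) - l2_norm S p) \<longlonglongrightarrow> 0"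
      by (rule Lim_null_comparison[rotated])
        (use l2_norm_diff_bound[OF qS pS] in \<open>auto intro!: always_eventually\<close>)
    then have "(\<lambda>k. l2_norm S (q k)) \<longlonglongrightarrow> l2_norm S p" by (rule LIM_zero_cancel)
    from tendsto_power[OF this, of 2]
    have var: "(\<lambda>k. \<integral>x. (q k x)\<^sup>2 \<partial>S) \<longlonglongrightarrow> (\<integral>x. (p x)\<^sup>2 \<partial>S)" by (simp add: l2_norm_sq)
    have [measurable]: "(\<lambda>\<omega>. l2_inner L (W \<omega>) F) \<in> borel_measurable N"
      by (rule l2_inner_measurable[OF W F])
    have inner_lim: "AE \<omega> in N. (\<lambda>k. \<Sum>i<r k. t k i * G i \<omega>) \<longlonglongrightarrow> l2_inner L (W \<omega>) F"
      using AE_A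
    proof eventually_elim
      fix \<omega> assume \<omega>: "\<omega> \<in> A"
      have 1: "l2_inner L (W \<omega>) F = (\<integral>y. g \<omega> y * f y \<partial>L)"
        unfolding W_A[OF \<omega>] f_def by (rule l2_inner_rep[OF g[OF \<omega>] F])
      have "(\<lambda>k. (\<Sum>i<r k. t k i * G i \<omega>) - l2_inner L (W \<omega>) F) \<longlonglongrightarrow> 0"
      proof (rule Lim_null_comparison)
        show "(\<lambda>k. l2_norm L (\<lambda>y. Wk k \<omega> y - g \<omega> y) * l2_norm L f) \<longlonglongrightarrow> 0"
          by (rule tendsto_mult_left_zero[OF glim[OF \<omega>]])
        show "\<forall>\<^sub>F k in sequentially. norm ((\<Sum>i<r k. t k i * G i \<omega>) - l2_inner L (W \<omega>) F)
            \<le> l2_norm L (\<lambda>y. Wk k \<omega> y - g \<omega> y) * l2_norm L f"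
        proof (intro always_eventually allI)
          fix k
          have "(\<Sum>i<r k. t k i * G i \<omega>) - l2_inner L (W \<omega>) F = (\<integral>y. (Wk k \<omega> y - g \<omega> y) * f y \<partial>L)"
            unfolding 1 Wkf[symmetric]
            using l2_fun_mult[OF WkL f] l2_fun_mult[OF g[OF \<omega>] f] by (simp add: left_diff_distrib)
          then show "norm ((\<Sum>i<r k. t k i * G i \<omega>) - l2_inner L (W \<omega>) F)
            \<le> l2_norm L (\<lambda>y. Wk k \<omega> y - g \<omega> y) * l2_norm L f"
            using l2_Cauchy_Schwarz[OF l2_fun_diff[OF WkL g[OF \<omega>]] f] by simp
        qed
      qed
      then show "(\<lambda>k. \<Sum>i<r k. t k i * G i \<omega>) \<longlonglongrightarrow> l2_inner L (W \<omega>) F" by (rule LIM_zero_cancel)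
    qed
    have "(\<lambda>k. char (distr N borel (\<lambda>\<omega>. \<Sum>i<r k. t k i * G i \<omega>)) s)
        \<longlonglongrightarrow> char (distr N borel (\<lambda>\<omega>. l2_inner L (W \<omega>) F)) s"
    proof -
      have "(\<lambda>k. \<integral>\<omega>. iexp (s * (\<Sum>i<r k. t k i * G i \<omega>)) \<partial>N)
          \<longlonglongrightarrow> (\<integral>\<omega>. iexp (s * l2_inner L (W \<omega>) F) \<partial>N)"
      proof (rule integral_dominated_convergence[where w="\<lambda>_. 1"])
        show "AE \<omega> in N. (\<lambda>k. iexp (s * (\<Sum>i<r k. t k i * G i \<omega>))) \<longlonglongrightarrow> iexp (s * l2_inner L (W \<omega>) F)"
          using inner_lim by eventually_elim (intro tendsto_intros)
      qed (auto simp del: of_real_sum of_real_mult)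
      then show ?thesis unfolding char_def by (subst (1 2) integral_distr) auto
    qed
    \<comment> \<open>The same characteristic functions computed from the variances; uniqueness of
      limits then gives the one of the inner product with \<open>W\<close>.\<close>
    moreover have "(\<lambda>k. char (distr N borel (\<lambda>\<omega>. \<Sum>i<r k. t k i * G i \<omega>)) s)
        \<longlonglongrightarrow> complex_of_real (exp (- (s\<^sup>2 * (\<integral>x. (p x)\<^sup>2 \<partial>S)) / 2))"
      unfolding Gchar using var unfolding q_def by (intro tendsto_intros) auto
    ultimately show ?thesis unfolding p_def f_def by (rule LIMSEQ_unique)
  qed
  show ?thesis by (rule that[OF N G GG Gchar W AE_lim Wchar])
qed

context iid_sequence
begin

lemma normalized_sum_cmult: "normalized_sum (\<lambda>x. a * f x) n \<omega> = a * normalized_sum f n \<omega>"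
  by (simp add: normalized_sum_def sum_distrib_left)

lemma normalized_sum_diff:
  "normalized_sum (\<lambda>x. f x - g x) n \<omega> = normalized_sum f n \<omega> - normalized_sum g n \<omega>"
  by (simp add: normalized_sum_def sum_subtractf diff_divide_distrib)

lemma normalized_sum_sum:
  "normalized_sum (\<lambda>x. \<Sum>i\<in>I. f i x) n \<omega> = (\<Sum>i\<in>I. normalized_sum (f i) n \<omega>)"
  unfolding normalized_sum_def by (subst sum.swap) (simp add: sum_divide_distrib)

lemma normalized_sum_l2_fun:
  assumes "\<And>x. x \<in> space S \<Longrightarrow> d x \<in> l2_fun L" "\<omega> \<in> space M"
  shows "(\<lambda>y. normalized_sum (\<lambda>x. d x y) n \<omega>) \<in> l2_fun L"
proof -
  have "(\<lambda>y. inverse (sqrt (real n)) * (\<Sum>j<n. d (Y j \<omega>) y)) \<in> l2_fun L"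
    using assms measurable_space[OF measurable_Y] by (intro l2_fun_cmult l2_fun_sum) auto
  then show ?thesis by (simp add: normalized_sum_def field_simps)
qed

lemma normalized_sum_pair_measurable:
  assumes d: "(\<lambda>(x, y). d x y) \<in> borel_measurable (S \<Otimes>\<^sub>M L)"
  shows "(\<lambda>(\<omega>, y). normalized_sum (\<lambda>x. d x y) n \<omega>) \<in> borel_measurable (M \<Otimes>\<^sub>M L)"
proof -
  have "(\<lambda>z. (Y j (fst z), snd z)) \<in> measurable (M \<Otimes>\<^sub>M L) (S \<Otimes>\<^sub>M L)" for j by measurable
  from measurable_compose[OF this d]
  have "(\<lambda>z. d (Y j (fst z)) (snd z)) \<in> borel_measurable (M \<Otimes>\<^sub>M L)" for j by simp
  then show ?thesis
    unfolding normalized_sum_def split_beta' by (intro borel_measurable_divide borel_measurable_sum) auto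
qed

lemma normalized_sum_norm_measurable:
  assumes L: "sigma_finite_measure L" and d: "(\<lambda>(x, y). d x y) \<in> borel_measurable (S \<Otimes>\<^sub>M L)"
  shows "(\<lambda>\<omega>. l2_norm L (\<lambda>y. normalized_sum (\<lambda>x. d x y) n \<omega>)) \<in> borel_measurable M"
proof -
  interpret L: sigma_finite_measure L by fact
  note [measurable] = normalized_sum_pair_measurable[OF d]
  show ?thesis unfolding l2_norm_def by measurable
qed

text \<open>Tonelli's theorem reduces the claim to second moments at a fixed \<open>y\<close>, where
  the two sides agree for positive \<open>n\<close> and the left one is 0 for
  \<open>n = 0\<close>.\<close>

lemma normalized_sum_process_moment:
  assumes L: "sigma_finite_measure L"
    and d[measurable]: "(\<lambda>(x, y). d x y) \<in> borel_measurable (S \<Otimes>\<^sub>M L)"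
    and dL: "\<And>x. x \<in> space S \<Longrightarrow> d x \<in> l2_fun L"
    and dS: "\<And>y. y \<in> space L \<Longrightarrow> (\<lambda>x. d x y) \<in> l2_fun S"
    and d0: "\<And>y. y \<in> space L \<Longrightarrow> (\<integral>x. d x y \<partial>S) = 0"
  shows "(\<integral>\<^sup>+\<omega>. ennreal ((l2_norm L (\<lambda>y. normalized_sum (\<lambda>x. d x y) n \<omega>))\<^sup>2) \<partial>M)
      \<le> (\<integral>\<^sup>+x. ennreal (\<integral>y. (d x y)\<^sup>2 \<partial>L) \<partial>S)"
proof -
  interpret L: sigma_finite_measure L by fact
  interpret S: prob_space S by (rule prob_space_S)
  interpret PM: pair_sigma_finite M L ..
  interpret PS: pair_sigma_finite S L ..
  note [measurable] = normalized_sum_pair_measurable[OF d]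
  have "(\<integral>\<^sup>+\<omega>. ennreal ((l2_norm L (\<lambda>y. normalized_sum (\<lambda>x. d x y) n \<omega>))\<^sup>2) \<partial>M)
      = (\<integral>\<^sup>+\<omega>. \<integral>\<^sup>+y. ennreal ((normalized_sum (\<lambda>x. d x y) n \<omega>)\<^sup>2) \<partial>L \<partial>M)"
    unfolding l2_norm_sq
    by (intro nn_integral_cong nn_integral_eq_integral[symmetric] l2_funD(2) normalized_sum_l2_fun dL) auto
  also have "\<dots> = (\<integral>\<^sup>+y. \<integral>\<^sup>+\<omega>. ennreal ((normalized_sum (\<lambda>x. d x y) n \<omega>)\<^sup>2) \<partial>M \<partial>L)"
    by (rule PM.Fubini'[symmetric]) measurable
  also have "\<dots> \<le> (\<integral>\<^sup>+y. \<integral>\<^sup>+x. ennreal ((d x y)\<^sup>2) \<partial>S \<partial>L)"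
  proof (rule nn_integral_mono)
    fix y assume y: "y \<in> space L"
    have "(\<integral>\<^sup>+\<omega>. ennreal ((normalized_sum (\<lambda>x. d x y) n \<omega>)\<^sup>2) \<partial>M)
        = ennreal (\<integral>\<omega>. (normalized_sum (\<lambda>x. d x y) n \<omega>)\<^sup>2 \<partial>M)"
      by (intro nn_integral_eq_integral l2_funD(2) normalized_sum_l2 dS y) auto
    also have "\<dots> \<le> ennreal (\<integral>x. (d x y)\<^sup>2 \<partial>S)"
      by (intro ennreal_leI) (simp add: normalized_sum_second_moment dS d0 y)
    also have "\<dots> = (\<integral>\<^sup>+x. ennreal ((d x y)\<^sup>2) \<partial>S)"
      by (intro nn_integral_eq_integral[symmetric] l2_funD(2) dS y) auto
    finally show "(\<integral>\<^sup>+\<omega>. ennreal ((normalized_sum (\<lambda>x. d x y) n \<omega>)\<^sup>2) \<partial>M)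
        \<le> (\<integral>\<^sup>+x. ennreal ((d x y)\<^sup>2) \<partial>S)" .
  qed
  also have "\<dots> = (\<integral>\<^sup>+x. \<integral>\<^sup>+y. ennreal ((d x y)\<^sup>2) \<partial>L \<partial>S)"
    by (rule PS.Fubini') measurable
  also have "\<dots> = (\<integral>\<^sup>+x. ennreal (\<integral>y. (d x y)\<^sup>2 \<partial>L) \<partial>S)"
    by (intro nn_integral_cong nn_integral_eq_integral l2_funD(2) dL) auto
  finally show ?thesis .
qed

text \<open>For a Lipschitz test function the expectations are compared in four steps:
  \<open>X n\<close> with the normalized sum of \<open>h\<close>, at cost \<open>\<beta> n\<close>;
  this with its finite-rank version, at cost \<open>2 * (1/2) ^ k\<close> for all \<open>n\<close>;
  the latter with its Gaussian counterpart, by \<open>cramer_wold\<close> for fixed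
  \<open>k\<close>; and that one with \<open>W\<close>. The costs are multiplied by the Lipschitz
  constant. Working with the majorant \<open>\<beta>\<close> spares a measurability proof for the
  distance that it bounds.\<close>

theorem l2_central_limit:
  fixes h :: "'x \<Rightarrow> 'b \<Rightarrow> real" and v :: "nat \<Rightarrow> 'x \<Rightarrow> real" and c :: "nat \<Rightarrow> nat \<Rightarrow> 'b \<Rightarrow> real"
    and r :: "nat \<Rightarrow> nat" and \<beta> :: "nat \<Rightarrow> 'a \<Rightarrow> ennreal"
  assumes L: "sigma_finite_measure L"
    and h[measurable]: "(\<lambda>(x, y). h x y) \<in> borel_measurable (S \<Otimes>\<^sub>M L)"
    and hL: "\<And>x. x \<in> space S \<Longrightarrow> h x \<in> l2_fun L"
    and hS: "\<And>y. y \<in> space L \<Longrightarrow> (\<lambda>x. h x y) \<in> l2_fun S"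
    and h0: "\<And>y. y \<in> space L \<Longrightarrow> (\<integral>x. h x y \<partial>S) = 0"
    and v: "\<And>i. v i \<in> l2_fun S" and v0: "\<And>i. (\<integral>x. v i x \<partial>S) = 0" and c: "\<And>k i. c k i \<in> l2_fun L"
    and approx: "\<And>k. (\<integral>\<^sup>+x. ennreal (\<integral>y. (h x y - (\<Sum>i<r k. v i x * c k i y))\<^sup>2 \<partial>L) \<partial>S) \<le> ennreal ((1/4) ^ k)"
    and X: "\<And>n \<omega>. \<omega> \<in> space M \<Longrightarrow> X n \<omega> \<in> l2_fun L"
    and X_re: "\<And>n. random_element (l2_topology L) M (\<lambda>\<omega>. l2_class L (X n \<omega>))"
    and \<beta>[measurable]: "\<And>n. \<beta> n \<in> borel_measurable M"
    and X_close: "\<And>n \<omega>. \<omega> \<in> space M \<Longrightarrow>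
      ennreal (l2_norm L (\<lambda>y. X n \<omega> y - normalized_sum (\<lambda>x. h x y) n \<omega>)) \<le> \<beta> n \<omega>"
    and \<beta>_lim: "(\<lambda>n. \<integral>\<^sup>+\<omega>. \<beta> n \<omega> \<partial>M) \<longlonglongrightarrow> 0"
  obtains N :: "(nat \<Rightarrow> real) measure" and W where
    "prob_space N" "centred_gaussian_element L N W"
    "\<And>F. F \<in> L2 L \<Longrightarrow> (\<lambda>\<omega>. l2_inner L (W \<omega>) F) \<in> l2_fun N"
    "\<And>F. F \<in> L2 L \<Longrightarrow> (\<integral>\<omega>. (l2_inner L (W \<omega>) F)\<^sup>2 \<partial>N) = (\<integral>x. (\<integral>y. h x y * l2_rep F y \<partial>L)\<^sup>2 \<partial>S)"
    "converges_in_distribution (l2_topology L) M (\<lambda>n \<omega>. l2_class L (X n \<omega>)) N W"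
proof -
  interpret L: sigma_finite_measure L by fact
  interpret S: prob_space S by (rule prob_space_S)
  interpret H: Metric_space "L2 L" "l2_dist L" by (rule Metric_space_L2)
  obtain N :: "(nat \<Rightarrow> real) measure" and G W where N: "prob_space N" and G: "\<And>i. G i \<in> l2_fun N"
    and GG: "\<And>i j. (\<integral>\<omega>. G i \<omega> * G j \<omega> \<partial>N) = (\<integral>x. v i x * v j x \<partial>S)"
    and Gchar: "\<And>m t s. char (distr N borel (\<lambda>\<omega>. \<Sum>i<m. t i * G i \<omega>)) s
       = complex_of_real (exp (- (s\<^sup>2 * (\<integral>x. (\<Sum>i<m. t i * v i x)\<^sup>2 \<partial>S)) / 2))"
    and W: "random_element (l2_topology L) N W"
    and Wlim: "AE \<omega> in N. (\<lambda>k. l2_dist L (l2_class L (\<lambda>y. \<Sum>i<r k. G i \<omega> * c k i y)) (W \<omega>)) \<longlonglongrightarrow> 0"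
    and Wchar: "\<And>F s. F \<in> L2 L \<Longrightarrow> char (distr N borel (\<lambda>\<omega>. l2_inner L (W \<omega>) F)) s
       = complex_of_real (exp (- (s\<^sup>2 * (\<integral>x. (\<integral>y. h x y * l2_rep F y \<partial>L)\<^sup>2 \<partial>S)) / 2))"
    by (rule gaussian_element_exists[OF prob_space_S L h hL v c approx]) (assumption, rule that)
  interpret N: prob_space N by fact
  note [measurable] = l2_funD(1)[OF v] l2_funD(1)[OF c] l2_funD(1)[OF G]
  have WL2: "W \<omega> \<in> L2 L" if "\<omega> \<in> space N" for \<omega>
    using random_elementD(1)[OF W that] by (simp add: topspace_l2)
  note normal = normal_char_imp[OF N l2_inner_measurable[OF W] Wchar integral_nonneg_AE[OF AE_I2[OF zero_le_power2]]]
  have gauss: "centred_gaussian_element L N W"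
    unfolding centred_gaussian_element_def using W normal(1,3) by blast
  define U where "U k n \<omega> y = (\<Sum>i<r k. normalized_sum (v i) n \<omega> * c k i y)" for k n \<omega> y
  define e where "e k n \<omega> = l2_norm L (\<lambda>y. normalized_sum (\<lambda>x. h x y) n \<omega> - U k n \<omega> y)" for k n \<omega>
  define hk where "hk k x y = (\<Sum>i<r k. v i x * c k i y)" for k x y
  have hkL: "hk k x \<in> l2_fun L" for k x
    unfolding hk_def[abs_def] by (intro l2_fun_sum l2_fun_cmult c)
  have UL: "U k n \<omega> \<in> l2_fun L" for k n \<omega>
    unfolding U_def[abs_def] by (intro l2_fun_sum l2_fun_cmult c)
  have [measurable]: "(\<lambda>(x, y). hk k x y) \<in> borel_measurable (S \<Otimes>\<^sub>M L)" for k
    unfolding hk_def by measurable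
  have U_eq: "normalized_sum (\<lambda>x. h x y) n \<omega> - U k n \<omega> y = normalized_sum (\<lambda>x. h x y - hk k x y) n \<omega>" for k n \<omega> y
  proof -
    have "U k n \<omega> y = normalized_sum (\<lambda>x. hk k x y) n \<omega>"
      unfolding U_def hk_def normalized_sum_sum
      by (intro sum.cong refl) (simp add: normalized_sum_cmult mult.commute[of _ "c k _ y"])
    then show ?thesis by (simp add: normalized_sum_diff)
  qed
  have hkS: "(\<lambda>x. hk k x y) \<in> l2_fun S" for k y
    unfolding hk_def mult.commute[of "v _ _"] by (intro l2_fun_sum l2_fun_cmult v)
  have hk0: "(\<integral>x. hk k x y \<partial>S) = 0" for k y
    unfolding hk_def using l2_integrable[OF v] by (simp add: v0)
  have e_moment: "(\<integral>\<^sup>+\<omega>. ennreal ((e k n \<omega>)\<^sup>2) \<partial>M) \<le> ennreal ((1/4) ^ k)" for k n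
    unfolding e_def U_eq
  proof (rule order_trans[OF normalized_sum_process_moment[OF L] approx[of k, folded hk_def]])
    show "(\<lambda>(x, y). h x y - hk k x y) \<in> borel_measurable (S \<Otimes>\<^sub>M L)" by measurable
    show "(\<lambda>y. h x y - hk k x y) \<in> l2_fun L" if "x \<in> space S" for x
      by (intro l2_fun_diff hL hkL that)
    show "(\<lambda>x. h x y - hk k x y) \<in> l2_fun S" if "y \<in> space L" for y
      by (intro l2_fun_diff hS hkS that)
    show "(\<integral>x. h x y - hk k x y \<partial>S) = 0" if "y \<in> space L" for y
      using l2_integrable[OF hS[OF that]] l2_integrable[OF hkS] by (simp add: h0[OF that] hk0)
  qed
  have [measurable]: "e k n \<in> borel_measurable M" for k n
    unfolding e_def[abs_def] U_eq by (rule normalized_sum_norm_measurable[OF L]) measurable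
  \<comment> \<open>From \<open>t <= (1/2) ^ k + 2 ^ k * t ^ 2\<close> with
    \<open>t = e k n \<omega>\<close>, where both terms have mean at most
    \<open>(1/2) ^ k\<close>.\<close>
  have e_mean: "(\<integral>\<^sup>+\<omega>. ennreal (e k n \<omega>) \<partial>M) \<le> ennreal (2 * (1/2) ^ k)" for k n
  proof -
    have "(\<integral>\<^sup>+\<omega>. ennreal (e k n \<omega>) \<partial>M) \<le> (\<integral>\<^sup>+\<omega>. ennreal ((1/2) ^ k) + ennreal (2 ^ k) * ennreal ((e k n \<omega>)\<^sup>2) \<partial>M)"
    proof (rule nn_integral_mono)
      fix \<omega>
      have "e k n \<omega> \<le> (1/2) ^ k + 2 ^ k * (e k n \<omega>)\<^sup>2"
      proof -
        have "2 ^ k * e k n \<omega> \<le> 1 + (2 ^ k * e k n \<omega>)\<^sup>2"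
        proof -
          have "0 \<le> 2 ^ k * e k n \<omega>" by (simp add: e_def)
          then show ?thesis using sum_squares_bound[of 1 "2 ^ k * e k n \<omega>"] by simp
        qed
        then have "2 ^ k * e k n \<omega> \<le> 2 ^ k * ((1/2) ^ k + 2 ^ k * (e k n \<omega>)\<^sup>2)"
          by (simp add: distrib_left power_mult_distrib power2_eq_square power_one_over mult_ac)
        then show ?thesis by (rule mult_left_le_imp_le) simp
      qed
      then have "ennreal (e k n \<omega>) \<le> ennreal ((1/2) ^ k + 2 ^ k * (e k n \<omega>)\<^sup>2)" by (rule ennreal_leI)
      then show "ennreal (e k n \<omega>) \<le> ennreal ((1/2) ^ k) + ennreal (2 ^ k) * ennreal ((e k n \<omega>)\<^sup>2)"
        by (simp add: ennreal_mult)
    qed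
    also have "\<dots> = ennreal ((1/2) ^ k) + ennreal (2 ^ k) * (\<integral>\<^sup>+\<omega>. ennreal ((e k n \<omega>)\<^sup>2) \<partial>M)"
      by (subst nn_integral_add) (auto simp: nn_integral_cmult emeasure_space_1)
    also have "\<dots> \<le> ennreal ((1/2) ^ k) + ennreal (2 ^ k) * ennreal ((1/4) ^ k)"
      by (intro add_left_mono mult_left_mono e_moment) simp
    also have "\<dots> = ennreal ((1/2) ^ k + 2 ^ k * (1/4) ^ k)" by (simp add: ennreal_mult)
    also have "(1/2) ^ k + 2 ^ k * (1/4) ^ k = 2 * (1/2 :: real) ^ k" by (simp add: power_mult_distrib[symmetric])
    finally show ?thesis .
  qed
  have conv: "converges_in_distribution H.mtopology M (\<lambda>n \<omega>. l2_class L (X n \<omega>)) N W"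
  proof (rule H.portmanteau_lipschitz)
    show "prob_space M" "prob_space N" by (rule prob_space_axioms, rule N)
    show "random_element H.mtopology M (\<lambda>\<omega>. l2_class L (X n \<omega>))" for n
      using X_re by (simp add: l2_topology_def)
    show "random_element H.mtopology N W" using W by (simp add: l2_topology_def)
    fix m \<phi> assume m: "0 \<le> m" and lip: "H.lipschitz m \<phi>" and bdd: "bounded (\<phi> ` L2 L)"
    obtain B where B: "\<And>F. F \<in> L2 L \<Longrightarrow> \<bar>\<phi> F\<bar> \<le> B" using bdd by (auto simp: bounded_iff)
    have cm: "continuous_map (l2_topology L) euclideanreal \<phi>"
      unfolding l2_topology_def by (rule H.lipschitz_continuous_map[OF lip])
    \<comment> \<open>Along finite-rank sums \<open>\<phi>\<close> becomes a bounded continuous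
      function of the first \<open>r k\<close> coefficients, the setting of
      \<open>cramer_wold\<close>.\<close>
    define \<psi> where "\<psi> k x = \<phi> (l2_class L (\<lambda>y. \<Sum>i<r k. x i * c k i y))" for k and x :: "nat \<Rightarrow> real"
    have \<psi>L: "l2_class L (\<lambda>y. \<Sum>i<r k. x i * c k i y) \<in> L2 L" for k and x :: "nat \<Rightarrow> real"
      by (intro l2_class_in_L2 l2_fun_sum l2_fun_cmult c)
    have fd: "(\<lambda>n. \<integral>\<omega>. \<psi> k (\<lambda>i. normalized_sum (v i) n \<omega>) \<partial>M) \<longlonglongrightarrow> (\<integral>\<omega>. \<psi> k (\<lambda>i. G i \<omega>) \<partial>N)" for k
    proof (rule cramer_wold[where V="\<lambda>n i. normalized_sum (v i) n" and G=G and \<psi>="\<psi> k" and m="r k" and C="\<Sum>i<r k. \<integral>x. (v i x)\<^sup>2 \<partial>S" and B=B])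
      show "prob_space M" "prob_space N" by (rule prob_space_axioms, rule N)
      show "normalized_sum (v i) n \<in> l2_fun M" for i n by (rule normalized_sum_l2[OF v])
      show "G i \<in> l2_fun N" for i by (rule G)
      have le: "(\<integral>x. (v i x)\<^sup>2 \<partial>S) \<le> (\<Sum>i<r k. \<integral>x. (v i x)\<^sup>2 \<partial>S)" if "i < r k" for i
        using that by (intro member_le_sum) auto
      then show "(\<integral>\<omega>. (normalized_sum (v i) n \<omega>)\<^sup>2 \<partial>M) \<le> (\<Sum>i<r k. \<integral>x. (v i x)\<^sup>2 \<partial>S)" if "i < r k" for i n
        using that by (simp add: normalized_sum_second_moment[OF v v0] sum_nonneg)
      show "(\<integral>\<omega>. (G i \<omega>)\<^sup>2 \<partial>N) \<le> (\<Sum>i<r k. \<integral>x. (v i x)\<^sup>2 \<partial>S)" if "i < r k" for i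
        using le[OF that] GG[of i i] by (simp add: power2_eq_square)
      show "(\<lambda>n. char (distr M borel (\<lambda>\<omega>. \<Sum>i<r k. t i * normalized_sum (v i) n \<omega>)) 1)
          \<longlonglongrightarrow> char (distr N borel (\<lambda>\<omega>. \<Sum>i<r k. t i * G i \<omega>)) 1" for t
      proof -
        have "(\<lambda>\<omega>. \<Sum>i<r k. t i * normalized_sum (v i) n \<omega>) = normalized_sum (\<lambda>x. \<Sum>i<r k. t i * v i x) n" for n
          by (simp add: normalized_sum_sum normalized_sum_cmult fun_eq_iff)
        moreover have "(\<lambda>n. char (distr M borel (normalized_sum (\<lambda>x. \<Sum>i<r k. t i * v i x) n)) 1)
            \<longlonglongrightarrow> complex_of_real (exp (- (\<integral>x. (\<Sum>i<r k. t i * v i x)\<^sup>2 \<partial>S) / 2))"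
          using l2_integrable[OF v]
          by (intro normalized_sum_char_tendsto l2_fun_sum l2_fun_cmult v) (simp add: v0)
        ultimately show ?thesis by (simp add: Gchar)
      qed
      show "continuous_on UNIV (\<psi> k)"
        unfolding \<psi>_def[abs_def] by (rule random_element_finite_rank(2)[OF _ _ cm]) (use c in auto)
      show "\<psi> k x = \<psi> k y" if "\<And>i. i < r k \<Longrightarrow> x i = y i" for x y
        unfolding \<psi>_def using that by (intro arg_cong[where f="\<lambda>f. \<phi> (l2_class L f)"] ext sum.cong) auto
      show "\<bar>\<psi> k x\<bar> \<le> B" for x unfolding \<psi>_def by (intro B \<psi>L)
    qed
    have limW: "(\<lambda>k. \<integral>\<omega>. \<psi> k (\<lambda>i. G i \<omega>) \<partial>N) \<longlonglongrightarrow> (\<integral>\<omega>. \<phi> (W \<omega>) \<partial>N)"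
    proof (rule integral_dominated_convergence[where w="\<lambda>_. B"])
      show "(\<lambda>\<omega>. \<phi> (W \<omega>)) \<in> borel_measurable N" by (rule random_element_continuous_map[OF W cm])
      show "(\<lambda>\<omega>. \<psi> k (\<lambda>i. G i \<omega>)) \<in> borel_measurable N" for k
        unfolding \<psi>_def
        by (rule random_element_continuous_map[OF random_element_finite_rank(1) cm]) (auto simp: c)
      show "AE \<omega> in N. norm (\<psi> k (\<lambda>i. G i \<omega>)) \<le> B" for k
        unfolding \<psi>_def using B[OF \<psi>L] by simp
      show "AE \<omega> in N. (\<lambda>k. \<psi> k (\<lambda>i. G i \<omega>)) \<longlonglongrightarrow> \<phi> (W \<omega>)"
        using Wlim AE_space
      proof eventually_elim
        case (elim \<omega>)
        show ?case
        proof (rule Lim_null_comparison[THEN LIM_zero_cancel])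
          show "(\<lambda>k. m * l2_dist L (l2_class L (\<lambda>y. \<Sum>i<r k. G i \<omega> * c k i y)) (W \<omega>)) \<longlonglongrightarrow> 0"
            by (rule tendsto_mult_right_zero[OF elim(1)])
          show "\<forall>\<^sub>F k in sequentially. norm (\<psi> k (\<lambda>i. G i \<omega>) - \<phi> (W \<omega>))
              \<le> m * l2_dist L (l2_class L (\<lambda>y. \<Sum>i<r k. G i \<omega> * c k i y)) (W \<omega>)"
            using lip \<psi>L WL2[OF elim(2)] by (simp add: H.lipschitz_def \<psi>_def)
        qed
      qed
    qed auto
    have diff: "ennreal \<bar>(\<integral>\<omega>. \<phi> (l2_class L (X n \<omega>)) \<partial>M) - (\<integral>\<omega>. \<psi> k (\<lambda>i. normalized_sum (v i) n \<omega>) \<partial>M)\<bar>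
        \<le> ennreal m * ((\<integral>\<^sup>+\<omega>. \<beta> n \<omega> \<partial>M) + ennreal (2 * (1/2) ^ k))" for n k
    proof -
      have XL: "l2_class L (X n \<omega>) \<in> L2 L" if "\<omega> \<in> space M" for \<omega> by (intro l2_class_in_L2 X that)
      have i1: "integrable M (\<lambda>\<omega>. \<phi> (l2_class L (X n \<omega>)))"
        using random_element_continuous_map[OF X_re cm] B[OF XL]
        by (intro integrable_const_bound[of _ B]) auto
      have i2: "integrable M (\<lambda>\<omega>. \<psi> k (\<lambda>i. normalized_sum (v i) n \<omega>))"
      proof (rule integrable_const_bound[of _ B])
        show "(\<lambda>\<omega>. \<psi> k (\<lambda>i. normalized_sum (v i) n \<omega>)) \<in> borel_measurable M"
          unfolding \<psi>_def
          by (rule random_element_continuous_map[OF random_element_finite_rank(1) cm])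
            (auto simp: c intro: l2_funD(1) normalized_sum_l2 v)
        show "AE \<omega> in M. norm (\<psi> k (\<lambda>i. normalized_sum (v i) n \<omega>)) \<le> B"
          unfolding \<psi>_def using B[OF \<psi>L] by simp
      qed
      have "ennreal \<bar>(\<integral>\<omega>. \<phi> (l2_class L (X n \<omega>)) \<partial>M) - (\<integral>\<omega>. \<psi> k (\<lambda>i. normalized_sum (v i) n \<omega>) \<partial>M)\<bar>
          = ennreal \<bar>\<integral>\<omega>. \<phi> (l2_class L (X n \<omega>)) - \<psi> k (\<lambda>i. normalized_sum (v i) n \<omega>) \<partial>M\<bar>"
        using i1 i2 by simp
      also have "\<dots> \<le> ennreal (\<integral>\<omega>. \<bar>\<phi> (l2_class L (X n \<omega>)) - \<psi> k (\<lambda>i. normalized_sum (v i) n \<omega>)\<bar> \<partial>M)"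
        by (intro ennreal_leI integral_abs_bound)
      also have "\<dots> = (\<integral>\<^sup>+\<omega>. ennreal \<bar>\<phi> (l2_class L (X n \<omega>)) - \<psi> k (\<lambda>i. normalized_sum (v i) n \<omega>)\<bar> \<partial>M)"
        using i1 i2 by (intro nn_integral_eq_integral[symmetric]) auto
      also have "\<dots> \<le> (\<integral>\<^sup>+\<omega>. ennreal m * (\<beta> n \<omega> + ennreal (e k n \<omega>)) \<partial>M)"
      proof (rule nn_integral_mono)
        fix \<omega> assume \<omega>: "\<omega> \<in> space M"
        have nl: "(\<lambda>y. normalized_sum (\<lambda>x. h x y) n \<omega>) \<in> l2_fun L"
          by (rule normalized_sum_l2_fun[OF hL \<omega>])
        have "\<bar>\<phi> (l2_class L (X n \<omega>)) - \<psi> k (\<lambda>i. normalized_sum (v i) n \<omega>)\<bar>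
            \<le> m * l2_dist L (l2_class L (X n \<omega>)) (l2_class L (U k n \<omega>))"
          using lip XL[OF \<omega>] l2_class_in_L2[OF UL[of k n \<omega>]]
          unfolding H.lipschitz_def \<psi>_def U_def[abs_def] by simp
        also have "l2_dist L (l2_class L (X n \<omega>)) (l2_class L (U k n \<omega>)) = l2_norm L (\<lambda>y. X n \<omega> y - U k n \<omega> y)"
          by (rule l2_dist_norm[OF X[OF \<omega>] UL])
        also have "m * l2_norm L (\<lambda>y. X n \<omega> y - U k n \<omega> y)
            \<le> m * (l2_norm L (\<lambda>y. X n \<omega> y - normalized_sum (\<lambda>x. h x y) n \<omega>) + e k n \<omega>)"
          unfolding e_def by (intro mult_left_mono l2_norm_diff_triangle X \<omega> nl UL m)
        finally have "ennreal \<bar>\<phi> (l2_class L (X n \<omega>)) - \<psi> k (\<lambda>i. normalized_sum (v i) n \<omega>)\<bar>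
            \<le> ennreal (m * (l2_norm L (\<lambda>y. X n \<omega> y - normalized_sum (\<lambda>x. h x y) n \<omega>) + e k n \<omega>))"
          by (rule ennreal_leI)
        also have "\<dots> = ennreal m * (ennreal (l2_norm L (\<lambda>y. X n \<omega> y - normalized_sum (\<lambda>x. h x y) n \<omega>)) + ennreal (e k n \<omega>))"
          using m by (simp add: ennreal_mult e_def)
        also have "\<dots> \<le> ennreal m * (\<beta> n \<omega> + ennreal (e k n \<omega>))"
          by (intro mult_left_mono add_right_mono X_close \<omega>) simp
        finally show "ennreal \<bar>\<phi> (l2_class L (X n \<omega>)) - \<psi> k (\<lambda>i. normalized_sum (v i) n \<omega>)\<bar>
            \<le> ennreal m * (\<beta> n \<omega> + ennreal (e k n \<omega>))" .
      qed
      also have "\<dots> = ennreal m * ((\<integral>\<^sup>+\<omega>. \<beta> n \<omega> \<partial>M) + (\<integral>\<^sup>+\<omega>. ennreal (e k n \<omega>) \<partial>M))"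
        by (subst nn_integral_cmult) (auto simp: nn_integral_add)
      also have "\<dots> \<le> ennreal m * ((\<integral>\<^sup>+\<omega>. \<beta> n \<omega> \<partial>M) + ennreal (2 * (1/2) ^ k))"
        by (intro mult_left_mono add_left_mono e_mean) simp
      finally show ?thesis .
    qed
    show "(\<lambda>n. \<integral>\<omega>. \<phi> (l2_class L (X n \<omega>)) \<partial>M) \<longlonglongrightarrow> (\<integral>\<omega>. \<phi> (W \<omega>) \<partial>N)"
    proof (rule tendstoI)
      fix \<epsilon> :: real assume \<epsilon>: "0 < \<epsilon>"
      \<comment> \<open>One \<open>\<delta>\<close> is for \<open>\<beta> n\<close> and one for the
        finite-rank error, together at most \<open>\<epsilon> / 2\<close> after multiplication by
        \<open>m\<close>; the summand 1 allows \<open>m = 0\<close>. The index \<open>k\<close> is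
        fixed before \<open>n\<close> grows.\<close>
      define \<delta> where "\<delta> = \<epsilon> / (4 * (m + 1))"
      have \<delta>: "0 < \<delta>" "m * \<delta> \<le> \<epsilon> / 4" using \<epsilon> m by (auto simp: \<delta>_def field_simps)
      have "(\<lambda>k. 2 * (1/2 :: real) ^ k) \<longlonglongrightarrow> 0"
        by (intro tendsto_mult_right_zero LIMSEQ_power_zero) simp
      then have "\<forall>\<^sub>F k in sequentially. 2 * (1/2 :: real) ^ k < \<delta>"
        using \<delta>(1) by (rule order_tendstoD(2))
      moreover have "\<forall>\<^sub>F k in sequentially. dist (\<integral>\<omega>. \<psi> k (\<lambda>i. G i \<omega>) \<partial>N) (\<integral>\<omega>. \<phi> (W \<omega>) \<partial>N) < \<epsilon> / 4"
        using \<epsilon> by (intro tendstoD[OF limW]) simp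
      ultimately have "\<forall>\<^sub>F k in sequentially. 2 * (1/2 :: real) ^ k < \<delta>
          \<and> dist (\<integral>\<omega>. \<psi> k (\<lambda>i. G i \<omega>) \<partial>N) (\<integral>\<omega>. \<phi> (W \<omega>) \<partial>N) < \<epsilon> / 4" by (rule eventually_conj)
      then obtain k where k: "2 * (1/2 :: real) ^ k < \<delta>"
          "dist (\<integral>\<omega>. \<psi> k (\<lambda>i. G i \<omega>) \<partial>N) (\<integral>\<omega>. \<phi> (W \<omega>) \<partial>N) < \<epsilon> / 4"
        by (auto dest: eventually_happens)
      have "\<forall>\<^sub>F n in sequentially. (\<integral>\<^sup>+\<omega>. \<beta> n \<omega> \<partial>M) < ennreal \<delta>"
        using \<delta> by (intro order_tendstoD(2)[OF \<beta>_lim]) simp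
      moreover have "\<forall>\<^sub>F n in sequentially. dist (\<integral>\<omega>. \<psi> k (\<lambda>i. normalized_sum (v i) n \<omega>) \<partial>M)
          (\<integral>\<omega>. \<psi> k (\<lambda>i. G i \<omega>) \<partial>N) < \<epsilon> / 4"
        using \<epsilon> by (intro tendstoD[OF fd]) simp
      ultimately show "\<forall>\<^sub>F n in sequentially. dist (\<integral>\<omega>. \<phi> (l2_class L (X n \<omega>)) \<partial>M) (\<integral>\<omega>. \<phi> (W \<omega>) \<partial>N) < \<epsilon>"
      proof eventually_elim
        case (elim n)
        have "ennreal \<bar>(\<integral>\<omega>. \<phi> (l2_class L (X n \<omega>)) \<partial>M) - (\<integral>\<omega>. \<psi> k (\<lambda>i. normalized_sum (v i) n \<omega>) \<partial>M)\<bar>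
            \<le> ennreal m * (ennreal \<delta> + ennreal \<delta>)"
          using elim(1) k(1) \<delta>
          by (intro order_trans[OF diff[of n k]] mult_left_mono add_mono ennreal_leI) auto
        also have "\<dots> = ennreal (m * (\<delta> + \<delta>))" using m \<delta>(1) by (simp only: ennreal_mult ennreal_plus add_nonneg_nonneg less_imp_le)
        finally have "\<bar>(\<integral>\<omega>. \<phi> (l2_class L (X n \<omega>)) \<partial>M) - (\<integral>\<omega>. \<psi> k (\<lambda>i. normalized_sum (v i) n \<omega>) \<partial>M)\<bar> \<le> m * (\<delta> + \<delta>)"
          using m \<delta> by (simp add: ennreal_le_iff)
        also have "\<dots> \<le> \<epsilon> / 2" using \<delta>(2) by (simp add: distrib_left)
        finally show ?case using elim(2) k(2) unfolding dist_real_def by linarith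
      qed
    qed
  qed
  show ?thesis
    by (rule that[OF N gauss normal(2) normal(4)]) (use conv in \<open>simp_all add: l2_topology_def\<close>)
qed

end

section \<open>Double integrals of covariance kernels\<close>

text \<open>Fubini's theorem on the triple product. For fixed \<open>x\<close> the integral of the
  absolute value over the last two variables factorizes, so \<open>fin\<close> is exactly absolute
  integrability. The aim is a kernel that is a mean of products: its double integral against two
  functions becomes a mean product of two inner products.\<close>

lemma product_kernel_Fubini:
  fixes u w :: "'x \<Rightarrow> 'b \<Rightarrow> real"
  assumes S: "sigma_finite_measure S" and B: "sigma_finite_measure B"
    and u[measurable]: "(\<lambda>(x, s). u x s) \<in> borel_measurable (S \<Otimes>\<^sub>M B)"
    and w[measurable]: "(\<lambda>(x, s). w x s) \<in> borel_measurable (S \<Otimes>\<^sub>M B)"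
    and ux: "\<And>x. x \<in> space S \<Longrightarrow> integrable B (u x)" and wx: "\<And>x. x \<in> space S \<Longrightarrow> integrable B (w x)"
    and fin: "(\<integral>\<^sup>+x. ennreal ((\<integral>s. \<bar>u x s\<bar> \<partial>B) * (\<integral>t. \<bar>w x t\<bar> \<partial>B)) \<partial>S) < \<infinity>"
  shows "integrable (B \<Otimes>\<^sub>M B) (\<lambda>(s, t). \<integral>x. u x s * w x t \<partial>S)"
    and "(\<integral>t. (\<integral>s. (\<integral>x. u x s * w x t \<partial>S) \<partial>B) \<partial>B) = (\<integral>x. (\<integral>s. u x s \<partial>B) * (\<integral>t. w x t \<partial>B) \<partial>S)"
proof -
  interpret S: sigma_finite_measure S by fact
  interpret B: sigma_finite_measure B by fact
  interpret BB: pair_sigma_finite B B ..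
  have BB: "sigma_finite_measure (B \<Otimes>\<^sub>M B)" by (rule sigma_finite_pair_measure[OF B B])
  interpret SBB: pair_sigma_finite S "B \<Otimes>\<^sub>M B" ..
  define F where "F x z = u x (fst z) * w x (snd z)" for x and z :: "'b \<times> 'b"
  have "(\<lambda>p. (fst p, fst (snd p))) \<in> measurable (S \<Otimes>\<^sub>M (B \<Otimes>\<^sub>M B)) (S \<Otimes>\<^sub>M B)" by measurable
  from measurable_compose[OF this u]
  have m1: "(\<lambda>p. u (fst p) (fst (snd p))) \<in> borel_measurable (S \<Otimes>\<^sub>M (B \<Otimes>\<^sub>M B))" by simp
  have "(\<lambda>p. (fst p, snd (snd p))) \<in> measurable (S \<Otimes>\<^sub>M (B \<Otimes>\<^sub>M B)) (S \<Otimes>\<^sub>M B)" by measurable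
  from measurable_compose[OF this w]
  have m2: "(\<lambda>p. w (fst p) (snd (snd p))) \<in> borel_measurable (S \<Otimes>\<^sub>M (B \<Otimes>\<^sub>M B))" by simp
  have F[measurable]: "(\<lambda>(x, z). F x z) \<in> borel_measurable (S \<Otimes>\<^sub>M (B \<Otimes>\<^sub>M B))"
    unfolding F_def split_beta' using m1 m2 by simp
  have nnF: "(\<integral>\<^sup>+z. ennreal \<bar>F x z\<bar> \<partial>(B \<Otimes>\<^sub>M B)) = ennreal ((\<integral>s. \<bar>u x s\<bar> \<partial>B) * (\<integral>t. \<bar>w x t\<bar> \<partial>B))"
    if x: "x \<in> space S" for x
  proof -
    note [measurable] = borel_measurable_integrable[OF ux[OF x]] borel_measurable_integrable[OF wx[OF x]]
    have "(\<integral>\<^sup>+z. ennreal \<bar>F x z\<bar> \<partial>(B \<Otimes>\<^sub>M B)) = (\<integral>\<^sup>+s. \<integral>\<^sup>+t. ennreal \<bar>F x (s, t)\<bar> \<partial>B \<partial>B)"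
      by (rule B.nn_integral_fst[symmetric]) (simp add: F_def)
    also have "\<dots> = (\<integral>\<^sup>+s. ennreal \<bar>u x s\<bar> * (\<integral>\<^sup>+t. ennreal \<bar>w x t\<bar> \<partial>B) \<partial>B)"
      by (simp add: F_def abs_mult ennreal_mult nn_integral_cmult)
    also have "\<dots> = (\<integral>\<^sup>+s. ennreal \<bar>u x s\<bar> \<partial>B) * (\<integral>\<^sup>+t. ennreal \<bar>w x t\<bar> \<partial>B)"
      by (rule nn_integral_multc) simp
    also have "\<dots> = ennreal (\<integral>s. \<bar>u x s\<bar> \<partial>B) * ennreal (\<integral>t. \<bar>w x t\<bar> \<partial>B)"
      using ux[OF x] wx[OF x] by (subst (1 2) nn_integral_eq_integral) auto
    finally show ?thesis by (simp add: ennreal_mult)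
  qed
  have Fx: "integrable (B \<Otimes>\<^sub>M B) (F x)" if x: "x \<in> space S" for x
  proof (rule integrableI_bounded)
    show "F x \<in> borel_measurable (B \<Otimes>\<^sub>M B)"
      using measurable_compose[OF measurable_Pair1'[OF x] F] by simp
  qed (use nnF[OF x] in simp)
  have "(\<integral>\<^sup>+p. ennreal (norm (case_prod F p)) \<partial>(S \<Otimes>\<^sub>M (B \<Otimes>\<^sub>M B)))
      = (\<integral>\<^sup>+x. \<integral>\<^sup>+z. ennreal (norm (F x z)) \<partial>(B \<Otimes>\<^sub>M B) \<partial>S)"
    by (subst sigma_finite_measure.nn_integral_fst[OF BB, symmetric]) auto
  also have "\<dots> < \<infinity>"
    using fin by (simp add: nnF cong: nn_integral_cong)
  finally have int: "integrable (S \<Otimes>\<^sub>M (B \<Otimes>\<^sub>M B)) (case_prod F)"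
    by (intro integrableI_bounded) auto
  have k: "integrable (B \<Otimes>\<^sub>M B) (\<lambda>z. \<integral>x. F x z \<partial>S)" by (rule SBB.integrable_snd[OF int])
  then show k': "integrable (B \<Otimes>\<^sub>M B) (\<lambda>(s, t). \<integral>x. u x s * w x t \<partial>S)"
    by (simp add: F_def split_beta')
  have "(\<integral>t. (\<integral>s. (\<integral>x. u x s * w x t \<partial>S) \<partial>B) \<partial>B) = (\<integral>z. (\<integral>x. F x z \<partial>S) \<partial>(B \<Otimes>\<^sub>M B))"
    using BB.integral_snd[OF k'] by (simp add: F_def split_beta')
  also have "\<dots> = (\<integral>x. (\<integral>z. F x z \<partial>(B \<Otimes>\<^sub>M B)) \<partial>S)"
    using SBB.integral_snd[OF int] SBB.integral_fst[OF int] by simp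
  also have "\<dots> = (\<integral>x. (\<integral>s. u x s \<partial>B) * (\<integral>t. w x t \<partial>B) \<partial>S)"
  proof (rule Bochner_Integration.integral_cong[OF refl])
    fix x assume x: "x \<in> space S"
    have "(\<integral>z. F x z \<partial>(B \<Otimes>\<^sub>M B)) = (\<integral>s. (\<integral>t. F x (s, t) \<partial>B) \<partial>B)"
      by (rule BB.integral_fst'[symmetric, OF Fx[OF x]])
    then show "(\<integral>z. F x z \<partial>(B \<Otimes>\<^sub>M B)) = (\<integral>s. u x s \<partial>B) * (\<integral>t. w x t \<partial>B)"
      by (simp add: F_def)
  qed
  finally show "(\<integral>t. (\<integral>s. (\<integral>x. u x s * w x t \<partial>S) \<partial>B) \<partial>B) = (\<integral>x. (\<integral>s. u x s \<partial>B) * (\<integral>t. w x t \<partial>B) \<partial>S)" .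
qed

section \<open>Right-continuous functions on the weighted half-line\<close>

lemma space_exp_weight [simp]: "space (exp_weight a) = {0..}"
  by (simp add: exp_weight_def space_restrict_space)

lemma sets_exp_weight: "sets (exp_weight a) = sets (restrict_space borel {0..})"
  unfolding exp_weight_def sets_density by (rule sets_restrict_space_cong) simp

lemma measurable_exp_weight_ident: "(\<lambda>y. y) \<in> borel_measurable (exp_weight a)"
  by (subst measurable_cong_sets[OF sets_exp_weight refl]) (rule measurable_restrict_space1, simp)

lemma sigma_finite_exp_weight: "sigma_finite_measure (exp_weight a)"
proof -
  interpret sigma_finite_measure "restrict_space lborel {0..} :: real measure"
    by (rule sigma_finite_measure_restrict_space[OF sigma_finite_lborel]) simp
  have "(\<lambda>t. ennreal (exp (- a * t))) \<in> borel_measurable (restrict_space lborel {0..})"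
    by (rule measurable_restrict_space1) measurable
  then show ?thesis
    unfolding exp_weight_def by (subst sigma_finite_iff_density_finite) auto
qed

lemma borel_measurable_exp_weight_iff:
  fixes f :: "real \<Rightarrow> real"
  shows "f \<in> borel_measurable (exp_weight a) \<longleftrightarrow> (\<lambda>y. indicator {0..} y * f y) \<in> borel_measurable borel"
  by (simp add: measurable_cong_sets[OF sets_exp_weight refl] borel_measurable_restrict_space_iff)

lemma integrable_exp_weight:
  fixes f :: "real \<Rightarrow> real"
  assumes "f \<in> borel_measurable (exp_weight a)"
  shows "integrable (exp_weight a) f \<longleftrightarrow> integrable lborel (\<lambda>y. indicator {0..} y * (exp (- a * y) * f y))"
    and "(\<integral>y. f y \<partial>exp_weight a) = (\<integral>y. indicator {0..} y * (exp (- a * y) * f y) \<partial>lborel)"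
proof -
  have e: "(\<lambda>t. exp (- a * t)) \<in> borel_measurable (restrict_space lborel {0..})"
    by (rule measurable_restrict_space1) measurable
  have f: "f \<in> borel_measurable (restrict_space lborel {0..})"
    using assms by (simp add: exp_weight_def)
  show "integrable (exp_weight a) f \<longleftrightarrow> integrable lborel (\<lambda>y. indicator {0..} y * (exp (- a * y) * f y))"
    unfolding exp_weight_def by (subst integrable_density[OF f e]) (simp_all add: integrable_restrict_space)
  show "(\<integral>y. f y \<partial>exp_weight a) = (\<integral>y. indicator {0..} y * (exp (- a * y) * f y) \<partial>lborel)"
    unfolding exp_weight_def by (subst integral_density[OF f e]) (simp_all add: integral_restrict_space)
qed

text \<open>As a function of \<open>y\<close> this is the indicator of \<open>{..<x}\<close>, and
  for \<open>0 \<le> a\<close> the weight is at most 1, so the mass of that set in the half-line is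
  at most \<open>\<bar>x\<bar>\<close>. This factor raises second moments to third ones.\<close>

lemma indicator_l2_fun:
  assumes a: "0 \<le> a"
  shows "(\<lambda>y. indicator {y<..} x) \<in> l2_fun (exp_weight a)"
    and "(\<integral>y. (indicator {y<..} x)\<^sup>2 \<partial>exp_weight a) \<le> \<bar>x\<bar>"
proof -
  have eq: "indicator {y<..} x = (indicator {..<x} y :: real)" for y by (simp add: indicator_def)
  have sq: "(indicator {..<x} y :: real)\<^sup>2 = indicator {..<x} y" for y by (simp add: indicator_def)
  have m: "(\<lambda>y. indicator {..<x} y :: real) \<in> borel_measurable (exp_weight a)"
    by (rule measurable_compose[OF measurable_exp_weight_ident]) measurable
  have le: "indicator {0..} y * (exp (- a * y) * indicator {..<x} y) \<le> indicator {0..\<bar>x\<bar>} y" for y :: real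
    using a by (auto simp: indicator_def)
  have int: "integrable lborel (indicator {0..\<bar>x\<bar>} :: real \<Rightarrow> real)" by (simp add: integrable_indicator_iff)
  have int': "integrable lborel (\<lambda>y. indicator {0..} y * (exp (- a * y) * indicator {..<x} y) :: real)"
    by (rule Bochner_Integration.integrable_bound[OF int]) (use le in \<open>auto intro!: AE_I2\<close>)
  show "(\<lambda>y. indicator {y<..} x) \<in> l2_fun (exp_weight a)"
    using m int' unfolding l2_fun_def eq by (simp add: sq integrable_exp_weight(1))
  have "(\<integral>y. (indicator {y<..} x)\<^sup>2 \<partial>exp_weight a)
      = (\<integral>y. indicator {0..} y * (exp (- a * y) * indicator {..<x} y) \<partial>lborel)"
    unfolding eq sq by (rule integrable_exp_weight(2)[OF m])
  also have "\<dots> \<le> (\<integral>y. indicator {0..\<bar>x\<bar>} y \<partial>lborel)"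
    by (rule integral_mono[OF int' int le])
  finally show "(\<integral>y. (indicator {y<..} x)\<^sup>2 \<partial>exp_weight a) \<le> \<bar>x\<bar>" by simp
qed

section \<open>Approximation by step functions with rational jump points\<close>

text \<open>The enumeration is injective, so that the least of finitely many rationals above
  \<open>y\<close> has a unique index.\<close>

definition rat_seq :: "nat \<Rightarrow> real" where
  "rat_seq = from_nat_into \<rat>"

lemma rat_seq_bij: "bij_betw rat_seq UNIV \<rat>"
  unfolding rat_seq_def by (rule bij_betw_from_nat_into[OF countable_rat Rats_infinite])

text \<open>On the half-line \<open>\<Sum>i<k. F (rat_seq i) * rat_step k i\<close> is the step function whose value at \<open>y\<close> is
  \<open>F r\<close> for the least \<open>r > y\<close> among the first \<open>k\<close> rationals, and \<open>0\<close> if there is no such \<open>r\<close>.\<close>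

definition rat_step :: "nat \<Rightarrow> nat \<Rightarrow> real \<Rightarrow> real" where
  "rat_step k i y = of_bool (y < rat_seq i \<and> (\<forall>l<k. y < rat_seq l \<longrightarrow> rat_seq i \<le> rat_seq l))"

lemma rat_step_l2:
  assumes "0 \<le> a"
  shows "rat_step k i \<in> l2_fun (exp_weight a)"
proof (rule l2_fun_bound[OF indicator_l2_fun(1)[OF assms, of "rat_seq i"]])
  have "rat_step k i \<in> borel_measurable borel" unfolding rat_step_def by measurable
  then show "rat_step k i \<in> borel_measurable (exp_weight a)"
    by (rule measurable_compose[OF measurable_exp_weight_ident])
qed (simp add: rat_step_def)

text \<open>Exactly one index contributes, by injectivity of \<open>rat_seq\<close>. The bound by
  \<open>rat_seq m\<close> keeps the selected rational near \<open>y\<close> once some rational near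
  \<open>y\<close> has been enumerated.\<close>

lemma rat_step_sum:
  fixes F :: "real \<Rightarrow> real"
  assumes "m < k" "y < rat_seq m"
  obtains r where "y < r" "r \<le> rat_seq m" "(\<Sum>i<k. F (rat_seq i) * rat_step k i y) = F r"
proof -
  define A where "A = {i. i < k \<and> y < rat_seq i}"
  have A: "finite A" "m \<in> A" using assms by (auto simp: A_def)
  obtain i0 where i0: "i0 \<in> A" "\<And>i. i \<in> A \<Longrightarrow> rat_seq i0 \<le> rat_seq i"
    using finite_has_minimal[of "rat_seq ` A"] A by (metis (no_types, lifting) ex_min_if_finite finite_imageI image_iff image_is_empty empty_iff not_le)
  have inj: "rat_seq i = rat_seq j \<Longrightarrow> i = j" for i j
    using rat_seq_bij by (auto simp: bij_betw_def inj_on_def)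
  have "rat_step k i y = of_bool (i = i0)" if "i < k" for i
  proof (cases "i = i0")
    case True
    then show ?thesis using i0 by (auto simp: rat_step_def A_def)
  next
    case False
    have "\<not> (y < rat_seq i \<and> (\<forall>l<k. y < rat_seq l \<longrightarrow> rat_seq i \<le> rat_seq l))"
    proof
      assume *: "y < rat_seq i \<and> (\<forall>l<k. y < rat_seq l \<longrightarrow> rat_seq i \<le> rat_seq l)"
      then have "rat_seq i \<le> rat_seq i0" using i0(1) by (auto simp: A_def)
      moreover have "rat_seq i0 \<le> rat_seq i" using * that by (intro i0(2)) (auto simp: A_def)
      ultimately show False using inj False by fastforce
    qed
    then show ?thesis using False by (simp add: rat_step_def)
  qed
  then have "(\<Sum>i<k. F (rat_seq i) * rat_step k i y) = (\<Sum>i<k. if i = i0 then F (rat_seq i0) else 0)"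
    by (intro sum.cong) auto
  also have "\<dots> = F (rat_seq i0)" using i0(1) by (simp add: A_def)
  finally show ?thesis using that i0 A by (auto simp: A_def)
qed

lemma rat_step_sum_zero:
  assumes "\<And>m. m < k \<Longrightarrow> \<not> y < rat_seq m"
  shows "(\<Sum>i<k. F (rat_seq i) * rat_step k i y) = 0"
  using assms by (intro sum.neutral) (auto simp: rat_step_def)

text \<open>The sum is a value of \<open>F\<close> to the right of \<open>y\<close> or it is 0; the
  second case is covered because the hypothesis at \<open>r = y\<close> forces
  \<open>0 \<le> D\<close>.\<close>

lemma rat_step_bound:
  assumes "\<And>r. y \<le> r \<Longrightarrow> \<bar>F r\<bar> \<le> D"
  shows "\<bar>\<Sum>i<k. F (rat_seq i) * rat_step k i y\<bar> \<le> D"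
proof (cases "\<exists>m<k. y < rat_seq m")
  case True
  then obtain m where "m < k" "y < rat_seq m" by blast
  then obtain r where "y < r" "(\<Sum>i<k. F (rat_seq i) * rat_step k i y) = F r"
    by (rule rat_step_sum)
  then show ?thesis using assms[of r] by simp
next
  case False
  then have "(\<Sum>i<k. F (rat_seq i) * rat_step k i y) = 0" by (intro rat_step_sum_zero) auto
  then show ?thesis using assms[of y] by simp
qed

text \<open>Once the enumeration has reached a rational \<open>q\<close> slightly above
  \<open>y\<close>, the selected rational lies in \<open>{y<..q}\<close>, where right-continuity
  controls \<open>F\<close>.\<close>

lemma rat_step_tendsto:
  assumes "(F \<longlongrightarrow> F y) (at_right y)"
  shows "(\<lambda>k. \<Sum>i<k. F (rat_seq i) * rat_step k i y) \<longlonglongrightarrow> F y"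
proof (rule tendstoI)
  fix e :: real assume "0 < e"
  then have "\<forall>\<^sub>F r in at_right y. dist (F r) (F y) < e" using assms by (rule tendstoD[rotated])
  then obtain b where b: "y < b" "\<And>r. y < r \<Longrightarrow> r < b \<Longrightarrow> dist (F r) (F y) < e"
    unfolding eventually_at_right[OF gt_ex[THEN exE, of y]] by (metis eventually_at_right_field)
  obtain q where q: "q \<in> \<rat>" "y < q" "q < b" using Rats_dense_in_real[OF b(1)] by blast
  then obtain m where m: "rat_seq m = q"
    using bij_betw_imp_surj_on[OF rat_seq_bij] by (metis imageE)
  show "\<forall>\<^sub>F k in sequentially. dist (\<Sum>i<k. F (rat_seq i) * rat_step k i y) (F y) < e"
    using eventually_gt_at_top[of m]
  proof eventually_elim
    case (elim k)
    have "y < rat_seq m" using m q by simp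
    with elim obtain r where "y < r" "r \<le> rat_seq m" "(\<Sum>i<k. F (rat_seq i) * rat_step k i y) = F r"
      by (rule rat_step_sum)
    then show ?case using b(2)[of r] q m by simp
  qed
qed

text \<open>For \<open>0 \<le> y\<close> a negative rational is never selected. The absolute value
  turns every coefficient into a value of \<open>F\<close> on the half-line, where its measurability
  will be assumed.\<close>

lemma rat_step_abs:
  assumes "0 \<le> y"
  shows "(\<Sum>i<k. F \<bar>rat_seq i\<bar> * rat_step k i y) = (\<Sum>i<k. F (rat_seq i) * rat_step k i y)"
proof (rule sum.cong[OF refl])
  fix i
  show "F \<bar>rat_seq i\<bar> * rat_step k i y = F (rat_seq i) * rat_step k i y"
    using assms by (cases "y < rat_seq i") (auto simp: rat_step_def)
qed

lemma rat_step_l2_tendsto: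
  assumes a: "0 \<le> a" and F: "F \<in> l2_fun (exp_weight a)" and D: "D \<in> l2_fun (exp_weight a)"
    and rc: "\<And>y. 0 \<le> y \<Longrightarrow> (F \<longlongrightarrow> F y) (at_right y)"
    and dom: "\<And>y r. 0 \<le> y \<Longrightarrow> y \<le> r \<Longrightarrow> \<bar>F r\<bar> \<le> D y"
  shows "(\<lambda>k. \<integral>y. (F y - (\<Sum>i<k. F \<bar>rat_seq i\<bar> * rat_step k i y))\<^sup>2 \<partial>exp_weight a) \<longlonglongrightarrow> 0"
    and "(\<integral>y. (F y - (\<Sum>i<k. F \<bar>rat_seq i\<bar> * rat_step k i y))\<^sup>2 \<partial>exp_weight a) \<le> 4 * (\<integral>y. (D y)\<^sup>2 \<partial>exp_weight a)"
proof -
  let ?L = "exp_weight a"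
  define T where "T k y = (\<Sum>i<k. F \<bar>rat_seq i\<bar> * rat_step k i y)" for k y
  have T: "T k \<in> l2_fun ?L" for k
    unfolding T_def[abs_def] by (intro l2_fun_sum l2_fun_cmult rat_step_l2 a)
  note [measurable] = l2_funD(1)[OF F] l2_funD(1)[OF T] l2_funD(1)[OF D]
  \<comment> \<open>Both \<open>F y\<close> and the step function are at most \<open>D y\<close> in
    absolute value, whence the factor 4.\<close>
  have bound: "(F y - T k y)\<^sup>2 \<le> 4 * (D y)\<^sup>2" if y: "0 \<le> y" for k y
  proof -
    have "\<bar>T k y\<bar> \<le> D y"
      unfolding T_def rat_step_abs[OF y] by (rule rat_step_bound) (rule dom[OF y])
    then have "\<bar>F y - T k y\<bar> \<le> 2 * D y" using dom[OF y order_refl] by linarith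
    then have "\<bar>F y - T k y\<bar>\<^sup>2 \<le> (2 * D y)\<^sup>2" by (intro power_mono) auto
    then show ?thesis by (simp add: power_mult_distrib)
  qed
  have "(\<lambda>k. \<integral>y. (F y - T k y)\<^sup>2 \<partial>?L) \<longlonglongrightarrow> (\<integral>y. 0 \<partial>?L)"
  proof (rule integral_dominated_convergence[where w="\<lambda>y. 4 * (D y)\<^sup>2"])
    show "integrable ?L (\<lambda>y. 4 * (D y)\<^sup>2)" using l2_funD(2)[OF D] by simp
    show "AE y in ?L. norm ((F y - T k y)\<^sup>2) \<le> 4 * (D y)\<^sup>2" for k
      using bound by (intro AE_I2) simp
    show "AE y in ?L. (\<lambda>k. (F y - T k y)\<^sup>2) \<longlonglongrightarrow> 0"
    proof (rule AE_I2)
      fix y assume "y \<in> space ?L"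
      then have y: "0 \<le> y" by simp
      have "(\<lambda>k. T k y) \<longlonglongrightarrow> F y"
        unfolding T_def rat_step_abs[OF y] by (rule rat_step_tendsto[OF rc[OF y]])
      from tendsto_power[OF tendsto_diff[OF tendsto_const this], of "F y" 2]
      show "(\<lambda>k. (F y - T k y)\<^sup>2) \<longlonglongrightarrow> 0" by simp
    qed
  qed measurable
  then show "(\<lambda>k. \<integral>y. (F y - (\<Sum>i<k. F \<bar>rat_seq i\<bar> * rat_step k i y))\<^sup>2 \<partial>?L) \<longlonglongrightarrow> 0"
    by (simp add: T_def)
  have "(\<integral>y. (F y - T k y)\<^sup>2 \<partial>?L) \<le> (\<integral>y. 4 * (D y)\<^sup>2 \<partial>?L)"
    using l2_funD(2)[OF l2_fun_diff[OF F T]] l2_funD(2)[OF D] bound by (intro integral_mono) auto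
  then show "(\<integral>y. (F y - (\<Sum>i<k. F \<bar>rat_seq i\<bar> * rat_step k i y))\<^sup>2 \<partial>?L) \<le> 4 * (\<integral>y. (D y)\<^sup>2 \<partial>?L)"
    by (simp add: T_def)
qed

text \<open>The step functions have finite rank with coefficients \<open>F \<omega> r\<close> at
  fixed points \<open>r\<close>, and they converge in norm for each \<open>\<omega>\<close>; so
  measurability at fixed points is enough.\<close>

lemma random_element_right_continuous:
  assumes a: "0 \<le> a" and F: "\<And>\<omega>. \<omega> \<in> space N \<Longrightarrow> F \<omega> \<in> l2_fun (exp_weight a)"
    and D: "\<And>\<omega>. \<omega> \<in> space N \<Longrightarrow> D \<omega> \<in> l2_fun (exp_weight a)"
    and rc: "\<And>\<omega> y. \<omega> \<in> space N \<Longrightarrow> 0 \<le> y \<Longrightarrow> (F \<omega> \<longlongrightarrow> F \<omega> y) (at_right y)"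
    and dom: "\<And>\<omega> y r. \<omega> \<in> space N \<Longrightarrow> 0 \<le> y \<Longrightarrow> y \<le> r \<Longrightarrow> \<bar>F \<omega> r\<bar> \<le> D \<omega> y"
    and m: "\<And>r. 0 \<le> r \<Longrightarrow> (\<lambda>\<omega>. F \<omega> r) \<in> borel_measurable N"
  shows "random_element (l2_topology (exp_weight a)) N (\<lambda>\<omega>. l2_class (exp_weight a) (F \<omega>))"
  unfolding l2_topology_def
proof (rule Metric_space.random_element_limit[OF Metric_space_L2])
  let ?L = "exp_weight a"
  show "random_element (Metric_space.mtopology (L2 ?L) (l2_dist ?L)) N
      (\<lambda>\<omega>. l2_class ?L (\<lambda>y. \<Sum>i<k. F \<omega> \<bar>rat_seq i\<bar> * rat_step k i y))" for k
    unfolding l2_topology_def[symmetric]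
    by (rule random_element_finite_rank(1)) (auto intro: rat_step_l2 a m)
  fix \<omega> assume \<omega>: "\<omega> \<in> space N"
  show "l2_class ?L (F \<omega>) \<in> L2 ?L" by (intro l2_class_in_L2 F \<omega>)
  have T: "(\<lambda>y. \<Sum>i<k. F \<omega> \<bar>rat_seq i\<bar> * rat_step k i y) \<in> l2_fun ?L" for k
    by (intro l2_fun_sum l2_fun_cmult rat_step_l2 a)
  have "(\<lambda>k. sqrt (\<integral>y. (F \<omega> y - (\<Sum>i<k. F \<omega> \<bar>rat_seq i\<bar> * rat_step k i y))\<^sup>2 \<partial>?L)) \<longlonglongrightarrow> sqrt 0"
    by (intro tendsto_real_sqrt rat_step_l2_tendsto(1)[OF a F[OF \<omega>] D[OF \<omega>]] rc dom \<omega>)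
  then show "(\<lambda>k. l2_dist ?L (l2_class ?L (\<lambda>y. \<Sum>i<k. F \<omega> \<bar>rat_seq i\<bar> * rat_step k i y)) (l2_class ?L (F \<omega>)))
      \<longlonglongrightarrow> 0"
    unfolding l2_dist_norm[OF T F[OF \<omega>]] l2_norm_commute[of ?L _ "F \<omega>"] by (simp add: l2_norm_def)
qed

text \<open>Dominated convergence in \<open>y\<close> for each \<open>x\<close>, then in
  \<open>x\<close> with the majorant \<open>4 * E x\<close>. The rate \<open>(1/4) ^ k\<close> is
  obtained by selecting the indices \<open>r k\<close>, not from any smoothness of
  \<open>h\<close>.\<close>

lemma rat_step_approximation:
  fixes h :: "'x \<Rightarrow> real \<Rightarrow> real"
  assumes a: "0 \<le> a"
    and h[measurable]: "(\<lambda>(x, y). h x y) \<in> borel_measurable (S \<Otimes>\<^sub>M exp_weight a)"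
    and hL: "\<And>x. x \<in> space S \<Longrightarrow> h x \<in> l2_fun (exp_weight a)"
    and hm: "\<And>r. 0 \<le> r \<Longrightarrow> (\<lambda>x. h x r) \<in> borel_measurable S"
    and D: "\<And>x. x \<in> space S \<Longrightarrow> D x \<in> l2_fun (exp_weight a)"
    and rc: "\<And>x y. x \<in> space S \<Longrightarrow> 0 \<le> y \<Longrightarrow> (h x \<longlongrightarrow> h x y) (at_right y)"
    and dom: "\<And>x y r. x \<in> space S \<Longrightarrow> 0 \<le> y \<Longrightarrow> y \<le> r \<Longrightarrow> \<bar>h x r\<bar> \<le> D x y"
    and E: "\<And>x. x \<in> space S \<Longrightarrow> (\<integral>y. (D x y)\<^sup>2 \<partial>exp_weight a) \<le> E x" "integrable S E"
  obtains r :: "nat \<Rightarrow> nat" where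
    "\<And>k. (\<integral>\<^sup>+x. ennreal (\<integral>y. (h x y - (\<Sum>i<r k. h x \<bar>rat_seq i\<bar> * rat_step (r k) i y))\<^sup>2 \<partial>exp_weight a) \<partial>S)
      \<le> ennreal ((1/4) ^ k)"
proof -
  let ?L = "exp_weight a"
  interpret L: sigma_finite_measure ?L by (rule sigma_finite_exp_weight)
  have [measurable]: "rat_step k i \<in> borel_measurable ?L" for k i
    by (rule l2_funD(1)[OF rat_step_l2[OF a]])
  have [measurable]: "(\<lambda>x. h x \<bar>rat_seq i\<bar>) \<in> borel_measurable S" for i by (rule hm) simp
  define u where "u k x = ennreal (\<integral>y. (h x y - (\<Sum>i<k. h x \<bar>rat_seq i\<bar> * rat_step k i y))\<^sup>2 \<partial>?L)" for k x
  have [measurable]: "u k \<in> borel_measurable S" for k unfolding u_def by measurable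
  have "(\<lambda>k. \<integral>\<^sup>+x. u k x \<partial>S) \<longlonglongrightarrow> (\<integral>\<^sup>+x. 0 \<partial>S)"
  proof (rule nn_integral_dominated_convergence[where w="\<lambda>x. ennreal (4 * E x)"])
    show "(\<lambda>x. ennreal (4 * E x)) \<in> borel_measurable S" using E(2) by measurable
    show "AE x in S. u k x \<le> ennreal (4 * E x)" for k
      unfolding u_def
      using order_trans[OF rat_step_l2_tendsto(2)[OF a hL D rc dom] mult_left_mono[OF E(1)]]
      by (intro AE_I2 ennreal_leI) simp
    have "(\<integral>\<^sup>+x. ennreal (4 * E x) \<partial>S) \<noteq> \<infinity>"
    proof -
      have "0 \<le> E x" if "x \<in> space S" for x using order_trans[OF _ E(1)[OF that]] by simp
      then show ?thesis using E(2) by (subst nn_integral_eq_integral) (auto intro!: AE_I2)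
    qed
    then show "(\<integral>\<^sup>+x. ennreal (4 * E x) \<partial>S) < \<infinity>" by (simp add: top.not_eq_extremum)
    show "AE x in S. (\<lambda>k. u k x) \<longlonglongrightarrow> 0"
    proof (rule AE_I2)
      fix x assume x: "x \<in> space S"
      have "(\<lambda>k. u k x) \<longlonglongrightarrow> ennreal 0"
        unfolding u_def by (intro tendsto_ennrealI rat_step_l2_tendsto(1)[OF a hL[OF x] D[OF x]] rc dom x)
      then show "(\<lambda>k. u k x) \<longlonglongrightarrow> 0" by simp
    qed
  qed measurable
  then have lim: "(\<lambda>k. \<integral>\<^sup>+x. u k x \<partial>S) \<longlonglongrightarrow> 0" by simp
  have "\<exists>n. (\<integral>\<^sup>+x. u n x \<partial>S) \<le> ennreal ((1/4) ^ k)" for k :: nat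
  proof -
    have "\<forall>\<^sub>F n in sequentially. (\<integral>\<^sup>+x. u n x \<partial>S) < ennreal ((1/4) ^ k)"
      by (rule order_tendstoD(2)[OF lim]) simp
    then show ?thesis by (auto dest!: eventually_happens intro: less_imp_le)
  qed
  then obtain r where "\<And>k. (\<integral>\<^sup>+x. u (r k) x \<partial>S) \<le> ennreal ((1/4) ^ k)" by metis
  then show ?thesis by (rule that[unfolded u_def[symmetric]])
qed

section \<open>The centred kernel of the statistic\<close>

lemma measurable_indicator_greaterThan [measurable]:
  "(\<lambda>(y, x). indicator {y<..} x :: real) \<in> borel_measurable (borel \<Otimes>\<^sub>M (borel :: real measure))"
proof -
  have "(\<lambda>(y, x). indicator {y<..} x :: real) = (\<lambda>p :: real \<times> real. if fst p < snd p then 1 else 0)"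
    by (auto simp: indicator_def fun_eq_iff)
  also have "\<dots> \<in> borel_measurable (borel \<Otimes>\<^sub>M borel)" by measurable
  finally show ?thesis .
qed

lemma indicator_greaterThan_mono: "y \<le> r \<Longrightarrow> indicator {r<..} x \<le> (indicator {y<..} x :: real)"
  for x y r :: real
  by (simp add: indicator_def)

text \<open>The strict inequality makes the indicator constant in \<open>r\<close> just to the right
  of \<open>y\<close>, also for \<open>y = x\<close>.\<close>

lemma indicator_greaterThan_tendsto:
  "((\<lambda>r. indicator {r<..} x :: real) \<longlongrightarrow> indicator {y<..} x) (at_right y)" for x y :: real
proof (rule tendsto_eventually)
  show "\<forall>\<^sub>F r in at_right y. indicator {r<..} x = (indicator {y<..} x :: real)"
  proof (cases "y < x")
    case True
    have "\<forall>\<^sub>F r in at_right y. r < x" using True by (auto simp: eventually_at_right_field)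
    then show ?thesis by eventually_elim (simp add: True)
  next
    case False
    have "\<forall>\<^sub>F r in at_right y. y < r" by (rule eventually_at_right_less)
    then show ?thesis by eventually_elim (use False in \<open>simp add: indicator_def\<close>)
  qed
qed

locale third_moment_law = prob_space S for S :: "real measure" +
  assumes sets_S [measurable_cong]: "sets S = sets borel"
    and third_moment: "integrable S (\<lambda>x. \<bar>x\<bar> ^ 3)"
    and mean: "(\<integral>x. x \<partial>S) = 1"
begin

lemma space_S [simp]: "space S = UNIV"
  using sets_eq_imp_space_eq[OF sets_S] by simp

text \<open>\<open>wt\<close> bounds \<open>|x - 1|\<close>, and also \<open>|x - 1 - y|\<close>
  whenever \<open>0 <= y < x\<close>. For the law \<open>S\<close> of X, \<open>tail\<close> is P(X
  > y), \<open>excess\<close> is the function z, \<open>P l\<close> is Psi of order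
  \<open>l\<close>, and \<open>zeta\<close> will be a common majorant of \<open>tail\<close> and, on
  the half-line, of the absolute value of \<open>excess\<close>.\<close>

definition wt :: "real \<Rightarrow> real" where "wt x = \<bar>x\<bar> + 1"
definition tail :: "real \<Rightarrow> real" where "tail y = (\<integral>x. indicator {y<..} x \<partial>S)"
definition zeta :: "real \<Rightarrow> real" where "zeta y = (\<integral>x. wt x * indicator {y<..} x \<partial>S)"
definition excess :: "real \<Rightarrow> real" where "excess y = (\<integral>x. (x - y - 1) * indicator {y<..} x \<partial>S)"
definition P :: "nat \<Rightarrow> real \<Rightarrow> real" where "P l y = (\<integral>x. (x - 1) ^ l * indicator {y<..} x \<partial>S)"

text \<open>The middle term is the first-order effect of the sample mean: \<open>1 - mean\<close>
  times the empirical tail, with the empirical tail replaced by \<open>tail y\<close>. Subtracting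
  \<open>excess y\<close> centres the first term.\<close>

definition h :: "real \<Rightarrow> real \<Rightarrow> real" where
  "h x y = (x - 1 - y) * indicator {y<..} x - (x - 1) * tail y - excess y"

text \<open>A bound for the three terms of \<open>h\<close> one by one. The bracketing is that of
  two applications of \<open>l2_norm_sq_add\<close>.\<close>

definition D :: "real \<Rightarrow> real \<Rightarrow> real" where
  "D x y = (wt x * indicator {y<..} x + wt x * tail y) + zeta y"

lemma wt_ge_1: "1 \<le> wt x" and wt_pos: "0 \<le> wt x"
  by (auto simp: wt_def)

lemma wt_measurable [measurable]: "wt \<in> borel_measurable borel"
  unfolding wt_def[abs_def] by measurable

text \<open>\<open>wt x\<close> is at most 2 for \<open>\<bar>x\<bar> \<le> 1\<close> and at most
  \<open>2 * \<bar>x\<bar>\<close> otherwise, so both functions stay below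
  \<open>4 + 4 * \<bar>x\<bar> ^ 3\<close>. This is where the third moment enters.\<close>

lemma integrable_wt_cubic: "integrable S (\<lambda>x. (wt x)\<^sup>2 * \<bar>x\<bar>)" and integrable_wt_sq: "integrable S (\<lambda>x. (wt x)\<^sup>2)"
proof -
  have i: "integrable S (\<lambda>x. 4 + 4 * \<bar>x\<bar> ^ 3)" using third_moment by simp
  have b: "(wt x)\<^sup>2 \<le> 4 + 4 * \<bar>x\<bar> ^ 3 \<and> (wt x)\<^sup>2 * \<bar>x\<bar> \<le> 4 + 4 * \<bar>x\<bar> ^ 3" for x
  proof (cases "\<bar>x\<bar> \<le> 1")
    case True
    then have "(wt x)\<^sup>2 \<le> 2\<^sup>2" unfolding wt_def by (intro power_mono) auto
    then have 4: "(wt x)\<^sup>2 \<le> 4" by simp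
    moreover have "(wt x)\<^sup>2 * \<bar>x\<bar> \<le> 4 * 1" using True 4 by (intro mult_mono) auto
    moreover have "0 \<le> \<bar>x\<bar> ^ 3" by simp
    ultimately show ?thesis by linarith
  next
    case False
    then have "(wt x)\<^sup>2 \<le> (2 * \<bar>x\<bar>)\<^sup>2" unfolding wt_def by (intro power_mono) auto
    then have 1: "(wt x)\<^sup>2 \<le> 4 * \<bar>x\<bar>\<^sup>2" by (simp add: power_mult_distrib)
    then have "(wt x)\<^sup>2 * \<bar>x\<bar> \<le> 4 * \<bar>x\<bar>\<^sup>2 * \<bar>x\<bar>" by (intro mult_right_mono) auto
    then have 2: "(wt x)\<^sup>2 * \<bar>x\<bar> \<le> 4 * \<bar>x\<bar> ^ 3" by (simp add: power3_eq_cube power2_eq_square mult.assoc)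
    have "(wt x)\<^sup>2 * 1 \<le> (wt x)\<^sup>2 * \<bar>x\<bar>" using False by (intro mult_left_mono) auto
    with 2 show ?thesis by linarith
  qed
  show "integrable S (\<lambda>x. (wt x)\<^sup>2 * \<bar>x\<bar>)"
    by (rule Bochner_Integration.integrable_bound[OF i]) (use b in \<open>auto intro!: AE_I2\<close>)
  show "integrable S (\<lambda>x. (wt x)\<^sup>2)"
    by (rule Bochner_Integration.integrable_bound[OF i]) (use b in \<open>auto intro!: AE_I2\<close>)
qed

lemma wt_l2: "wt \<in> l2_fun S"
  using integrable_wt_sq by (simp add: l2_fun_def)

lemma l2_wt_bound:
  assumes "f \<in> borel_measurable borel" "\<And>x. \<bar>f x\<bar> \<le> c * wt x"
  shows "f \<in> l2_fun S"
proof (rule l2_fun_bound[OF l2_fun_cmult[OF wt_l2, of c]])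
  show "f \<in> borel_measurable S" using assms(1) by measurable
qed (use assms(2) in simp)

lemma l2_imp_integrable: "f \<in> l2_fun S \<Longrightarrow> integrable S f"
  using square_integrable_imp_integrable by (auto simp: l2_fun_def)

lemma wt_indicator_l2: "(\<lambda>x. wt x * indicator {y<..} x) \<in> l2_fun S"
  by (rule l2_wt_bound[of _ 1]) (auto simp: indicator_def wt_pos abs_of_nonneg)

lemma indicator_l2: "(\<lambda>x. indicator {y<..} x) \<in> l2_fun S"
  by (rule l2_wt_bound[of _ 1]) (auto simp: indicator_def wt_def)

lemma centred_l2: "(\<lambda>x. x - 1) \<in> l2_fun S"
  by (rule l2_wt_bound[of _ 1]) (auto simp: wt_def)

lemma excess_l2: "(\<lambda>x. (x - 1 - y) * indicator {y<..} x) \<in> l2_fun S"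
proof (rule l2_wt_bound[of _ "1 + \<bar>y\<bar>"])
  fix x
  have "\<bar>(x - 1 - y) * indicator {y<..} x\<bar> \<le> \<bar>x\<bar> + 1 + \<bar>y\<bar>" by (auto simp: indicator_def)
  also have "\<dots> \<le> (1 + \<bar>y\<bar>) * wt x" by (simp add: wt_def algebra_simps)
  finally show "\<bar>(x - 1 - y) * indicator {y<..} x\<bar> \<le> (1 + \<bar>y\<bar>) * wt x" .
qed simp

lemma excess_pointwise: "0 \<le> r \<Longrightarrow> \<bar>(x - 1 - r) * indicator {r<..} x\<bar> \<le> wt x * indicator {r<..} x"
  by (auto simp: indicator_def wt_def)

lemma tail_nonneg: "0 \<le> tail y" and zeta_nonneg: "0 \<le> zeta y"
  unfolding tail_def zeta_def by (auto intro!: integral_nonneg_AE simp: wt_pos)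

lemma tail_mono: "y \<le> r \<Longrightarrow> tail r \<le> tail y"
  unfolding tail_def
  by (intro integral_mono l2_imp_integrable indicator_l2 indicator_greaterThan_mono)

lemma zeta_mono: "y \<le> r \<Longrightarrow> zeta r \<le> zeta y"
  unfolding zeta_def
  by (intro integral_mono l2_imp_integrable wt_indicator_l2 mult_left_mono indicator_greaterThan_mono wt_pos)

lemma tail_le_zeta: "tail y \<le> zeta y"
  unfolding tail_def zeta_def
  by (intro integral_mono l2_imp_integrable wt_indicator_l2 indicator_l2) (simp add: indicator_def wt_ge_1)

lemma excess_eq: "excess y = (\<integral>x. (x - 1 - y) * indicator {y<..} x \<partial>S)"
  unfolding excess_def by (simp add: algebra_simps)

lemma excess_le_zeta: "0 \<le> r \<Longrightarrow> \<bar>excess r\<bar> \<le> zeta r"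
  unfolding excess_eq zeta_def
  by (rule order_trans[OF integral_abs_bound])
    (intro integral_mono l2_imp_integrable wt_indicator_l2 integrable_abs excess_l2 excess_pointwise)

lemma indicator_measurable2 [measurable]:
  assumes "f \<in> borel_measurable N" "g \<in> borel_measurable N"
  shows "(\<lambda>z. indicator {f z<..} (g z :: real) :: real) \<in> borel_measurable N"
  using measurable_compose[OF measurable_Pair[OF assms] measurable_indicator_greaterThan] by simp

lemma tail_measurable [measurable]: "tail \<in> borel_measurable borel"
  unfolding tail_def[abs_def] by measurable

lemma zeta_measurable [measurable]: "zeta \<in> borel_measurable borel"
  unfolding zeta_def[abs_def] by measurable

lemma excess_measurable [measurable]: "excess \<in> borel_measurable borel"
  unfolding excess_def[abs_def] by measurable

lemma h_measurable [measurable]: "(\<lambda>(x, y). h x y) \<in> borel_measurable (borel \<Otimes>\<^sub>M borel)"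
  unfolding h_def by measurable

lemma h_measurable_exp_weight: "(\<lambda>(x, y). h x y) \<in> borel_measurable (S \<Otimes>\<^sub>M exp_weight a)"
proof -
  have "(\<lambda>p. (fst p, snd p)) \<in> measurable (S \<Otimes>\<^sub>M exp_weight a) (borel \<Otimes>\<^sub>M borel)"
    by (intro measurable_Pair measurable_compose[OF measurable_snd measurable_exp_weight_ident]) measurable
  from measurable_compose[OF this h_measurable] show ?thesis by simp
qed

text \<open>Jensen's inequality, as Cauchy-Schwarz against the constant 1 on a probability
  space.\<close>

lemma zeta_sq_le: "(zeta y)\<^sup>2 \<le> (\<integral>x. (wt x)\<^sup>2 * indicator {y<..} x \<partial>S)"
proof -
  have one: "(\<lambda>x. 1) \<in> l2_fun S" by (simp add: l2_fun_def)
  have "\<bar>zeta y\<bar> \<le> l2_norm S (\<lambda>x. wt x * indicator {y<..} x) * l2_norm S (\<lambda>x. 1)"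
    unfolding zeta_def using l2_Cauchy_Schwarz[OF wt_indicator_l2 one] by simp
  then have "\<bar>zeta y\<bar> \<le> l2_norm S (\<lambda>x. wt x * indicator {y<..} x)"
    by (simp add: l2_norm_def prob_space[simplified])
  then have "\<bar>zeta y\<bar>\<^sup>2 \<le> (l2_norm S (\<lambda>x. wt x * indicator {y<..} x))\<^sup>2" by (intro power_mono) auto
  also have "\<dots> = (\<integral>x. (wt x)\<^sup>2 * indicator {y<..} x \<partial>S)"
    unfolding l2_norm_sq
    by (intro Bochner_Integration.integral_cong) (auto simp: indicator_def)
  finally show ?thesis by simp
qed

text \<open>After \<open>zeta_sq_le\<close>, exchanging the integrals leaves for each
  \<open>x\<close> the mass of \<open>{..<x}\<close>, at most \<open>\<bar>x\<bar>\<close>; so the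
  bound is the integral in \<open>integrable_wt_cubic\<close>.\<close>

lemma zeta_l2:
  assumes a: "0 \<le> a"
  shows "zeta \<in> l2_fun (exp_weight a)"
proof -
  let ?L = "exp_weight a"
  interpret L: sigma_finite_measure ?L by (rule sigma_finite_exp_weight)
  interpret PL: pair_sigma_finite S ?L ..
  have m: "zeta \<in> borel_measurable ?L"
    by (rule measurable_compose[OF measurable_exp_weight_ident]) simp
  have "(\<lambda>p. (fst p, snd p)) \<in> measurable (S \<Otimes>\<^sub>M ?L) (borel \<Otimes>\<^sub>M borel)"
    by (intro measurable_Pair measurable_compose[OF measurable_snd measurable_exp_weight_ident]) measurable
  from measurable_compose[OF this, of "\<lambda>(x, y). ennreal ((wt x)\<^sup>2 * indicator {y<..} x)" borel]
  have m2: "(\<lambda>(x, y). ennreal ((wt x)\<^sup>2 * indicator {y<..} x)) \<in> borel_measurable (S \<Otimes>\<^sub>M ?L)" by simp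
  have int: "integrable S (\<lambda>x. (wt x)\<^sup>2 * indicator {y<..} x)" for y
    by (rule Bochner_Integration.integrable_bound[OF integrable_wt_sq]) (auto simp: indicator_def)
  have "(\<integral>\<^sup>+y. ennreal (norm ((zeta y)\<^sup>2)) \<partial>?L) \<le> (\<integral>\<^sup>+y. \<integral>\<^sup>+x. ennreal ((wt x)\<^sup>2 * indicator {y<..} x) \<partial>S \<partial>?L)"
  proof (rule nn_integral_mono)
    fix y
    have "ennreal (norm ((zeta y)\<^sup>2)) \<le> ennreal (\<integral>x. (wt x)\<^sup>2 * indicator {y<..} x \<partial>S)"
      using zeta_sq_le by (intro ennreal_leI) simp
    also have "\<dots> = (\<integral>\<^sup>+x. ennreal ((wt x)\<^sup>2 * indicator {y<..} x) \<partial>S)"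
      by (rule nn_integral_eq_integral[OF int, symmetric]) simp
    finally show "ennreal (norm ((zeta y)\<^sup>2)) \<le> (\<integral>\<^sup>+x. ennreal ((wt x)\<^sup>2 * indicator {y<..} x) \<partial>S)" .
  qed
  also have "\<dots> = (\<integral>\<^sup>+x. \<integral>\<^sup>+y. ennreal ((wt x)\<^sup>2 * indicator {y<..} x) \<partial>?L \<partial>S)"
    by (rule PL.Fubini'[OF m2])
  also have "\<dots> \<le> (\<integral>\<^sup>+x. ennreal ((wt x)\<^sup>2 * \<bar>x\<bar>) \<partial>S)"
  proof (rule nn_integral_mono)
    fix x :: real
    have sq: "(indicator {y<..} x)\<^sup>2 = (indicator {y<..} x :: real)" for y by (simp add: indicator_def)
    have i: "integrable ?L (\<lambda>y. indicator {y<..} x :: real)"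
      using l2_funD(2)[OF indicator_l2_fun(1)[OF a, of x]] by (simp add: sq)
    have "(\<integral>\<^sup>+y. ennreal ((wt x)\<^sup>2 * indicator {y<..} x) \<partial>?L) = ennreal (\<integral>y. (wt x)\<^sup>2 * indicator {y<..} x \<partial>?L)"
      by (rule nn_integral_eq_integral) (use i in auto)
    also have "\<dots> \<le> ennreal ((wt x)\<^sup>2 * \<bar>x\<bar>)"
      using indicator_l2_fun(2)[OF a, of x] by (intro ennreal_leI) (simp add: sq mult_left_mono)
    finally show "(\<integral>\<^sup>+y. ennreal ((wt x)\<^sup>2 * indicator {y<..} x) \<partial>?L) \<le> ennreal ((wt x)\<^sup>2 * \<bar>x\<bar>)" .
  qed
  also have "\<dots> < \<infinity>"
    using integrable_wt_cubic by (subst nn_integral_eq_integral) auto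
  finally have "integrable ?L (\<lambda>y. (zeta y)\<^sup>2)"
    using m by (intro integrableI_bounded) auto
  then show ?thesis using m by (simp add: l2_fun_def)
qed

lemma tail_l2: "0 \<le> a \<Longrightarrow> tail \<in> l2_fun (exp_weight a)"
  by (rule l2_fun_bound[OF zeta_l2])
    (auto simp: tail_nonneg tail_le_zeta intro: measurable_compose[OF measurable_exp_weight_ident])

lemma D_l2: "0 \<le> a \<Longrightarrow> D x \<in> l2_fun (exp_weight a)"
  unfolding D_def[abs_def]
  by (intro l2_fun_add l2_fun_cmult indicator_l2_fun(1) tail_l2 zeta_l2)

lemma h_dominated:
  assumes "0 \<le> y" "y \<le> r"
  shows "\<bar>h x r\<bar> \<le> D x y"
proof -
  have r: "0 \<le> r" using assms by simp
  have "\<bar>(x - 1 - r) * indicator {r<..} x\<bar> \<le> wt x * indicator {y<..} x"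
    using excess_pointwise[OF r, of x] mult_left_mono[OF indicator_greaterThan_mono[OF assms(2), of x] wt_pos[of x]] by linarith
  moreover have "\<bar>(x - 1) * tail r\<bar> \<le> wt x * tail y"
    unfolding abs_mult abs_of_nonneg[OF tail_nonneg]
    by (intro mult_mono tail_mono assms tail_nonneg wt_pos) (auto simp: wt_def)
  moreover have "\<bar>excess r\<bar> \<le> zeta y" using excess_le_zeta[OF r] zeta_mono[OF assms(2)] by linarith
  ultimately show ?thesis unfolding h_def D_def by linarith
qed

text \<open>The factors 2 stem from two uses of \<open>(u + v) ^ 2 <= 2 * u ^ 2 + 2 * v ^ 2\<close>,
  one for each sum in \<open>D\<close>. Only \<open>wt\<close> and \<open>\<bar>x\<bar>\<close>
  remain as functions of \<open>x\<close>, so integrability over \<open>S\<close> is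
  visible.\<close>

definition envelope :: "real \<Rightarrow> real \<Rightarrow> real" where
  "envelope a x = 2 * (2 * ((wt x)\<^sup>2 * \<bar>x\<bar>) + 2 * ((wt x)\<^sup>2 * (\<integral>y. (tail y)\<^sup>2 \<partial>exp_weight a)))
    + 2 * (\<integral>y. (zeta y)\<^sup>2 \<partial>exp_weight a)"

lemma envelope_integrable: "integrable S (envelope a)"
  unfolding envelope_def[abs_def] using integrable_wt_cubic integrable_wt_sq by simp

lemma D_envelope:
  assumes a: "0 \<le> a"
  shows "(\<integral>y. (D x y)\<^sup>2 \<partial>exp_weight a) \<le> envelope a x"
proof -
  let ?L = "exp_weight a"
  note l2 = l2_fun_cmult[OF indicator_l2_fun(1)[OF a, of x], of "wt x"] l2_fun_cmult[OF tail_l2[OF a], of "wt x"]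
  have "(\<integral>y. (D x y)\<^sup>2 \<partial>?L) \<le> 2 * (\<integral>y. (wt x * indicator {y<..} x + wt x * tail y)\<^sup>2 \<partial>?L) + 2 * (\<integral>y. (zeta y)\<^sup>2 \<partial>?L)"
    unfolding D_def by (intro l2_norm_sq_add l2_fun_add l2 zeta_l2 a)
  also have "(\<integral>y. (wt x * indicator {y<..} x + wt x * tail y)\<^sup>2 \<partial>?L)
      \<le> 2 * (\<integral>y. (wt x * indicator {y<..} x)\<^sup>2 \<partial>?L) + 2 * (\<integral>y. (wt x * tail y)\<^sup>2 \<partial>?L)"
    by (intro l2_norm_sq_add l2)
  also have "(\<integral>y. (wt x * indicator {y<..} x)\<^sup>2 \<partial>?L) \<le> (wt x)\<^sup>2 * \<bar>x\<bar>"
    using indicator_l2_fun(2)[OF a, of x] by (simp add: power_mult_distrib mult_left_mono)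
  finally show ?thesis by (simp add: envelope_def power_mult_distrib)
qed

lemma h_l2:
  assumes a: "0 \<le> a"
  shows "h x \<in> l2_fun (exp_weight a)"
proof (rule l2_fun_bound[OF D_l2[OF a]])
  show "h x \<in> borel_measurable (exp_weight a)"
    by (rule measurable_compose[OF measurable_exp_weight_ident]) measurable
  show "AE y in exp_weight a. \<bar>h x y\<bar> \<le> D x y"
    by (rule AE_I2) (simp add: h_dominated)
qed

lemma h_norm_envelope:
  assumes a: "0 \<le> a"
  shows "(l2_norm (exp_weight a) (h x))\<^sup>2 \<le> envelope a x"
proof -
  have "(\<integral>y. (h x y)\<^sup>2 \<partial>exp_weight a) \<le> (\<integral>y. (D x y)\<^sup>2 \<partial>exp_weight a)"
  proof (rule integral_mono[OF l2_funD(2)[OF h_l2[OF a]] l2_funD(2)[OF D_l2[OF a]]])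
    fix y assume "y \<in> space (exp_weight a)"
    then have "\<bar>h x y\<bar> \<le> D x y" by (simp add: h_dominated)
    then have "\<bar>h x y\<bar>\<^sup>2 \<le> (D x y)\<^sup>2" by (intro power_mono) auto
    then show "(h x y)\<^sup>2 \<le> (D x y)\<^sup>2" by simp
  qed
  with D_envelope[OF a, of x] show ?thesis by (simp add: l2_norm_sq)
qed

lemma h_l2_S: "(\<lambda>x. h x y) \<in> l2_fun S"
proof -
  have "(\<lambda>x. (x - 1 - y) * indicator {y<..} x - tail y * (x - 1) - excess y * 1) \<in> l2_fun S"
    by (intro l2_fun_diff excess_l2 l2_fun_cmult centred_l2) (simp add: l2_fun_def)
  then show ?thesis unfolding h_def by (simp add: mult.commute)
qed

lemma centred_mean: "(\<integral>x. x - 1 \<partial>S) = 0"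
proof -
  have "(\<lambda>x. x) \<in> l2_fun S" by (rule l2_wt_bound[of _ 1]) (auto simp: wt_def)
  then show ?thesis using l2_imp_integrable[of "\<lambda>x. x"] mean prob_space by simp
qed

lemma h_mean: "(\<integral>x. h x y \<partial>S) = 0"
proof -
  have i: "integrable S (\<lambda>x. (x - 1 - y) * indicator {y<..} x)" "integrable S (\<lambda>x. (x - 1) * tail y)"
    using l2_imp_integrable[OF excess_l2] integrable_mult_left[OF l2_imp_integrable[OF centred_l2]] by auto
  have "(\<integral>x. h x y \<partial>S)
      = (\<integral>x. (x - 1 - y) * indicator {y<..} x \<partial>S) - (\<integral>x. (x - 1) * tail y \<partial>S) - (\<integral>x. excess y \<partial>S)"
    unfolding h_def using i by (subst Bochner_Integration.integral_diff) (auto intro: Bochner_Integration.integral_diff)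
  also have "(\<integral>x. (x - 1) * tail y \<partial>S) = 0"
    using centred_mean integral_mult_left_zero[of S "\<lambda>x. x - 1" "tail y"] by simp
  finally show ?thesis using prob_space by (simp add: excess_eq)
qed

text \<open>Dominated convergence along sequences that approach \<open>y\<close> from the right, so
  the bound is asked for \<open>y \<le> r\<close> only.\<close>

lemma integral_right_continuous:
  fixes g :: "real \<Rightarrow> real \<Rightarrow> real"
  assumes [measurable]: "\<And>r. g r \<in> borel_measurable borel"
    and lim: "\<And>x. ((\<lambda>r. g r x) \<longlongrightarrow> g y x) (at_right y)"
    and bound: "\<And>r x. y \<le> r \<Longrightarrow> \<bar>g r x\<bar> \<le> wt x"
  shows "((\<lambda>r. \<integral>x. g r x \<partial>S) \<longlongrightarrow> (\<integral>x. g y x \<partial>S)) (at_right y)"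
  unfolding tendsto_at_iff_sequentially
proof (intro allI impI)
  fix X assume X: "\<forall>i. X i \<in> {y<..} - {y}" "X \<longlonglongrightarrow> y"
  show "((\<lambda>r. \<integral>x. g r x \<partial>S) \<circ> X) \<longlonglongrightarrow> (\<integral>x. g y x \<partial>S)"
    unfolding comp_def
  proof (rule integral_dominated_convergence[where w=wt])
    show "integrable S wt" by (rule l2_imp_integrable[OF wt_l2])
    show "AE x in S. (\<lambda>i. g (X i) x) \<longlonglongrightarrow> g y x"
      using lim X unfolding tendsto_at_iff_sequentially comp_def by (intro AE_I2) blast
    show "AE x in S. norm (g (X i) x) \<le> wt x" for i
      using bound[of "X i"] X(1) by (intro AE_I2) (simp add: less_imp_le)
  qed measurable
qed

lemma tail_right_continuous: "(tail \<longlongrightarrow> tail y) (at_right y)"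
  unfolding tail_def[abs_def]
  by (rule integral_right_continuous) (auto simp: indicator_greaterThan_tendsto, auto simp: indicator_def wt_def)

lemma excess_right_continuous: "0 \<le> y \<Longrightarrow> (excess \<longlongrightarrow> excess y) (at_right y)"
  unfolding excess_def[abs_def]
proof (rule integral_right_continuous)
  show "((\<lambda>r. (x - r - 1) * indicator {r<..} x) \<longlongrightarrow> (x - y - 1) * indicator {y<..} x) (at_right y)" for x
    by (intro tendsto_intros indicator_greaterThan_tendsto)
  show "\<bar>(x - r - 1) * indicator {r<..} x\<bar> \<le> wt x" if "0 \<le> y" "y \<le> r" for x r
    using that by (auto simp: indicator_def wt_def)
qed measurable

lemma h_right_continuous: "0 \<le> y \<Longrightarrow> (h x \<longlongrightarrow> h x y) (at_right y)"
  unfolding h_def[abs_def]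
  by (intro tendsto_intros indicator_greaterThan_tendsto tail_right_continuous excess_right_continuous)

text \<open>With \<open>A s x = (x - 1 - s) 1{x > s}\<close> and \<open>c x = x - 1\<close>, the
  product of two indicators is the one at \<open>max s t\<close>, which yields the first three
  terms; the products of \<open>A\<close> with \<open>c\<close> yield the differences of
  \<open>P 2\<close> and \<open>P 1\<close>. As \<open>c\<close> has mean 0, its products with
  constants drop out, and the products of \<open>excess\<close> add up with coefficient
  \<open>-2 + 1 = -1\<close>.\<close>

lemma h_kernel:
  "(\<integral>x. h x s * h x t \<partial>S) = P 2 (max s t) + s * t * tail (max s t) - (s + t) * P 1 (max s t)
    - tail s * (P 2 t - t * P 1 t) - tail t * (P 2 s - s * P 1 s)
    + (\<integral>x. (x - 1)\<^sup>2 \<partial>S) * tail s * tail t - excess s * excess t"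
proof -
  define A where "A s x = (x - 1 - s) * indicator {s<..} x" for s x :: real
  define c where "c x = x - 1" for x :: real
  have A: "A s \<in> l2_fun S" for s unfolding A_def[abs_def] by (rule excess_l2)
  have c: "c \<in> l2_fun S" unfolding c_def[abs_def] by (rule centred_l2)
  have one: "(\<lambda>x. 1) \<in> l2_fun S" by (simp add: l2_fun_def)
  have ci: "(\<lambda>x. c x * indicator {r<..} x) \<in> l2_fun S" for r
    by (rule l2_wt_bound[of _ 1]) (auto simp: c_def wt_def indicator_def)
  have P1: "integrable S (\<lambda>x. c x * indicator {r<..} x)" "(\<integral>x. c x * indicator {r<..} x \<partial>S) = P 1 r" for r
    using l2_imp_integrable[OF ci] by (auto simp: P_def c_def)
  have P2: "integrable S (\<lambda>x. c x * (c x * indicator {r<..} x))" "(\<integral>x. c x * (c x * indicator {r<..} x) \<partial>S) = P 2 r" for r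
    using l2_fun_mult[OF c ci] by (auto simp: P_def c_def power2_eq_square mult.assoc)
  have T: "integrable S (\<lambda>x. indicator {r<..} x :: real)" "(\<integral>x. indicator {r<..} x \<partial>S) = tail r" for r
    using l2_imp_integrable[OF indicator_l2] by (auto simp: tail_def)
  have "A s x * A t x = c x * (c x * indicator {max s t<..} x) - (s + t) * (c x * indicator {max s t<..} x)
      + s * t * indicator {max s t<..} x" for x
    by (auto simp: A_def c_def indicator_def algebra_simps max_def)
  then have AA: "(\<integral>x. A s x * A t x \<partial>S) = P 2 (max s t) - (s + t) * P 1 (max s t) + s * t * tail (max s t)"
    using P1 P2 T by simp
  have "A r x * c x = c x * (c x * indicator {r<..} x) - r * (c x * indicator {r<..} x)" for x r
    by (auto simp: A_def c_def indicator_def algebra_simps)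
  then have Ac: "(\<integral>x. A r x * c x \<partial>S) = P 2 r - r * P 1 r" for r
    using P1 P2 by simp
  have A1: "(\<integral>x. A r x \<partial>S) = excess r" for r by (simp add: A_def excess_eq)
  have c1: "(\<integral>x. c x \<partial>S) = 0" using centred_mean by (simp add: c_def)
  have cc: "(\<integral>x. c x * c x \<partial>S) = (\<integral>x. (x - 1)\<^sup>2 \<partial>S)" by (simp add: c_def power2_eq_square)
  have h: "h x r = A r x - tail r * c x - excess r" for x r by (simp add: h_def A_def c_def mult.commute)
  have "h x s * h x t = A s x * A t x - tail t * (A s x * c x) - tail s * (A t x * c x)
      + tail s * tail t * (c x * c x) - excess t * A s x - excess s * A t x
      + (tail s * excess t + tail t * excess s) * c x + excess s * excess t" for x
    unfolding h by (simp add: algebra_simps)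
  then have "(\<integral>x. h x s * h x t \<partial>S) = (\<integral>x. A s x * A t x \<partial>S) - tail t * (\<integral>x. A s x * c x \<partial>S)
      - tail s * (\<integral>x. A t x * c x \<partial>S) + tail s * tail t * (\<integral>x. c x * c x \<partial>S)
      - excess t * (\<integral>x. A s x \<partial>S) - excess s * (\<integral>x. A t x \<partial>S)
      + (tail s * excess t + tail t * excess s) * (\<integral>x. c x \<partial>S) + excess s * excess t"
    using l2_fun_mult[OF A A] l2_fun_mult[OF A c] l2_fun_mult[OF c c] l2_imp_integrable[OF A] l2_imp_integrable[OF c] prob_space
    by simp
  then show ?thesis unfolding AA Ac A1 c1 cc by (simp add: algebra_simps)
qed

lemma inner_h_bound:
  assumes a: "0 \<le> a" and f: "f \<in> l2_fun (exp_weight a)"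
  shows "\<bar>\<integral>y. h x y * f y \<partial>exp_weight a\<bar> \<le> l2_norm (exp_weight a) (h x) * l2_norm (exp_weight a) f"
  by (rule l2_Cauchy_Schwarz[OF h_l2[OF a] f])

lemma inner_h_l2:
  assumes a: "0 \<le> a" and f: "f \<in> l2_fun (exp_weight a)"
  shows "(\<lambda>x. \<integral>y. h x y * f y \<partial>exp_weight a) \<in> l2_fun S"
proof -
  let ?L = "exp_weight a"
  interpret L: sigma_finite_measure ?L by (rule sigma_finite_exp_weight)
  note [measurable] = h_measurable_exp_weight[of a] l2_funD(1)[OF f]
  have m: "(\<lambda>x. \<integral>y. h x y * f y \<partial>?L) \<in> borel_measurable S" by measurable
  have "integrable S (\<lambda>x. (\<integral>y. h x y * f y \<partial>?L)\<^sup>2)"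
  proof (rule Bochner_Integration.integrable_bound)
    show "integrable S (\<lambda>x. envelope a x * (l2_norm ?L f)\<^sup>2)" using envelope_integrable by simp
    show "(\<lambda>x. (\<integral>y. h x y * f y \<partial>?L)\<^sup>2) \<in> borel_measurable S" using m by measurable
    show "AE x in S. norm ((\<integral>y. h x y * f y \<partial>?L)\<^sup>2) \<le> norm (envelope a x * (l2_norm ?L f)\<^sup>2)"
    proof (rule AE_I2)
      fix x
      have "\<bar>\<integral>y. h x y * f y \<partial>?L\<bar>\<^sup>2 \<le> (l2_norm ?L (h x) * l2_norm ?L f)\<^sup>2"
        by (intro power_mono inner_h_bound a f) simp
      also have "\<dots> \<le> envelope a x * (l2_norm ?L f)\<^sup>2"
        unfolding power_mult_distrib by (intro mult_right_mono h_norm_envelope a) simp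
      finally show "norm ((\<integral>y. h x y * f y \<partial>?L)\<^sup>2) \<le> norm (envelope a x * (l2_norm ?L f)\<^sup>2)" by simp
    qed
  qed
  with m show ?thesis by (simp add: l2_fun_def)
qed

text \<open>\<open>K s t\<close> is a mean of products, so \<open>product_kernel_Fubini\<close>
  applies over Lebesgue measure; its finiteness condition follows from Cauchy-Schwarz and the
  integrability of \<open>envelope\<close>.\<close>

lemma covariance_kernel:
  assumes a: "0 \<le> a" and f: "f \<in> l2_fun (exp_weight a)" and g: "g \<in> l2_fun (exp_weight a)"
    and K: "\<And>s t. K s t = (\<integral>x. h x s * h x t \<partial>S)"
  shows "set_integrable (lborel \<Otimes>\<^sub>M lborel) ({0..} \<times> {0..}) (\<lambda>(s, t). K s t * f s * g t * exp (- a * (s + t)))"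
    and "(LINT t:{0..}|lborel. (LINT s:{0..}|lborel. K s t * f s * g t * exp (- a * (s + t))))
      = (\<integral>x. (\<integral>y. h x y * f y \<partial>exp_weight a) * (\<integral>y. h x y * g y \<partial>exp_weight a) \<partial>S)"
proof -
  let ?L = "exp_weight a"
  \<comment> \<open>Indicator and weight are absorbed into the function, so that integrals over
    \<open>exp_weight a\<close> become integrals over the whole line.\<close>
  define u where "u f x s = indicator {0..} s * (exp (- a * s) * (h x s * f s))" for f :: "real \<Rightarrow> real" and x s
  have hf: "(\<lambda>y. h x y * f y) \<in> borel_measurable ?L" if "f \<in> l2_fun ?L" for f x
    using l2_funD(1)[OF h_l2[OF a, of x]] l2_funD(1)[OF that] by simp
  have u_int: "integrable lborel (u f x)" if f: "f \<in> l2_fun ?L" for f x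
    using l2_fun_mult[OF h_l2[OF a, of x] f] integrable_exp_weight(1)[OF hf[OF f], of x] by (simp add: u_def[abs_def])
  have u_integral: "(\<integral>s. u f x s \<partial>lborel) = (\<integral>y. h x y * f y \<partial>?L)" if f: "f \<in> l2_fun ?L" for f x
    using integrable_exp_weight(2)[OF hf[OF f], of x] by (simp add: u_def)
  have u_abs: "0 \<le> (\<integral>s. \<bar>u f x s\<bar> \<partial>lborel)" "(\<integral>s. \<bar>u f x s\<bar> \<partial>lborel) \<le> l2_norm ?L (h x) * l2_norm ?L f"
    if f: "f \<in> l2_fun ?L" for f x
  proof -
    have abs_l2: "(\<lambda>y. \<bar>k y\<bar>) \<in> l2_fun ?L" if "k \<in> l2_fun ?L" for k :: "real \<Rightarrow> real"
      using that by (auto simp: l2_fun_def)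
    have m: "(\<lambda>y. \<bar>h x y\<bar> * \<bar>f y\<bar>) \<in> borel_measurable ?L"
      using l2_funD(1)[OF h_l2[OF a, of x]] l2_funD(1)[OF f] by simp
    have "\<bar>u f x s\<bar> = indicator {0..} s * (exp (- a * s) * (\<bar>h x s\<bar> * \<bar>f s\<bar>))" for s
      by (simp add: u_def abs_mult)
    then have "(\<integral>s. \<bar>u f x s\<bar> \<partial>lborel) = (\<integral>y. \<bar>h x y\<bar> * \<bar>f y\<bar> \<partial>?L)"
      using integrable_exp_weight(2)[OF m] by simp
    also have "\<dots> \<le> \<bar>\<integral>y. \<bar>h x y\<bar> * \<bar>f y\<bar> \<partial>?L\<bar>" by simp
    also have "\<dots> \<le> l2_norm ?L (\<lambda>y. \<bar>h x y\<bar>) * l2_norm ?L (\<lambda>y. \<bar>f y\<bar>)"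
      by (intro l2_Cauchy_Schwarz abs_l2 h_l2 a f)
    finally show "(\<integral>s. \<bar>u f x s\<bar> \<partial>lborel) \<le> l2_norm ?L (h x) * l2_norm ?L f" by (simp add: l2_norm_def)
  qed simp
  have u_meas: "(\<lambda>(x, s). u f x s) \<in> borel_measurable (S \<Otimes>\<^sub>M lborel)" if f: "f \<in> l2_fun ?L" for f
  proof -
    have [measurable]: "(\<lambda>y. indicator {0..} y * f y) \<in> borel_measurable borel"
      using l2_funD(1)[OF f] by (simp add: borel_measurable_exp_weight_iff)
    have "(\<lambda>(x, s). u f x s) = (\<lambda>(x, s). exp (- a * s) * h x s * (indicator {0..} s * f s))"
      by (simp add: u_def fun_eq_iff)
    also have "\<dots> \<in> borel_measurable (S \<Otimes>\<^sub>M lborel)" by measurable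
    finally show ?thesis .
  qed
  have fin: "(\<integral>\<^sup>+x. ennreal ((\<integral>s. \<bar>u f x s\<bar> \<partial>lborel) * (\<integral>t. \<bar>u g x t\<bar> \<partial>lborel)) \<partial>S) < \<infinity>"
  proof -
    have "(\<integral>\<^sup>+x. ennreal ((\<integral>s. \<bar>u f x s\<bar> \<partial>lborel) * (\<integral>t. \<bar>u g x t\<bar> \<partial>lborel)) \<partial>S)
        \<le> (\<integral>\<^sup>+x. ennreal (envelope a x * (l2_norm ?L f * l2_norm ?L g)) \<partial>S)"
    proof (intro nn_integral_mono ennreal_leI)
      fix x
      have "(\<integral>s. \<bar>u f x s\<bar> \<partial>lborel) * (\<integral>t. \<bar>u g x t\<bar> \<partial>lborel)
          \<le> (l2_norm ?L (h x) * l2_norm ?L f) * (l2_norm ?L (h x) * l2_norm ?L g)"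
        by (intro mult_mono u_abs f g) auto
      also have "\<dots> = (l2_norm ?L (h x))\<^sup>2 * (l2_norm ?L f * l2_norm ?L g)" by (simp add: power2_eq_square)
      also have "\<dots> \<le> envelope a x * (l2_norm ?L f * l2_norm ?L g)"
        by (intro mult_right_mono h_norm_envelope a) simp
      finally show "(\<integral>s. \<bar>u f x s\<bar> \<partial>lborel) * (\<integral>t. \<bar>u g x t\<bar> \<partial>lborel)
          \<le> envelope a x * (l2_norm ?L f * l2_norm ?L g)" .
    qed
    also have "\<dots> < \<infinity>"
    proof -
      have e: "0 \<le> envelope a x" for x using order_trans[OF zero_le_power2 h_norm_envelope[OF a]] .
      have "integrable S (\<lambda>x. envelope a x * (l2_norm ?L f * l2_norm ?L g))" using envelope_integrable by simp
      then show ?thesis using e by (subst nn_integral_eq_integral) auto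
    qed
    finally show ?thesis .
  qed
  note F = product_kernel_Fubini[OF sigma_finite_measure_axioms sigma_finite_lborel u_meas[OF f] u_meas[OF g]
      u_int[OF f] u_int[OF g] fin]
  have k: "(\<integral>x. u f x s * u g x t \<partial>S)
      = indicator {0..} t * (indicator {0..} s * (K s t * f s * g t * exp (- a * (s + t))))" for s t
  proof -
    have "u f x s * u g x t
        = (indicator {0..} t * (indicator {0..} s * (f s * g t * exp (- a * (s + t))))) * (h x s * h x t)" for x
    proof -
      have "exp (- a * (s + t)) = exp (- a * s) * exp (- a * t)"
        by (simp add: exp_add[symmetric] algebra_simps)
      then show ?thesis by (simp only: u_def mult_ac)
    qed
    then show ?thesis by (simp add: K)
  qed
  show "set_integrable (lborel \<Otimes>\<^sub>M lborel) ({0..} \<times> {0..}) (\<lambda>(s, t). K s t * f s * g t * exp (- a * (s + t)))"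
    using F(1) unfolding k set_integrable_def by (simp add: split_beta' indicator_times mult_ac)
  show "(LINT t:{0..}|lborel. (LINT s:{0..}|lborel. K s t * f s * g t * exp (- a * (s + t))))
      = (\<integral>x. (\<integral>y. h x y * f y \<partial>?L) * (\<integral>y. h x y * g y \<partial>?L) \<partial>S)"
    using F(2) unfolding k u_integral[OF f] u_integral[OF g] set_lebesgue_integral_def by simp
qed

end

section \<open>Reindexing, canonical probability space, and proof of the theorem\<close>

text \<open>Needed because the sample is numbered from 1 and \<open>iid_sequence\<close> from 0.
  Injectivity lets a family of events over \<open>J\<close> be moved to the image of
  \<open>J\<close>, where independence is known.\<close>

lemma (in prob_space) indep_vars_reindex:
  assumes f: "inj_on f I" and X: "indep_vars M' X (f ` I)"
  shows "indep_vars (\<lambda>i. M' (f i)) (\<lambda>i. X (f i)) I"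
proof -
  have *: "indep_sets (\<lambda>i. F (f i)) I" if F: "indep_sets F (f ` I)" for F
    unfolding indep_sets_def
  proof (intro conjI ballI allI impI)
    show "F (f i) \<subseteq> events" if "i \<in> I" for i using F that by (auto simp: indep_sets_def)
    fix J A assume J: "J \<subseteq> I" "J \<noteq> {}" "finite J" and A: "A \<in> (\<Pi> j\<in>J. F (f j))"
    have inj: "inj_on f J" using f J(1) by (rule inj_on_subset)
    define A' where "A' k = A (the_inv_into J f k)" for k
    have A': "A' (f j) = A j" if "j \<in> J" for j using that by (simp add: A'_def the_inv_into_f_f[OF inj])
    have "A' \<in> Pi (f ` J) F" using A A' by auto
    moreover have "f ` J \<subseteq> f ` I" "f ` J \<noteq> {}" "finite (f ` J)" using J by auto
    ultimately have "prob (\<Inter>k\<in>f ` J. A' k) = (\<Prod>k\<in>f ` J. prob (A' k))"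
      using F unfolding indep_sets_def by blast
    also have "\<dots> = (\<Prod>j\<in>J. prob (A' (f j)))" by (rule prod.reindex_cong[OF inj]) auto
    finally show "prob (\<Inter>j\<in>J. A j) = (\<Prod>j\<in>J. prob (A j))" by (simp add: A')
  qed
  show ?thesis
    using X *[of "\<lambda>i. {X i -` A \<inter> space M |A. A \<in> sets (M' i)}"] by (simp add: indep_vars_def2)
qed

text \<open>All these properties depend on \<open>W\<close> through its law only, so
  \<open>W\<close> may be replaced by the identity on the space of classes under that law. This
  produces the type of probability space that the theorem prescribes.\<close>

lemma canonical_random_element:
  fixes W :: "'c \<Rightarrow> (real \<Rightarrow> real) set"
  assumes N: "prob_space N" and W: "random_element (l2_topology (exp_weight a)) N W"
  defines "N' \<equiv> distr N (borel_of (l2_topology (exp_weight a))) W"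
  shows "prob_space N'"
    and "centred_gaussian_element (exp_weight a) N W \<Longrightarrow> centred_gaussian_element (exp_weight a) N' (\<lambda>F. F)"
    and "has_covariance_kernel a N W K \<Longrightarrow> has_covariance_kernel a N' (\<lambda>F. F) K"
    and "converges_in_distribution (l2_topology (exp_weight a)) M X N W
      \<Longrightarrow> converges_in_distribution (l2_topology (exp_weight a)) M X N' (\<lambda>F. F)"
proof -
  let ?L = "exp_weight a" and ?T = "l2_topology (exp_weight a)"
  have Wm: "W \<in> measurable N (borel_of ?T)" using W by (simp add: random_element_def)
  have idm: "random_element ?T (borel_of ?T) (\<lambda>F. F)" by (simp add: random_element_def)
  have id': "random_element ?T N' (\<lambda>F. F)" by (simp add: random_element_def N'_def)
  have inner: "(\<lambda>G. l2_inner ?L G F) \<in> borel_measurable (borel_of ?T)" if "F \<in> L2 ?L" for F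
    by (rule l2_inner_measurable[OF idm that])
  show "prob_space N'" unfolding N'_def by (rule prob_space.prob_space_distr[OF N Wm])
  show "centred_gaussian_element ?L N' (\<lambda>F. F)" if g: "centred_gaussian_element ?L N W"
    unfolding centred_gaussian_element_def
  proof (intro conjI ballI id')
    fix F assume F: "F \<in> L2 ?L"
    have "distr N' borel (\<lambda>G. l2_inner ?L G F) = distr N borel (\<lambda>\<omega>. l2_inner ?L (W \<omega>) F)"
      unfolding N'_def by (subst distr_distr[OF inner[OF F] Wm]) (simp add: comp_def)
    then show "normal_law (distr N' borel (\<lambda>G. l2_inner ?L G F))"
      using g F by (simp add: centred_gaussian_element_def)
    show "(\<integral>G. l2_inner ?L G F \<partial>N') = 0"
      unfolding N'_def using g F by (subst integral_distr[OF Wm inner[OF F]]) (simp add: centred_gaussian_element_def)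
  qed
  show "has_covariance_kernel a N' (\<lambda>F. F) K" if c: "has_covariance_kernel a N W K"
    unfolding has_covariance_kernel_def Let_def
  proof (intro ballI)
    fix f g assume f: "f \<in> l2_fun ?L" and g: "g \<in> l2_fun ?L"
    let ?I = "\<lambda>G. l2_inner ?L G (l2_class ?L f) * l2_inner ?L G (l2_class ?L g)"
    have I: "?I \<in> borel_measurable (borel_of ?T)"
      by (intro borel_measurable_times inner l2_class_in_L2 f g)
    have "integrable N' ?I \<longleftrightarrow> integrable N (\<lambda>\<omega>. ?I (W \<omega>))"
      unfolding N'_def by (rule integrable_distr_eq[OF Wm I])
    moreover have "integral\<^sup>L N' ?I = (\<integral>\<omega>. ?I (W \<omega>) \<partial>N)"
      unfolding N'_def by (rule integral_distr[OF Wm I])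
    ultimately show "integrable N' ?I \<and>
        set_integrable (lborel \<Otimes>\<^sub>M lborel) ({0..} \<times> {0..}) (\<lambda>(s, t). K s t * f s * g t * exp (- a * (s + t))) \<and>
        integral\<^sup>L N' ?I = (LINT t:{0..}|lborel. (LINT s:{0..}|lborel. K s t * f s * g t * exp (- a * (s + t))))"
      using c f g by (simp add: has_covariance_kernel_def Let_def)
  qed
  show "converges_in_distribution ?T M X N' (\<lambda>F. F)" if c: "converges_in_distribution ?T M X N W"
  proof -
    have "(\<integral>F. \<phi> F \<partial>N') = (\<integral>\<omega>. \<phi> (W \<omega>) \<partial>N)" if "continuous_map ?T euclideanreal \<phi>" for \<phi>
      unfolding N'_def by (rule integral_distr[OF Wm random_element_continuous_map[OF idm that]])
    then show ?thesis using c id' by (simp add: converges_in_distribution_def)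
  qed
qed

text \<open>Polarization: the second moments are known for every element and inner products are
  additive, so the squares for \<open>f\<close>, \<open>g\<close> and \<open>f + g\<close> determine
  the mixed moment. The sum is formed on functions and only then passed to its class.\<close>

lemma centred_gaussian_covariance:
  assumes W: "random_element (l2_topology L) N W"
    and l2: "\<And>F. F \<in> L2 L \<Longrightarrow> (\<lambda>\<omega>. l2_inner L (W \<omega>) F) \<in> l2_fun N"
    and var: "\<And>F. F \<in> L2 L \<Longrightarrow> (\<integral>\<omega>. (l2_inner L (W \<omega>) F)\<^sup>2 \<partial>N) = (\<integral>x. (\<integral>y. h x y * l2_rep F y \<partial>L)\<^sup>2 \<partial>S)"
    and h: "\<And>x. x \<in> space S \<Longrightarrow> h x \<in> l2_fun L"
    and p: "\<And>f. f \<in> l2_fun L \<Longrightarrow> (\<lambda>x. \<integral>y. h x y * f y \<partial>L) \<in> l2_fun S"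
    and f: "f \<in> l2_fun L" and g: "g \<in> l2_fun L"
  shows "(\<integral>\<omega>. l2_inner L (W \<omega>) (l2_class L f) * l2_inner L (W \<omega>) (l2_class L g) \<partial>N)
      = (\<integral>x. (\<integral>y. h x y * f y \<partial>L) * (\<integral>y. h x y * g y \<partial>L) \<partial>S)"
proof -
  define I where "I f \<omega> = l2_inner L (W \<omega>) (l2_class L f)" for f \<omega>
  define q where "q f x = (\<integral>y. h x y * f y \<partial>L)" for f x
  have fg: "(\<lambda>y. f y + g y) \<in> l2_fun L" by (rule l2_fun_add[OF f g])
  have I: "I k \<in> l2_fun N" if "k \<in> l2_fun L" for k
    unfolding I_def[abs_def] by (rule l2[OF l2_class_in_L2[OF that]])
  have q: "q k \<in> l2_fun S" if "k \<in> l2_fun L" for k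
    unfolding q_def[abs_def] by (rule p[OF that])
  have Iq: "(\<integral>\<omega>. (I k \<omega>)\<^sup>2 \<partial>N) = (\<integral>x. (q k x)\<^sup>2 \<partial>S)" if k: "k \<in> l2_fun L" for k
  proof -
    have "(\<integral>y. h x y * l2_rep (l2_class L k) y \<partial>L) = q k x" if x: "x \<in> space S" for x
      unfolding q_def
    proof (rule integral_cong_AE)
      show "AE y in L. h x y * l2_rep (l2_class L k) y = h x y * k y"
        using l2_rep_class[OF k] by eventually_elim simp
    qed (use l2_funD(1)[OF h[OF x]] l2_funD(1)[OF k] l2_funD(1)[OF l2_rep(1)[OF l2_class_in_L2[OF k]]] in auto)
    then show ?thesis
      unfolding I_def var[OF l2_class_in_L2[OF k]] by (intro Bochner_Integration.integral_cong) auto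
  qed
  have I_add: "I (\<lambda>y. f y + g y) \<omega> = I f \<omega> + I g \<omega>" if \<omega>: "\<omega> \<in> space N" for \<omega>
  proof -
    have WL: "W \<omega> \<in> L2 L" using random_elementD(1)[OF W \<omega>] by (simp add: topspace_l2)
    have "I k \<omega> = (\<integral>y. l2_rep (W \<omega>) y * k y \<partial>L)" if "k \<in> l2_fun L" for k
      unfolding I_def using l2_inner_class[OF l2_rep(1)[OF WL] that] l2_rep(2)[OF WL] by simp
    then show ?thesis
      using f g fg l2_fun_mult[OF l2_rep(1)[OF WL] f] l2_fun_mult[OF l2_rep(1)[OF WL] g]
      by (simp add: distrib_left)
  qed
  have q_add: "q (\<lambda>y. f y + g y) x = q f x + q g x" if x: "x \<in> space S" for x
    unfolding q_def using l2_fun_mult[OF h[OF x] f] l2_fun_mult[OF h[OF x] g] by (simp add: distrib_left)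
  have pol: "(\<integral>x. (u x + w x)\<^sup>2 \<partial>Q) = (\<integral>x. (u x)\<^sup>2 \<partial>Q) + (\<integral>x. (w x)\<^sup>2 \<partial>Q) + 2 * (\<integral>x. u x * w x \<partial>Q)"
    if "u \<in> l2_fun Q" "w \<in> l2_fun Q" for u w and Q :: "'z measure"
    using l2_funD(2)[OF that(1)] l2_funD(2)[OF that(2)] l2_fun_mult[OF that]
    by (simp add: power2_sum mult.assoc)
  have "(\<integral>\<omega>. (I f \<omega> + I g \<omega>)\<^sup>2 \<partial>N) = (\<integral>\<omega>. (I (\<lambda>y. f y + g y) \<omega>)\<^sup>2 \<partial>N)"
    by (intro Bochner_Integration.integral_cong) (simp_all add: I_add)
  also have "\<dots> = (\<integral>x. (q (\<lambda>y. f y + g y) x)\<^sup>2 \<partial>S)" by (rule Iq[OF fg])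
  also have "\<dots> = (\<integral>x. (q f x + q g x)\<^sup>2 \<partial>S)"
    by (intro Bochner_Integration.integral_cong) (simp_all add: q_add)
  finally have sum: "(\<integral>\<omega>. (I f \<omega> + I g \<omega>)\<^sup>2 \<partial>N) = (\<integral>x. (q f x + q g x)\<^sup>2 \<partial>S)" .
  have "(\<integral>\<omega>. I f \<omega> * I g \<omega> \<partial>N) = (\<integral>x. q f x * q g x \<partial>S)"
    using sum Iq[OF f] Iq[OF g]
      l2_funD(2)[OF I[OF f]] l2_funD(2)[OF I[OF g]] l2_fun_mult[OF I[OF f] I[OF g]]
      l2_funD(2)[OF q[OF f]] l2_funD(2)[OF q[OF g]] l2_fun_mult[OF q[OF f] q[OF g]]
    by (simp add: power2_sum mult.assoc)
  then show ?thesis by (simp add: I_def q_def)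
qed

theorem lemma3p4:
  fixes a :: real and M :: "'a measure"
    and X :: "'a \<Rightarrow> real" and Xs :: "nat \<Rightarrow> 'a \<Rightarrow> real"
  assumes "0 \<le> a"
    and "prob_space M"
    and "X \<in> borel_measurable M"
    and "prob_space.indep_vars M (\<lambda>_. borel) Xs {1..}"
    and "\<And>j. 1 \<le> j \<Longrightarrow> distr M borel (Xs j) = distr M borel X"
    and "AE \<omega> in M. 0 < X \<omega>"
    and "prob_space.expectation M X = 1"
    and "integrable M (\<lambda>\<omega>. \<bar>X \<omega>\<bar> ^ 3)"
  shows "\<exists>(N :: (real \<Rightarrow> real) set measure) (W :: (real \<Rightarrow> real) set \<Rightarrow> (real \<Rightarrow> real) set).
    prob_space N \<and>
    centred_gaussian_element (exp_weight a) N W \<and>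
    has_covariance_kernel a N W (K_kernel M X (z_fun M (Xs 1))) \<and>
    converges_in_distribution (l2_topology (exp_weight a))
      M (\<lambda>n \<omega>. l2_class (exp_weight a) (W_proc M Xs n \<omega>)) N W"
proof -
  note a = assms(1) and X[measurable] = assms(3)
  interpret M: prob_space M by fact
  let ?L = "exp_weight a"
  define S where "S = distr M borel X"
  define Y where "Y j = Xs (Suc j)" for j
  have sets_S: "sets S = sets borel" by (simp add: S_def)
  interpret S: third_moment_law S
  proof (intro third_moment_law.intro third_moment_law_axioms.intro)
    show "prob_space S" unfolding S_def by (rule M.prob_space_distr[OF X])
    show "integrable S (\<lambda>x. \<bar>x\<bar> ^ 3)" using assms(8) by (simp add: S_def integrable_distr_eq)
    show "(\<integral>x. x \<partial>S) = 1" using assms(7) by (simp add: S_def integral_distr)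
  qed (rule sets_S)
  have indep: "M.indep_vars (\<lambda>_. borel) Y UNIV"
  proof -
    have "M.indep_vars (\<lambda>_. borel) Xs (range Suc)"
      by (rule M.indep_vars_subset[OF assms(4)]) auto
    then show ?thesis unfolding Y_def[abs_def] by (rule M.indep_vars_reindex[rotated]) simp
  qed
  interpret iid_sequence M S Y
  proof
    show "M.indep_vars (\<lambda>_. S) Y UNIV"
      by (rule M.indep_vars_compose2[OF indep]) (simp add: measurable_cong_sets[OF refl sets_S])
    show "distr M S (Y i) = S" for i
    proof -
      have "distr M S (Y i) = distr M borel (Xs (Suc i))" by (rule distr_cong) (auto simp: sets_S Y_def)
      then show ?thesis by (simp add: assms(5) S_def)
    qed
  qed
  have Ym[measurable]: "Y j \<in> borel_measurable M" for j
    using measurable_Y by (simp add: measurable_cong_sets[OF refl sets_S])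
  have Psi: "Psi M X l s = S.P l s" for l s
    unfolding Psi_def S.P_def unfolding S_def by (subst integral_distr) auto
  have tail: "tail_prob M X s = S.tail s" for s
  proof -
    have "S.tail s = measure S {s<..}" unfolding S.tail_def by simp
    also have "\<dots> = measure M (X -` {s<..} \<inter> space M)" unfolding S_def by (rule measure_distr) auto
    also have "X -` {s<..} \<inter> space M = {\<omega> \<in> space M. X \<omega> > s}" by auto
    finally show ?thesis by (simp add: tail_prob_def)
  qed
  have z: "z_fun M (Xs 1) y = S.excess y" for y
  proof -
    have "z_fun M (Xs 1) y = (\<integral>\<omega>. (Y 0 \<omega> - y - 1) * indicator {y<..} (Y 0 \<omega>) \<partial>M)"
      by (simp add: z_fun_def Y_def)
    also have "\<dots> = S.excess y"
      unfolding S.excess_def by (rule integral_Y) measurable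
    finally show ?thesis .
  qed
  have V: "M.variance X = (\<integral>x. (x - 1)\<^sup>2 \<partial>S)"
    unfolding assms(7) S_def by (subst integral_distr) auto
  have K: "K_kernel M X (z_fun M (Xs 1)) s t = (\<integral>x. S.h x s * S.h x t \<partial>S)" for s t
    unfolding K_kernel_def S.h_kernel Psi tail z V ..
  \<comment> \<open>\<open>A n\<close> is the normalized fluctuation of the sample mean and
    \<open>B n\<close> that of the empirical tail. The remainder of the linearization is minus their
    product divided by \<open>sqrt n\<close>.\<close>
  define d where "d x y = indicator {y<..} x - S.tail y" for x y :: real
  define A where "A n \<omega> = normalized_sum (\<lambda>x. x - 1) n \<omega>" for n \<omega>
  define B where "B n \<omega> y = normalized_sum (\<lambda>x. d x y) n \<omega>" for n \<omega> y
  have W_unfold: "W_proc M Xs n \<omega> y = (1 / sqrt (real n)) *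
       (\<Sum>j<n. (Y j \<omega> - y - (\<Sum>j<n. Y j \<omega>) / real n) * indicator {y<..} (Y j \<omega>)) - sqrt (real n) * S.excess y" for n \<omega> y
    unfolding W_proc_def Z_proc_def sample_mean_def z by (simp add: sum.atLeast1_atMost_eq Y_def)
  have W_eq: "W_proc M Xs n \<omega> y
      = normalized_sum (\<lambda>x. S.h x y) n \<omega> + (- (A n \<omega> / sqrt (real n))) * B n \<omega> y" for n \<omega> y
  \<comment> \<open>For \<open>n = 0\<close> all quotients are 0 by convention. This index matters
    because every member of the sequence has to be a random element.\<close>
  proof (cases "n = 0")
    case True
    then show ?thesis by (simp add: W_unfold normalized_sum_def A_def)
  next
    case False
    \<comment> \<open>Writing \<open>n\<close> as \<open>s * s\<close> turns the claim into an
      identity between rational expressions in \<open>s\<close>.\<close>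
    define s where "s = sqrt (real n)"
    have s: "s \<noteq> 0" "real n = s * s" using False by (auto simp: s_def)
    define m where "m = (\<Sum>j<n. Y j \<omega>) / real n"
    define c where "c = (\<Sum>j<n. indicator {y<..} (Y j \<omega>) :: real)"
    define e where "e = (\<Sum>j<n. (Y j \<omega> - 1 - y) * indicator {y<..} (Y j \<omega>))"
    have m: "(\<Sum>j<n. Y j \<omega>) = s * s * m" using False by (simp add: m_def s(2)[symmetric])
    have W: "W_proc M Xs n \<omega> y = (e + (1 - m) * c) / s - s * S.excess y"
    proof -
      have "(\<Sum>j<n. (Y j \<omega> - y - m) * indicator {y<..} (Y j \<omega>))
          = (\<Sum>j<n. (Y j \<omega> - 1 - y) * indicator {y<..} (Y j \<omega>) + (1 - m) * indicator {y<..} (Y j \<omega>))"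
        by (intro sum.cong refl) (simp add: algebra_simps)
      also have "\<dots> = e + (1 - m) * c" by (simp add: e_def c_def sum.distrib sum_distrib_left)
      finally show ?thesis unfolding W_unfold m_def[symmetric] s_def[symmetric] by simp
    qed
    have h: "normalized_sum (\<lambda>x. S.h x y) n \<omega> = (e - (s * s * m - s * s) * S.tail y - s * s * S.excess y) / s"
      unfolding normalized_sum_def S.h_def s_def[symmetric]
      by (simp add: sum_subtractf e_def[symmetric] sum_distrib_right[symmetric] m s(2))
    have A: "A n \<omega> = (s * s * m - s * s) / s"
      unfolding A_def normalized_sum_def s_def[symmetric] by (simp add: sum_subtractf m s(2))
    have B: "B n \<omega> y = (c - s * s * S.tail y) / s"
      unfolding B_def d_def normalized_sum_def s_def[symmetric] by (simp add: sum_subtractf c_def s(2))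
    show ?thesis unfolding W h A B s_def[symmetric] using s(1) by (simp add: field_simps)
  qed
  have d_l2: "d x \<in> l2_fun ?L" for x
    unfolding d_def[abs_def] by (intro l2_fun_diff indicator_l2_fun(1) S.tail_l2 a)
  have d_meas: "(\<lambda>(x, y). d x y) \<in> borel_measurable (S \<Otimes>\<^sub>M ?L)"
  proof -
    have "(\<lambda>p. (fst p, snd p)) \<in> measurable (S \<Otimes>\<^sub>M ?L) (borel \<Otimes>\<^sub>M borel)"
      by (intro measurable_Pair measurable_compose[OF measurable_snd measurable_exp_weight_ident]) measurable
    from measurable_compose[OF this, of "\<lambda>(x, y). d x y" borel] show ?thesis by (simp add: d_def)
  qed
  have d_l2_S: "(\<lambda>x. d x y) \<in> l2_fun S" for y
    unfolding d_def by (intro l2_fun_diff S.indicator_l2) (simp add: l2_fun_def)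
  have d_mean: "(\<integral>x. d x y \<partial>S) = 0" for y
    unfolding d_def using S.l2_imp_integrable[OF S.indicator_l2] S.prob_space by (simp add: S.tail_def)
  have B_l2: "B n \<omega> \<in> l2_fun ?L" if "\<omega> \<in> space M" for n \<omega>
    unfolding B_def[abs_def] by (rule normalized_sum_l2_fun[OF d_l2 that])
  have W_l2: "W_proc M Xs n \<omega> \<in> l2_fun ?L" if \<omega>: "\<omega> \<in> space M" for n \<omega>
    unfolding W_eq[abs_def] by (intro l2_fun_add l2_fun_cmult normalized_sum_l2_fun S.h_l2 a B_l2 \<omega>)
  have W_re: "random_element (l2_topology ?L) M (\<lambda>\<omega>. l2_class ?L (W_proc M Xs n \<omega>))" for n
  proof (rule random_element_right_continuous[OF a W_l2])
    \<comment> \<open>With the indicators and \<open>zeta\<close> taken at \<open>y\<close>, this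
      bounds the process at every \<open>r\<close> with \<open>y \<le> r\<close>.\<close>
    define Q where "Q \<omega> y = (1 / sqrt (real n)) * (\<Sum>j<n. (\<bar>Y j \<omega>\<bar> + \<bar>(\<Sum>j<n. Y j \<omega>) / real n\<bar>) * indicator {y<..} (Y j \<omega>))
        + sqrt (real n) * S.zeta y" for \<omega> y
    show "Q \<omega> \<in> l2_fun ?L" for \<omega>
      unfolding Q_def[abs_def] by (intro l2_fun_add l2_fun_cmult l2_fun_sum indicator_l2_fun(1) S.zeta_l2 a)
    show "(W_proc M Xs n \<omega> \<longlongrightarrow> W_proc M Xs n \<omega> y) (at_right y)" if "0 \<le> y" for \<omega> y
      unfolding W_unfold[abs_def] by (intro tendsto_intros indicator_greaterThan_tendsto S.excess_right_continuous that)
    show "\<bar>W_proc M Xs n \<omega> r\<bar> \<le> Q \<omega> y" if y: "0 \<le> y" "y \<le> r" for \<omega> y r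
    proof -
      define m where "m = (\<Sum>j<n. Y j \<omega>) / real n"
      have "\<bar>(\<Sum>j<n. (Y j \<omega> - r - m) * indicator {r<..} (Y j \<omega>))\<bar>
          \<le> (\<Sum>j<n. \<bar>(Y j \<omega> - r - m) * indicator {r<..} (Y j \<omega>)\<bar>)" by (rule sum_abs)
      also have "\<dots> \<le> (\<Sum>j<n. (\<bar>Y j \<omega>\<bar> + \<bar>m\<bar>) * indicator {y<..} (Y j \<omega>))"
        using y by (intro sum_mono) (auto simp: indicator_def)
      finally have 1: "\<bar>(1 / sqrt (real n)) * (\<Sum>j<n. (Y j \<omega> - r - m) * indicator {r<..} (Y j \<omega>))\<bar>
          \<le> (1 / sqrt (real n)) * (\<Sum>j<n. (\<bar>Y j \<omega>\<bar> + \<bar>m\<bar>) * indicator {y<..} (Y j \<omega>))"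
        unfolding abs_mult by (intro mult_mono) auto
      have "\<bar>S.excess r\<bar> \<le> S.zeta y" using S.excess_le_zeta[of r] S.zeta_mono[OF y(2)] y by linarith
      then have 2: "\<bar>sqrt (real n) * S.excess r\<bar> \<le> sqrt (real n) * S.zeta y"
        unfolding abs_mult by (intro mult_mono) auto
      show ?thesis unfolding W_unfold Q_def using 1 2 unfolding m_def by linarith
    qed
    show "(\<lambda>\<omega>. W_proc M Xs n \<omega> r) \<in> borel_measurable M" for r
      unfolding W_unfold by measurable
  qed
  \<comment> \<open>The product of \<open>\<bar>A n \<omega>\<bar>\<close> and the norm of
    \<open>B n \<omega>\<close> is at most the sum of their squares, whose mean is bounded in
    \<open>n\<close>; so the mean of \<open>\<beta> n\<close> is of order
    \<open>1 / sqrt n\<close>.\<close>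
  define \<beta> where "\<beta> n \<omega> = ennreal (1 / sqrt (real n)) * (ennreal ((A n \<omega>)\<^sup>2) + ennreal ((l2_norm ?L (B n \<omega>))\<^sup>2))" for n \<omega>
  have [measurable]: "A n \<in> borel_measurable M" for n
    unfolding A_def[abs_def] by (rule l2_funD(1)[OF normalized_sum_l2[OF S.centred_l2]])
  have [measurable]: "(\<lambda>\<omega>. l2_norm ?L (B n \<omega>)) \<in> borel_measurable M" for n
    unfolding B_def[abs_def] by (rule normalized_sum_norm_measurable[OF sigma_finite_exp_weight d_meas])
  have \<beta>_meas: "\<beta> n \<in> borel_measurable M" for n unfolding \<beta>_def by measurable
  have close: "ennreal (l2_norm ?L (\<lambda>y. W_proc M Xs n \<omega> y - normalized_sum (\<lambda>x. S.h x y) n \<omega>)) \<le> \<beta> n \<omega>" for n \<omega>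
  proof -
    have "l2_norm ?L (\<lambda>y. W_proc M Xs n \<omega> y - normalized_sum (\<lambda>x. S.h x y) n \<omega>)
        = \<bar>A n \<omega>\<bar> * l2_norm ?L (B n \<omega>) * (1 / sqrt (real n))"
      unfolding W_eq add_diff_cancel_left' l2_norm_cmult by simp
    also have "\<dots> \<le> ((A n \<omega>)\<^sup>2 + (l2_norm ?L (B n \<omega>))\<^sup>2) * (1 / sqrt (real n))"
    proof (rule mult_right_mono)
      have "0 \<le> \<bar>A n \<omega>\<bar> * l2_norm ?L (B n \<omega>)" by simp
      then show "\<bar>A n \<omega>\<bar> * l2_norm ?L (B n \<omega>) \<le> (A n \<omega>)\<^sup>2 + (l2_norm ?L (B n \<omega>))\<^sup>2"
        using sum_squares_bound[of "\<bar>A n \<omega>\<bar>" "l2_norm ?L (B n \<omega>)"]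
        unfolding power2_abs mult.assoc by linarith
    qed simp
    finally have "ennreal (l2_norm ?L (\<lambda>y. W_proc M Xs n \<omega> y - normalized_sum (\<lambda>x. S.h x y) n \<omega>))
        \<le> ennreal (((A n \<omega>)\<^sup>2 + (l2_norm ?L (B n \<omega>))\<^sup>2) * (1 / sqrt (real n)))" by (rule ennreal_leI)
    also have "\<dots> = \<beta> n \<omega>"
      unfolding \<beta>_def by (subst ennreal_mult) (simp_all add: mult.commute)
    finally show ?thesis .
  qed
  have \<beta>_lim: "(\<lambda>n. \<integral>\<^sup>+\<omega>. \<beta> n \<omega> \<partial>M) \<longlonglongrightarrow> 0"
  proof (rule tendsto_sandwich[OF _ _ tendsto_const])
    \<comment> \<open>Since \<open>1 \<le> wt x\<close>, the absolute value of \<open>d x\<close> is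
      below \<open>D x\<close>, so \<open>envelope\<close> serves for the empirical tail
      too.\<close>
    define C where "C = (\<integral>x. (x - 1)\<^sup>2 \<partial>S) + (\<integral>x. S.envelope a x \<partial>S)"
    have env: "0 \<le> S.envelope a x" for x using order_trans[OF zero_le_power2 S.h_norm_envelope[OF a]] .
    have bound: "(\<integral>\<^sup>+\<omega>. \<beta> n \<omega> \<partial>M) \<le> ennreal (1 / sqrt (real n) * C)" for n
    proof -
      have "(\<integral>\<^sup>+\<omega>. ennreal ((A n \<omega>)\<^sup>2) \<partial>M) = ennreal (\<integral>\<omega>. (A n \<omega>)\<^sup>2 \<partial>M)"
        unfolding A_def by (intro nn_integral_eq_integral l2_funD(2) normalized_sum_l2 S.centred_l2) auto
      also have "\<dots> \<le> ennreal (\<integral>x. (x - 1)\<^sup>2 \<partial>S)"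
        unfolding A_def by (intro ennreal_leI) (simp add: normalized_sum_second_moment[OF S.centred_l2 S.centred_mean])
      finally have 1: "(\<integral>\<^sup>+\<omega>. ennreal ((A n \<omega>)\<^sup>2) \<partial>M) \<le> ennreal (\<integral>x. (x - 1)\<^sup>2 \<partial>S)" .
      have "(\<integral>\<^sup>+\<omega>. ennreal ((l2_norm ?L (B n \<omega>))\<^sup>2) \<partial>M) \<le> (\<integral>\<^sup>+x. ennreal (\<integral>y. (d x y)\<^sup>2 \<partial>?L) \<partial>S)"
        unfolding B_def[abs_def]
        by (rule normalized_sum_process_moment[OF sigma_finite_exp_weight d_meas d_l2 d_l2_S d_mean])
      also have "\<dots> \<le> (\<integral>\<^sup>+x. ennreal (S.envelope a x) \<partial>S)"
      proof (intro nn_integral_mono ennreal_leI)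
        fix x
        have "(\<integral>y. (d x y)\<^sup>2 \<partial>?L) \<le> (\<integral>y. (S.D x y)\<^sup>2 \<partial>?L)"
        proof (rule integral_mono[OF l2_funD(2)[OF d_l2] l2_funD(2)[OF S.D_l2[OF a]]])
          fix y
          have "\<bar>d x y\<bar> \<le> indicator {y<..} x + S.tail y"
            using S.tail_nonneg[of y] by (cases "y < x") (simp_all add: d_def abs_le_iff)
          also have "\<dots> \<le> S.wt x * (indicator {y<..} x + S.tail y)"
            using S.tail_nonneg[of y] mult_right_mono[OF S.wt_ge_1[of x], of "indicator {y<..} x + S.tail y"] by simp
          also have "\<dots> \<le> S.D x y" using S.zeta_nonneg[of y] by (simp add: S.D_def distrib_left)
          finally have "\<bar>d x y\<bar>\<^sup>2 \<le> (S.D x y)\<^sup>2" by (intro power_mono) auto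
          then show "(d x y)\<^sup>2 \<le> (S.D x y)\<^sup>2" by simp
        qed
        also have "\<dots> \<le> S.envelope a x" by (rule S.D_envelope[OF a])
        finally show "(\<integral>y. (d x y)\<^sup>2 \<partial>?L) \<le> S.envelope a x" .
      qed
      also have "\<dots> = ennreal (\<integral>x. S.envelope a x \<partial>S)"
        by (rule nn_integral_eq_integral[OF S.envelope_integrable]) (simp add: env)
      finally have 2: "(\<integral>\<^sup>+\<omega>. ennreal ((l2_norm ?L (B n \<omega>))\<^sup>2) \<partial>M) \<le> ennreal (\<integral>x. S.envelope a x \<partial>S)" .
      have "(\<integral>\<^sup>+\<omega>. \<beta> n \<omega> \<partial>M) = ennreal (1 / sqrt (real n)) *
          ((\<integral>\<^sup>+\<omega>. ennreal ((A n \<omega>)\<^sup>2) \<partial>M) + (\<integral>\<^sup>+\<omega>. ennreal ((l2_norm ?L (B n \<omega>))\<^sup>2) \<partial>M))"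
        unfolding \<beta>_def by (subst nn_integral_cmult) (auto simp: nn_integral_add)
      also have "\<dots> \<le> ennreal (1 / sqrt (real n)) * (ennreal (\<integral>x. (x - 1)\<^sup>2 \<partial>S) + ennreal (\<integral>x. S.envelope a x \<partial>S))"
        by (intro mult_left_mono add_mono 1 2) simp
      also have "\<dots> = ennreal (1 / sqrt (real n) * C)"
        unfolding C_def using env by (subst ennreal_mult) (auto intro!: add_nonneg_nonneg integral_nonneg_AE)
      finally show ?thesis .
    qed
    then show "\<forall>\<^sub>F n in sequentially. (\<integral>\<^sup>+\<omega>. \<beta> n \<omega> \<partial>M) \<le> ennreal (1 / sqrt (real n) * C)" by simp
    have "(\<lambda>n. 1 / sqrt (real n)) \<longlonglongrightarrow> 0"
      using tendsto_inverse_0_at_top[OF filterlim_compose[OF sqrt_at_top filterlim_real_sequentially]]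
      by (simp add: inverse_eq_divide)
    from tendsto_ennrealI[OF tendsto_mult_left_zero[OF this, of C]]
    show "(\<lambda>n. ennreal (1 / sqrt (real n) * C)) \<longlonglongrightarrow> 0" by simp
  qed simp
  \<comment> \<open>The functions \<open>v i\<close> of the central limit theorem are the values of
    \<open>h\<close> at the points \<open>\<bar>rat_seq i\<bar>\<close>, centred and
    square-integrable as at any fixed point; the functions \<open>c k i\<close> are
    \<open>rat_step (r k) i\<close>.\<close>
  obtain r where r: "\<And>k. (\<integral>\<^sup>+x. ennreal (\<integral>y. (S.h x y - (\<Sum>i<r k. S.h x \<bar>rat_seq i\<bar> * rat_step (r k) i y))\<^sup>2 \<partial>?L) \<partial>S)
      \<le> ennreal ((1/4) ^ k)"
  proof (rule rat_step_approximation[OF a S.h_measurable_exp_weight S.h_l2[OF a] _ S.D_l2[OF a]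
        S.h_right_continuous S.h_dominated S.D_envelope[OF a] S.envelope_integrable])
    show "(\<lambda>x. S.h x r) \<in> borel_measurable S" for r by (rule l2_funD(1)[OF S.h_l2_S])
  qed (assumption | rule that)+
  obtain N0 :: "(nat \<Rightarrow> real) measure" and W0 where N0: "prob_space N0" and gauss: "centred_gaussian_element ?L N0 W0"
    and l2: "\<And>F. F \<in> L2 ?L \<Longrightarrow> (\<lambda>\<omega>. l2_inner ?L (W0 \<omega>) F) \<in> l2_fun N0"
    and var: "\<And>F. F \<in> L2 ?L \<Longrightarrow> (\<integral>\<omega>. (l2_inner ?L (W0 \<omega>) F)\<^sup>2 \<partial>N0) = (\<integral>x. (\<integral>y. S.h x y * l2_rep F y \<partial>?L)\<^sup>2 \<partial>S)"
    and conv: "converges_in_distribution (l2_topology ?L) M (\<lambda>n \<omega>. l2_class ?L (W_proc M Xs n \<omega>)) N0 W0"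
    by (rule l2_central_limit[OF sigma_finite_exp_weight S.h_measurable_exp_weight S.h_l2[OF a] S.h_l2_S S.h_mean
          S.h_l2_S S.h_mean rat_step_l2[OF a] r W_l2 W_re \<beta>_meas close \<beta>_lim]) (assumption | rule that)+
  have W0: "random_element (l2_topology ?L) N0 W0" using gauss by (simp add: centred_gaussian_element_def)
  have cov: "has_covariance_kernel a N0 W0 (K_kernel M X (z_fun M (Xs 1)))"
    unfolding has_covariance_kernel_def Let_def
  proof (intro ballI conjI)
    fix f g assume f: "f \<in> l2_fun ?L" and g: "g \<in> l2_fun ?L"
    show "integrable N0 (\<lambda>\<omega>. l2_inner ?L (W0 \<omega>) (l2_class ?L f) * l2_inner ?L (W0 \<omega>) (l2_class ?L g))"
      by (intro l2_fun_mult l2 l2_class_in_L2 f g)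
    show "set_integrable (lborel \<Otimes>\<^sub>M lborel) ({0..} \<times> {0..})
        (\<lambda>(s, t). K_kernel M X (z_fun M (Xs 1)) s t * f s * g t * exp (- a * (s + t)))"
      by (rule S.covariance_kernel(1)[OF a f g K])
    show "(\<integral>\<omega>. l2_inner ?L (W0 \<omega>) (l2_class ?L f) * l2_inner ?L (W0 \<omega>) (l2_class ?L g) \<partial>N0)
        = (LINT t:{0..}|lborel. (LINT s:{0..}|lborel. K_kernel M X (z_fun M (Xs 1)) s t * f s * g t * exp (- a * (s + t))))"
      unfolding S.covariance_kernel(2)[OF a f g K]
      by (rule centred_gaussian_covariance[OF W0 l2 var S.h_l2[OF a] S.inner_h_l2[OF a] f g])
  qed
  \<comment> \<open>\<open>N0\<close> lives on sequences of reals; passing to the law of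
    \<open>W0\<close> gives a probability space made of classes of functions.\<close>
  show ?thesis
    using canonical_random_element[OF N0 W0] gauss cov conv by blast
qed

end
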